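(* Let $p$ be a prime and let $(k,p)$ satisfy one of: (1) $k=3$ and $p=6t+1$ for some positive integer $t$; (2) $k=4$ and $p=12t+1$ for some odd positive integer $t$; (3a) $k=5$ and $p=20t+1$ for some positive integer $t$, with $p<10^3$; (3b) $k=5$ and $p=20t+1$ for some positive integer $t$ such that $\varepsilon+1$ is not a $2^{e+1}$-th power in $\mathbb{Z}_p$ (equivalently, $(11+5\sqrt5)/2$ is not a $2^{e+1}$-th power in $\mathbb{Z}_p$), where $2^e$ is the largest power of $2$ dividing $t$ and $\varepsilon$ is a primitive $5$-th root of unity in $\mathbb{Z}_p$; (4) $k=7$ and $p=42t+1$ for some positive integer $t$ such that there is an integer $f$ with $3^f\mid t$ and $\varepsilon+1$, $\varepsilon^2+\varepsilon+1$, $\frac{\varepsilon^2+\varepsilon+1}{\varepsilon+1}$ are $3^f$-th powers but not $3^{f+1}$-th powers in $\mathbb{Z}_p$, where $\varepsilon$ is a primitive $7$-th root of unity in $\mathbb{Z}_p$; (5) $k=9$ and $p\in\{73,1153,1873,2017,6481,7489,7561\}$. Then there exists a $\mathrm{CRCBIBD}(pk,k,1)$, and the LDPC code based on it is a $(k,r)$-regular LDPC code of length $pr$ and rate at least $(r-k)/r$, where $r=(pk-1)/(k-1)$. Moreover, there exists a $\mathrm{CRCBIBD}(\ell k,k,1)$, and the LDPC code based on it is a $(k,r)$-regular LDPC code of length $\ell r$ and rate at least $(r-k)/r$, where $r=(\ell k-1)/(k-1)$, in the following cases: (6) $k\in\{3,5,7,9\}$ and $\ell$ is a product of primes $p\equiv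 1\pmod{k(k-1)}$ each of which satisfies, for that $k$, the condition of one of the cases (1), (3a), (3b), (4), (5) above; (7) $k=4$ and $\ell$ is a product of primes of the form $p=12t+1$ with $t$ odd.
   Context: A $\mathrm{BIBD}(v,k,\lambda)$ is a pair $(X,\mathcal{B})$ where $X$ is a set of $v$ points and $\mathcal{B}$ a collection of $k$-subsets (blocks) such that every pair of distinct points lies in exactly $\lambda$ blocks; each point lies in $r$ blocks, with $\lambda(v-1)=r(k-1)$ and $bk=vr$, $b=|\mathcal{B}|$. For a permutation $\sigma$ of $X$, $\sigma$ is an automorphism if it maps $\mathcal{B}$ onto itself (blockwise). The design is resolvable if $\mathcal{B}$ can be partitioned into resolution classes $\mathcal{R}_1,\dots,\mathcal{R}_r$, each partitioning $X$. A $\mathrm{CRCBIBD}(v,k,\lambda)$ (cyclically resolvable cyclic BIBD) is a resolvable BIBD with an automorphism $\sigma$ of order $v$ (so $X$ can be identified with $\mathbb{Z}_v$ and $\sigma: i\mapsto i+1$) that also preserves some resolution, i.e. $\{\mathcal{R}_1^\sigma,\dots,\mathcal{R}_r^\sigma\}=\{\mathcal{R}_1,\dots,\mathcal{R}_r\}$. The LDPC code based on the design is the binary linear code having the $v\times b$ point-block incidence matrix as parity-check matrix $H$. The code is $(k,r)$-regular if all columns of $H$ have weight $k$ and all rows weight $r$; its rate is $(b-\mathrm{rank}_2(H))/b$, with $b$ the length. *)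

theory Defs
  imports "HOL-Library.Z2" "HOL-Number_Theory.Number_Theory" "Jordan_Normal_Form.DL_Rank"
begin

text \<open>A BIBD(v,k,lambda) on the points {0..<v}; the blocks form a (finite) set of k-subsets.
  (Since only lambda = 1 is used, blocks cannot repeat, so a set of blocks suffices.)\<close>
definition bibd :: "nat \<Rightarrow> nat \<Rightarrow> nat \<Rightarrow> nat set set \<Rightarrow> bool" where
  "bibd v k lam B \<longleftrightarrow>
     finite B \<and>
     (\<forall>b\<in>B. b \<subseteq> {..<v} \<and> card b = k) \<and>
     (\<forall>x<v. \<forall>y<v. x \<noteq> y \<longrightarrow> card {b\<in>B. x \<in> b \<and> y \<in> b} = lam)"

definition resolution :: "nat \<Rightarrow> nat set set \<Rightarrow> nat set set set \<Rightarrow> bool" where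
  "resolution v B R \<longleftrightarrow>
     (\<forall>C\<in>R. C \<noteq> {} \<and> (\<forall>b\<in>C. \<forall>b'\<in>C. b \<noteq> b' \<longrightarrow> b \<inter> b' = {}) \<and> \<Union>C = {..<v}) \<and>
     (\<forall>C\<in>R. \<forall>C'\<in>R. C \<noteq> C' \<longrightarrow> C \<inter> C' = {}) \<and>
     \<Union>R = B"

definition shift :: "nat \<Rightarrow> nat set \<Rightarrow> nat set" where
  "shift v b = (\<lambda>i. (i + 1) mod v) ` b"

definition crcbibd :: "nat \<Rightarrow> nat \<Rightarrow> nat \<Rightarrow> nat set set \<Rightarrow> nat set set set \<Rightarrow> bool" where
  "crcbibd v k lam B R \<longleftrightarrow>
     bibd v k lam B \<and> resolution v B R \<and>
     shift v ` B = B \<and> (\<lambda>C. shift v ` C) ` R = R"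

definition inc_mat :: "nat \<Rightarrow> nat set list \<Rightarrow> bit mat" where
  "inc_mat v bs = mat v (length bs) (\<lambda>(i, j). if i \<in> bs ! j then 1 else 0)"

definition regular_ldpc :: "bit mat \<Rightarrow> nat \<Rightarrow> nat \<Rightarrow> bool" where
  "regular_ldpc H k r \<longleftrightarrow>
     (\<forall>j<dim_col H. card {i. i < dim_row H \<and> H $$ (i, j) \<noteq> 0} = k) \<and>
     (\<forall>i<dim_row H. card {j. j < dim_col H \<and> H $$ (i, j) \<noteq> 0} = r)"

definition code_length :: "bit mat \<Rightarrow> nat" where
  "code_length H = dim_col H"

definition code_rate :: "bit mat \<Rightarrow> real" where
  "code_rate H = (real (dim_col H) - real (vec_space.rank (dim_row H) H)) / real (dim_col H)"

definition crc_ldpc_result :: "nat \<Rightarrow> nat \<Rightarrow> bool" where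
  "crc_ldpc_result k l \<longleftrightarrow>
     (let r = (l * k - 1) div (k - 1) in
      \<exists>bs R. distinct bs \<and> crcbibd (l * k) k 1 (set bs) R \<and>
        regular_ldpc (inc_mat (l * k) bs) k r \<and>
        code_length (inc_mat (l * k) bs) = l * r \<and>
        code_rate (inc_mat (l * k) bs) \<ge> (real r - real k) / real r)"

definition is_power_mod :: "nat \<Rightarrow> nat \<Rightarrow> nat \<Rightarrow> bool" where
  "is_power_mod p m x \<longleftrightarrow> (\<exists>y. [y ^ m = x] (mod p))"

definition prim_root_unity :: "nat \<Rightarrow> nat \<Rightarrow> nat \<Rightarrow> bool" where
  "prim_root_unity p n eps \<longleftrightarrow> ord p eps = n"

definition case1 :: "nat \<Rightarrow> nat \<Rightarrow> bool" where
  "case1 k p \<longleftrightarrow> k = 3 \<and> (\<exists>t>0. p = 6 * t + 1)"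

definition case2 :: "nat \<Rightarrow> nat \<Rightarrow> bool" where
  "case2 k p \<longleftrightarrow> k = 4 \<and> (\<exists>t>0. odd t \<and> p = 12 * t + 1)"

definition case3a :: "nat \<Rightarrow> nat \<Rightarrow> bool" where
  "case3a k p \<longleftrightarrow> k = 5 \<and> (\<exists>t>0. p = 20 * t + 1) \<and> p < 10 ^ 3"

definition case3b :: "nat \<Rightarrow> nat \<Rightarrow> bool" where
  "case3b k p \<longleftrightarrow> k = 5 \<and>
     (\<exists>t>0. p = 20 * t + 1 \<and>
        (\<forall>e. 2 ^ e dvd t \<and> \<not> 2 ^ (e + 1) dvd t \<longrightarrow>
           (\<exists>eps. prim_root_unity p 5 eps \<and> \<not> is_power_mod p (2 ^ (e + 1)) (eps + 1))))"

definition case4 :: "nat \<Rightarrow> nat \<Rightarrow> bool" where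
  "case4 k p \<longleftrightarrow> k = 7 \<and>
     (\<exists>t>0. p = 42 * t + 1 \<and>
        (\<exists>f. 3 ^ f dvd t \<and>
           (\<exists>eps. prim_root_unity p 7 eps \<and>
              is_power_mod p (3 ^ f) (eps + 1) \<and>
              \<not> is_power_mod p (3 ^ (f + 1)) (eps + 1) \<and>
              is_power_mod p (3 ^ f) (eps\<^sup>2 + eps + 1) \<and>
              \<not> is_power_mod p (3 ^ (f + 1)) (eps\<^sup>2 + eps + 1) \<and>
              (\<forall>z. [z * (eps + 1) = eps\<^sup>2 + eps + 1] (mod p) \<longrightarrow>
                 is_power_mod p (3 ^ f) z \<and> \<not> is_power_mod p (3 ^ (f + 1)) z))))"

definition case5 :: "nat \<Rightarrow> nat \<Rightarrow> bool" where
  "case5 k p \<longleftrightarrow> k = 9 \<and> p \<in> {73, 1153, 1873, 2017, 6481, 7489, 7561}"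

end

theory Submission
  imports Defs
begin

text \<open>A cyclically resolvable cyclic design on \<open>\<int>\<^bsub>lk\<^esub>\<close> is developed from base blocks and the short block \<open>l\<int>\<^bsub>lk\<^esub>\<close>:
  the differences of the base blocks have to cover each \<open>d\<close> not divisible by \<open>l\<close> exactly once. The blocks
  indexed by \<open>I - J\<close> cover the nonzero residues modulo \<open>l\<close>, so that together with the short block their
  translates by multiples of \<open>l\<close> form a resolution class; a block indexed by \<open>J\<close> covers the residues modulo
  \<open>k\<close>, so that its translates by multiples of \<open>k\<close> form one. Inflating such a family by a difference
  matrix multiplies \<open>l\<close>, which reduces everything to primes.

  For a prime \<open>p\<close> work in \<open>\<int>\<^bsub>p\<^esub> \<times> \<int>\<^bsub>k\<^esub>\<close>. If \<open>k\<close> is odd and \<open>\<epsilon>\<close> has order \<open>k\<close> modulo \<open>p\<close>, a \<open>(p, k, 1)\<close> difference family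
  whose blocks are disjoint with union closed under \<open>\<epsilon>\<close> is completed by the blocks \<open>{(m \<epsilon>\<^sup>i, i)}\<close>. Blocks of the
  form \<open>m \<langle>\<epsilon>\<rangle>\<close> give such a family as soon as the logarithms of the \<open>1 - \<epsilon>\<^sup>d\<close> tile, which the hypotheses on power
  residues ensure through a digit of the logarithm. For \<open>k = 4\<close> the blocks are multiples of four tetrads
  whose points and differences are, up to roots of unity, products of powers of \<open>1 + i\<close>, \<open>\<surd>3\<close> and a fundamental
  unit of \<open>\<rat>(\<zeta>\<^sub>1\<^sub>2)\<close>. Whether this works depends only on the logarithms of these numbers modulo 4 and on
  one 3-adic digit of them, and tables of tetrads settle the finitely many cases.\<close>

section \<open>Designs from cyclic families\<close>

text \<open>Every construction over a prime is a factorisation of the cyclic group of logarithms: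
  the logarithms of the multipliers, described by a predicate \<open>A\<close>, plus finitely many
  logarithms of differences must give each residue modulo \<open>p - 1\<close> exactly once. The
  hypotheses do not fix the power of 2 or 3 that divides the logarithms involved, so no subgroup of
  multipliers can be named in advance. Asking that one digit of the logarithm vanishes works at any
  position; the resulting set is in general not a subgroup, which is why multipliers are given by
  predicates on logarithms. For k = 4 the digit is read at the largest \<open>G\<close> such that
  \<open>3 ^ G\<close> divides the logarithms of all four generators, so at least one of the four
  digits is non-zero. The root of unity, 1 + i and the square root of 3 do not suffice: if their
  digits are all 0, the twelve differences of each of the four tetrads share one digit, whereas each
  digit has to occur sixteen times among the 48 differences. The fundamental unit removes this
  obstruction.\<close>

lemma cong_dvd_modulus_left: "[a = b] (mod m * n) \<Longrightarrow> [a = b] (mod m)" for a b :: int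
  by (meson cong_dvd_modulus dvd_triv_left)

lemma cong_dvd_modulus_right: "[a = b] (mod m * n) \<Longrightarrow> [a = b] (mod n)" for a b :: int
  by (meson cong_dvd_modulus dvd_triv_right)

text \<open>The conditions fall into three groups: those on differences give the pair count, those
  on residues modulo \<open>l\<close> give the classes that contain a short block, and the
  transversality modulo \<open>k\<close> gives one family of classes for each block of
  \<open>J\<close>. The index type is free, so that constructions may index blocks by pairs and
  disjoint sums.\<close>

locale crc_family =
  fixes k l :: nat and I J :: "'i set" and Z :: "'i \<Rightarrow> nat \<Rightarrow> int"
  assumes k_gt: "1 < k" and l_pos: "0 < l" and fin: "finite I" and J_sub: "J \<subseteq> I"
    and diff_nz: "\<And>b i j. b \<in> I \<Longrightarrow> i < k \<Longrightarrow> j < k \<Longrightarrow> i \<noteq> j \<Longrightarrow> \<not> int l dvd Z b i - Z b j"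
    and diff_ex: "\<And>d. \<not> int l dvd d \<Longrightarrow>
      \<exists>b\<in>I. \<exists>i<k. \<exists>j<k. [Z b i - Z b j = d] (mod int l * int k)"
    and diff_unique: "\<And>b b' i j i' j'. b \<in> I \<Longrightarrow> b' \<in> I \<Longrightarrow> i < k \<Longrightarrow> j < k \<Longrightarrow> i \<noteq> j \<Longrightarrow>
      i' < k \<Longrightarrow> j' < k \<Longrightarrow> [Z b i - Z b j = Z b' i' - Z b' j'] (mod int l * int k) \<Longrightarrow>
      b = b' \<and> i = i' \<and> j = j'"
    and res_nz: "\<And>b i. b \<in> I - J \<Longrightarrow> i < k \<Longrightarrow> \<not> int l dvd Z b i"
    and res_ex: "\<And>x. \<not> int l dvd x \<Longrightarrow> \<exists>b\<in>I - J. \<exists>i<k. [Z b i = x] (mod int l)"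
    and res_unique: "\<And>b b' i i'. b \<in> I - J \<Longrightarrow> b' \<in> I - J \<Longrightarrow> i < k \<Longrightarrow> i' < k \<Longrightarrow>
      [Z b i = Z b' i'] (mod int l) \<Longrightarrow> b = b' \<and> i = i'"
    and leave_ex: "\<And>b c. b \<in> J \<Longrightarrow> \<exists>i<k. [Z b i = c] (mod int k)"
    and leave_unique: "\<And>b i i'. b \<in> J \<Longrightarrow> i < k \<Longrightarrow> i' < k \<Longrightarrow>
      [Z b i = Z b i'] (mod int k) \<Longrightarrow> i = i'"
begin

abbreviation m :: int where "m \<equiv> int l * int k"

definition trans :: "(nat \<Rightarrow> int) \<Rightarrow> int \<Rightarrow> nat set" where
  "trans f s = (\<lambda>i. nat ((f i + s) mod m)) ` {..<k}"

abbreviation blk :: "'i \<Rightarrow> int \<Rightarrow> nat set" where "blk b \<equiv> trans (Z b)"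

abbreviation spread :: "int \<Rightarrow> nat set" where "spread \<equiv> trans (\<lambda>i. int l * int i)"

lemma m_pos: "0 < m"
  using k_gt l_pos by simp

lemma mem_trans: "n \<in> trans f s \<longleftrightarrow> n < l * k \<and> (\<exists>i<k. [int n = f i + s] (mod m))"
proof
  assume "n \<in> trans f s"
  then obtain i where i: "i < k" "n = nat ((f i + s) mod m)"
    by (auto simp: trans_def)
  then have "int n = (f i + s) mod m"
    using m_pos by simp
  moreover have "(f i + s) mod m < m"
    using m_pos by simp
  ultimately show "n < l * k \<and> (\<exists>i<k. [int n = f i + s] (mod m))"
    using i by (metis cong_mod_left cong_refl of_nat_less_iff of_nat_mult)
next
  assume "n < l * k \<and> (\<exists>i<k. [int n = f i + s] (mod m))"
  then obtain i where i: "i < k" "[int n = f i + s] (mod m)" and n: "n < l * k"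
    by auto
  have "int n = int n mod m"
    using n by (metis mod_less of_nat_mod of_nat_mult)
  then have "n = nat ((f i + s) mod m)"
    using i(2) by (metis cong_def nat_int)
  then show "n \<in> trans f s"
    using i(1) by (auto simp: trans_def)
qed

text \<open>If \<open>n = a + l q\<close>, then \<open>q\<close> may be reduced modulo
  \<open>k\<close> because \<open>l k\<close> vanishes. So these translates form the short orbit,
  the cosets of the subgroup of order \<open>k\<close>, and they carry exactly the differences
  divisible by \<open>l\<close>.\<close>

lemma mem_spread: "n \<in> spread a \<longleftrightarrow> n < l * k \<and> [int n = a] (mod int l)"
proof -
  have "\<exists>i<k. [int n = int l * int i + a] (mod m)" if eq: "[int n = a] (mod int l)"
  proof -
    obtain q where q: "int n = a + int l * q"
      using eq by (metis cong_iff_lin cong_sym)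
    define i where "i = nat (q mod int k)"
    have i: "int i = q mod int k" "i < k"
      using k_gt by (auto simp: i_def nat_less_iff)
    have "int l dvd int l" by simp
    have "[q = int i] (mod int k)"
      by (simp add: i(1) cong_def)
    then have "m dvd int l * q - int l * int i"
      by (metis cong_iff_dvd_diff mult_dvd_mono dvd_refl right_diff_distrib)
    then have "[int n = int l * int i + a] (mod m)"
      by (simp add: q cong_iff_dvd_diff)
    then show ?thesis using i(2) by blast
  qed
  moreover have "[int n = a] (mod int l)" if "[int n = int l * int i + a] (mod m)" for i
    using cong_dvd_modulus_left[OF that] by (simp add: cong_def)
  ultimately show ?thesis
    unfolding mem_trans by blast
qed

lemma card_trans:
  assumes "\<And>i j. i < k \<Longrightarrow> j < k \<Longrightarrow> [f i = f j] (mod m) \<Longrightarrow> i = j"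
  shows "card (trans f s) = k"
proof -
  have "inj_on (\<lambda>i. nat ((f i + s) mod m)) {..<k}"
  proof (rule inj_onI)
    fix i j assume *: "i \<in> {..<k}" "j \<in> {..<k}" "nat ((f i + s) mod m) = nat ((f j + s) mod m)"
    then have "[f i + s = f j + s] (mod m)"
      using m_pos by (simp add: cong_def eq_nat_nat_iff)
    then show "i = j"
      using * assms cong_add_rcancel by blast
  qed
  then show ?thesis
    by (simp add: trans_def card_image)
qed

lemma shift_trans: "shift (l * k) (trans f s) = trans f (s + 1)"
proof -
  have "(nat (x mod m) + 1) mod (l * k) = nat ((x + 1) mod m)" for x
  proof -
    have "int ((nat (x mod m) + 1) mod (l * k)) = (x mod m + 1) mod m"
      using m_pos by (simp add: of_nat_mod add.commute)
    also have "\<dots> = (x + 1) mod m"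
      by (simp add: mod_simps)
    finally show ?thesis by (metis nat_int)
  qed
  then show ?thesis
    by (auto simp: trans_def shift_def image_image add.assoc)
qed

lemma trans_cong: "[s = s'] (mod m) \<Longrightarrow> trans f s = trans f s'"
  unfolding trans_def by (metis cong_add_lcancel cong_def)

section \<open>The developed blocks form a design\<close>

definition blocks :: "nat set set" where
  "blocks = (\<Union>b\<in>I. range (blk b)) \<union> range spread"

lemma trans_subset: "trans f s \<subseteq> {..<l * k}"
  by (auto simp: mem_trans)

text \<open>The difference \<open>x - y\<close> determines the base block and both positions by
  \<open>diff_unique\<close>; the translation is then \<open>x\<close> minus a known point.\<close>

lemma blk_pair_unique:
  assumes "b \<in> I" "b' \<in> I" "x \<noteq> y" "x \<in> blk b s" "y \<in> blk b s" "x \<in> blk b' s'" "y \<in> blk b' s'"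
  shows "b = b' \<and> [s = s'] (mod m)"
proof -
  obtain i j i' j' where ij: "i < k" "j < k" "i' < k" "j' < k"
    "[int x = Z b i + s] (mod m)" "[int y = Z b j + s] (mod m)"
    "[int x = Z b' i' + s'] (mod m)" "[int y = Z b' j' + s'] (mod m)"
    using assms by (auto simp: mem_trans)
  have "i \<noteq> j"
  proof
    assume "i = j"
    then have "[int x = int y] (mod m)"
      using ij by (metis cong_sym cong_trans)
    moreover have "x < l * k" "y < l * k"
      using assms by (auto simp: mem_trans)
    ultimately show False
      using assms(3) by (metis cong_int_iff cong_less_modulus_unique_nat of_nat_mult)
  qed
  have "[int x - int y = Z b i - Z b j] (mod m)"
    using cong_diff[OF ij(5,6)] by simp
  moreover have "[int x - int y = Z b' i' - Z b' j'] (mod m)"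
    using cong_diff[OF ij(7,8)] by simp
  ultimately have eq: "b = b' \<and> i = i' \<and> j = j'"
    using diff_unique[OF assms(1,2) ij(1,2) \<open>i \<noteq> j\<close> ij(3,4)] by (meson cong_sym cong_trans)
  then have "[Z b i + s = Z b i + s'] (mod m)"
    using ij by (meson cong_sym cong_trans)
  then show ?thesis
    using eq cong_add_lcancel by blast
qed

lemma card_blk: "b \<in> I \<Longrightarrow> card (blk b s) = k"
  by (rule card_trans) (metis cong_dvd_modulus_left cong_iff_dvd_diff diff_nz)

lemma card_spread: "card (spread a) = k"
proof (rule card_trans)
  fix i j assume "i < k" "j < k" "[int l * int i = int l * int j] (mod m)"
  then have "int l * int k dvd int l * (int i - int j)"
    by (simp add: cong_iff_dvd_diff right_diff_distrib)
  then have "[int i = int j] (mod int k)"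
    using l_pos by (simp add: cong_iff_dvd_diff)
  then show "i = j"
    using \<open>i < k\<close> \<open>j < k\<close> cong_int_iff cong_less_modulus_unique_nat by blast
qed

lemma blk_spread_pair:
  assumes "b \<in> I" "x \<noteq> y" "x \<in> blk b s" "y \<in> blk b s" "x \<in> spread a" "y \<in> spread a"
  shows False
proof -
  obtain i j where ij: "i < k" "j < k" "[int x = Z b i + s] (mod m)" "[int y = Z b j + s] (mod m)"
    using assms by (auto simp: mem_trans)
  have "i \<noteq> j"
  proof
    assume "i = j"
    then have "[int x = int y] (mod m)"
      using ij by (metis cong_sym cong_trans)
    moreover have "x < l * k" "y < l * k"
      using assms by (auto simp: mem_trans)
    ultimately show False
      using assms(2) by (metis cong_int_iff cong_less_modulus_unique_nat of_nat_mult)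
  qed
  have "[int x - int y = Z b i - Z b j] (mod int l)"
    using cong_diff[OF ij(3,4)] cong_dvd_modulus_left by force
  moreover have "[int x - int y = 0] (mod int l)"
    using assms(5,6) by (metis cong_diff_iff_cong_0 cong_sym cong_trans mem_spread)
  ultimately show False
    using diff_nz[OF assms(1) ij(1,2) \<open>i \<noteq> j\<close>] by (meson cong_dvd_iff cong_0_iff)
qed

lemma finite_blocks: "finite blocks"
  by (rule finite_subset[of _ "Pow {..<l * k}"]) (use trans_subset in \<open>auto simp: blocks_def\<close>)

lemma bibd_blocks: "bibd (l * k) k 1 blocks"
  unfolding bibd_def
proof (intro conjI ballI allI impI)
  show "finite blocks" by (rule finite_blocks)
  show "b \<subseteq> {..<l * k}" "card b = k" if "b \<in> blocks" for b
    using that trans_subset card_blk card_spread by (auto simp: blocks_def)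
  fix x y assume xy: "x < l * k" "y < l * k" "x \<noteq> y"
  show "card {b \<in> blocks. x \<in> b \<and> y \<in> b} = 1"
  \<comment> \<open>Pairs whose difference is divisible by \<open>l\<close> belong to the short
    orbit, all others to the full orbits.\<close>
  proof (cases "int l dvd int x - int y")
    case True
    have "{b \<in> blocks. x \<in> b \<and> y \<in> b} = {spread (int x)}"
    proof (intro equalityI subsetI)
      fix b assume b: "b \<in> {b \<in> blocks. x \<in> b \<and> y \<in> b}"
      have "x \<in> spread (int x)" "y \<in> spread (int x)"
        using True xy by (auto simp: mem_spread cong_iff_dvd_diff dvd_diff_commute)
      then have "b \<in> range spread"
        using b blk_spread_pair[OF _ xy(3)] by (auto simp: blocks_def)
      then obtain a where a: "b = spread a" by auto
      then have "[a = int x] (mod int l)"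
        using b by (auto simp: mem_spread cong_sym)
      then have "n \<in> spread a \<longleftrightarrow> n \<in> spread (int x)" for n
        unfolding mem_spread by (meson cong_sym cong_trans)
      then show "b \<in> {spread (int x)}"
        using a by blast
    next
      fix b assume "b \<in> {spread (int x)}"
      then show "b \<in> {b \<in> blocks. x \<in> b \<and> y \<in> b}"
        using True xy by (auto simp: blocks_def mem_spread cong_iff_dvd_diff dvd_diff_commute)
    qed
    then show ?thesis by simp
  next
    case False
    then obtain b i j where b: "b \<in> I" "i < k" "j < k" "[Z b i - Z b j = int x - int y] (mod m)"
      using diff_ex by blast
    \<comment> \<open>The translation that moves position \<open>i\<close> to \<open>x\<close>; the
      prescribed difference then moves position \<open>j\<close> to \<open>y\<close>.\<close>
    let ?s = "int x - Z b i"
    have "[int x - Z b i + Z b j = int x - (int x - int y)] (mod m)"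
      using cong_diff[OF cong_refl[of "int x"] b(4)] by (simp add: algebra_simps)
    then have "[int y = Z b j + ?s] (mod m)"
      by (simp add: cong_sym_eq algebra_simps)
    then have mem: "x \<in> blk b ?s" "y \<in> blk b ?s"
      using b xy unfolding mem_trans by (force, blast)
    have "{b \<in> blocks. x \<in> b \<and> y \<in> b} = {blk b ?s}"
    proof (intro equalityI subsetI)
      fix B assume B: "B \<in> {b \<in> blocks. x \<in> b \<and> y \<in> b}"
      then have "B \<notin> range spread"
        using False by (auto simp: mem_spread) (meson cong_iff_dvd_diff cong_sym cong_trans)
      then obtain b' s' where "b' \<in> I" "B = blk b' s'"
        using B by (auto simp: blocks_def)
      then have "b = b' \<and> [?s = s'] (mod m)"
        using blk_pair_unique[OF b(1) _ xy(3) mem] B by blast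
      then have "b = b'" "blk b ?s = blk b s'"
        using trans_cong by blast+
      then show "B \<in> {blk b ?s}"
        using \<open>B = blk b' s'\<close> by simp
    qed (use mem b in \<open>auto simp: blocks_def\<close>)
    then show ?thesis by simp
  qed
qed

section \<open>Resolution classes\<close>

definition main_class :: "int \<Rightarrow> nat set set" where
  "main_class a = insert (spread a) (\<Union>b\<in>I - J. blk b ` {s. [s = a] (mod int l)})"

definition side_class :: "'i \<Rightarrow> int \<Rightarrow> nat set set" where
  "side_class b c = blk b ` {s. [s = c] (mod int k)}"

text \<open>The parameter of a main class matters modulo \<open>l\<close> only, that of a side class
  modulo \<open>k\<close> only. As \<open>I\<close> has \<open>(l - 1) / (k - 1)\<close> blocks and
  \<open>I - J\<close> has \<open>(l - 1) / k\<close>, there are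
  \<open>l + (l - 1) / (k - 1) = (l k - 1) / (k - 1)\<close> classes, one for each block through a
  point.\<close>

definition resol :: "nat set set set" where
  "resol = range main_class \<union> (\<Union>b\<in>J. range (side_class b))"

lemma Union_main_class: "\<Union>(main_class a) = {..<l * k}"
proof (intro equalityI subsetI)
  fix n assume "n \<in> \<Union>(main_class a)"
  then show "n \<in> {..<l * k}"
    using trans_subset by (auto simp: main_class_def)
next
  fix n assume n: "n \<in> {..<l * k}"
  show "n \<in> \<Union>(main_class a)"
  proof (cases "int l dvd int n - a")
    case True
    then show ?thesis
      using n by (auto simp: main_class_def mem_spread cong_iff_dvd_diff)
  next
    case False
    then obtain b i where b: "b \<in> I - J" "i < k" "[Z b i = int n - a] (mod int l)"
      using res_ex by blast
    have "[int n - Z b i = int n - (int n - a)] (mod int l)"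
      using b(3) cong_diff cong_refl by blast
    then have "[int n - Z b i = a] (mod int l)" by simp
    moreover have "n \<in> blk b (int n - Z b i)"
      using n b by (auto simp: mem_trans intro!: exI[of _ i])
    ultimately show ?thesis
      using b unfolding main_class_def by blast
  qed
qed

lemma disjoint_main_class:
  assumes "B \<in> main_class a" "B' \<in> main_class a" "n \<in> B" "n \<in> B'"
  shows "B = B'"
proof -
  \<comment> \<open>A point common to such a block and the short block would make a point of the
    base block divisible by \<open>l\<close>.\<close>
  have spr: "n \<notin> spread a" if "b \<in> I - J" "[s = a] (mod int l)" "n \<in> blk b s" for b s
  proof
    assume "n \<in> spread a"
    obtain i where i: "i < k" "[int n = Z b i + s] (mod m)"
      using \<open>n \<in> blk b s\<close> by (auto simp: mem_trans)
    have "[int n = Z b i + s] (mod int l)"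
      using i(2) by (rule cong_dvd_modulus_left)
    moreover have "[int n = a] (mod int l)"
      using \<open>n \<in> spread a\<close> by (simp add: mem_spread)
    then have "[int n = s] (mod int l)"
      using cong_sym[OF that(2)] by (rule cong_trans)
    ultimately have "[0 + s = Z b i + s] (mod int l)"
      by (metis add_0 cong_sym cong_trans)
    then have "[0 = Z b i] (mod int l)"
      using cong_add_rcancel by blast
    then show False
      using res_nz that(1) i(1) by (metis cong_0_iff cong_sym)
  qed
  have blk: "blk b s = blk b' s'"
    if "b \<in> I - J" "[s = a] (mod int l)" "n \<in> blk b s" "b' \<in> I - J" "[s' = a] (mod int l)" "n \<in> blk b' s'"
    for b s b' s'
  proof -
    obtain i i' where i: "i < k" "[int n = Z b i + s] (mod m)" "i' < k" "[int n = Z b' i' + s'] (mod m)"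
      using \<open>n \<in> blk b s\<close> \<open>n \<in> blk b' s'\<close> by (auto simp: mem_trans)
    have "[Z b i + s = Z b' i' + s'] (mod int l)"
      using i(2,4) by (meson cong_dvd_modulus_left cong_sym cong_trans)
    moreover have "[s = s'] (mod int l)"
      using that by (meson cong_sym cong_trans)
    ultimately have "[Z b i = Z b' i'] (mod int l)"
      by (metis add_diff_cancel_right' cong_diff)
    then have eq: "b = b' \<and> i = i'"
      using res_unique that i by blast
    then have "[Z b i + s = Z b i + s'] (mod m)"
      using i by (meson cong_sym cong_trans)
    then show ?thesis
      using eq trans_cong cong_add_lcancel by blast
  qed
  show ?thesis
    using assms spr blk unfolding main_class_def by (elim insertE UN_E imageE CollectE) blast+
qed

lemma Union_side_class:
  assumes "b \<in> J" shows "\<Union>(side_class b c) = {..<l * k}"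
proof (intro equalityI subsetI)
  fix n assume "n \<in> \<Union>(side_class b c)"
  then show "n \<in> {..<l * k}"
    using trans_subset by (auto simp: side_class_def)
next
  fix n assume n: "n \<in> {..<l * k}"
  obtain i where i: "i < k" "[Z b i = int n - c] (mod int k)"
    using leave_ex assms by blast
  have "[int n - Z b i = int n - (int n - c)] (mod int k)"
    using i(2) cong_diff cong_refl by blast
  then have "[int n - Z b i = c] (mod int k)" by simp
  moreover have "n \<in> blk b (int n - Z b i)"
    using n i by (auto simp: mem_trans intro!: exI[of _ i])
  ultimately show "n \<in> \<Union>(side_class b c)"
    unfolding side_class_def by blast
qed

lemma disjoint_side_class:
  assumes "b \<in> J" "B \<in> side_class b c" "B' \<in> side_class b c" "n \<in> B" "n \<in> B'"
  shows "B = B'"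
proof -
  obtain s s' where s: "B = blk b s" "[s = c] (mod int k)" "B' = blk b s'" "[s' = c] (mod int k)"
    using assms by (auto simp: side_class_def)
  obtain i i' where i: "i < k" "[int n = Z b i + s] (mod m)" "i' < k" "[int n = Z b i' + s'] (mod m)"
    using assms s by (auto simp: mem_trans)
  have "[Z b i + s = Z b i' + s'] (mod int k)"
    using i(2,4) by (meson cong_dvd_modulus_right cong_sym cong_trans)
  moreover have "[s = s'] (mod int k)"
    using s by (meson cong_sym cong_trans)
  ultimately have "[Z b i = Z b i'] (mod int k)"
    by (metis add_diff_cancel_right' cong_diff)
  then have "i = i'"
    using leave_unique assms i by blast
  then have "[Z b i + s = Z b i + s'] (mod m)"
    using i by (meson cong_sym cong_trans)
  then show ?thesis
    using s trans_cong cong_add_lcancel by blast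
qed

text \<open>Since \<open>k > 1\<close>, equal blocks share a pair of points. Hence base block and
  translation can be recovered from the block as a set, which shows that distinct classes have no
  block in common.\<close>

lemma two_points:
  assumes "card A = k" obtains x y where "x \<in> A" "y \<in> A" "x \<noteq> (y :: nat)"
proof -
  have "finite A" "\<not> card A \<le> Suc 0"
    using assms k_gt by (auto intro: card_ge_0_finite)
  then show ?thesis
    using that card_le_Suc0_iff_eq[of A] by blast
qed

lemma blk_eq_blk:
  assumes "blk b s = blk b' s'" "b \<in> I" "b' \<in> I" shows "b = b' \<and> [s = s'] (mod m)"
proof -
  obtain x y where "x \<in> blk b s" "y \<in> blk b s" "x \<noteq> y"
    using two_points[OF card_blk[OF assms(2), of s]] .
  then show ?thesis
    using blk_pair_unique[OF assms(2,3)] assms(1) by blast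
qed

lemma blk_neq_spread: "b \<in> I \<Longrightarrow> blk b s \<noteq> spread a"
proof -
  assume b: "b \<in> I"
  obtain x y where "x \<in> blk b s" "y \<in> blk b s" "x \<noteq> y"
    using two_points[OF card_blk[OF b, of s]] .
  then show ?thesis
    using blk_spread_pair[OF b] by blast
qed

lemma main_class_cong: "[a = a'] (mod int l) \<Longrightarrow> main_class a = main_class a'"
proof -
  assume a: "[a = a'] (mod int l)"
  have "spread a = spread a'"
    using a unfolding set_eq_iff mem_spread by (meson cong_sym cong_trans)
  moreover have "[s = a] (mod int l) \<longleftrightarrow> [s = a'] (mod int l)" for s
    using a by (meson cong_sym cong_trans)
  ultimately show ?thesis by (simp add: main_class_def)
qed

lemma side_class_cong: "[c = c'] (mod int k) \<Longrightarrow> side_class b c = side_class b c'"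
  unfolding side_class_def by (metis (no_types, lifting) cong_sym cong_trans)

lemma main_inter_main:
  assumes "B \<in> main_class a" "B \<in> main_class a'" shows "main_class a = main_class a'"
proof -
  have "spread a = spread a' \<Longrightarrow> [a = a'] (mod int l)"
  proof -
    assume eq: "spread a = spread a'"
    obtain n where "n \<in> spread a"
      by (rule two_points[OF card_spread])
    then show ?thesis
      using eq by (metis mem_spread cong_sym cong_trans)
  qed
  moreover have "[a = a'] (mod int l)"
    if "B = blk b s" "b \<in> I - J" "[s = a] (mod int l)"
      "B = blk b' s'" "b' \<in> I - J" "[s' = a'] (mod int l)" for b s b' s'
  proof -
    have "[s = s'] (mod m)" using that blk_eq_blk by blast
    then show ?thesis
      using that by (meson cong_dvd_modulus_left cong_sym cong_trans)
  qed
  moreover have "blk b s \<noteq> spread a''" if "b \<in> I - J" for b s a''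
    using that blk_neq_spread by blast
  ultimately have "[a = a'] (mod int l)"
    using assms unfolding main_class_def by (elim insertE UN_E imageE CollectE) blast+
  then show ?thesis by (rule main_class_cong)
qed

lemma side_inter_side:
  assumes "B \<in> side_class b c" "B \<in> side_class b' c'" "b \<in> J" "b' \<in> J"
  shows "side_class b c = side_class b' c'"
proof -
  obtain s s' where s: "B = blk b s" "[s = c] (mod int k)" "B = blk b' s'" "[s' = c'] (mod int k)"
    using assms by (auto simp: side_class_def)
  then have "b = b'" "[s = s'] (mod m)"
    using blk_eq_blk assms J_sub by blast+
  then have "[c = c'] (mod int k)"
    using s by (meson cong_dvd_modulus_right cong_sym cong_trans)
  then show ?thesis
    using \<open>b = b'\<close> side_class_cong by blast
qed

lemma main_inter_side:
  assumes "b \<in> J" shows "main_class a \<inter> side_class b c = {}"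
proof -
  have b: "b \<in> I" using assms J_sub by blast
  have "B \<notin> side_class b c" if "B \<in> main_class a" for B
  proof
    assume "B \<in> side_class b c"
    then obtain s where s: "B = blk b s" unfolding side_class_def by blast
    then have "B \<noteq> spread a" using blk_neq_spread b by blast
    then obtain b' s' where "B = blk b' s'" "b' \<in> I - J"
      using \<open>B \<in> main_class a\<close> unfolding main_class_def by blast
    then have "b = b'" using s blk_eq_blk b by blast
    then show False using \<open>b' \<in> I - J\<close> assms by blast
  qed
  then show ?thesis by blast
qed

lemma resolution_resol: "resolution (l * k) blocks resol"
  unfolding resolution_def
proof (intro conjI ballI impI)
  fix C assume C: "C \<in> resol"
  have "c \<in> {s. [s = c] (mod int k)}" for c
    by simp
  then have "side_class b c \<noteq> {}" for b c
    unfolding side_class_def by blast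
  then show "C \<noteq> {}"
    using C by (auto simp: resol_def main_class_def)
  show "B \<inter> B' = {}" if "B \<in> C" "B' \<in> C" "B \<noteq> B'" for B B'
    using C that disjoint_main_class disjoint_side_class unfolding resol_def by blast
  show "\<Union>C = {..<l * k}"
    using C Union_main_class Union_side_class unfolding resol_def by blast
next
  fix C C' assume "C \<in> resol" "C' \<in> resol" "C \<noteq> C'"
  then show "C \<inter> C' = {}"
    using main_inter_main side_inter_side main_inter_side unfolding resol_def by blast
next
  show "\<Union>resol = blocks"
  proof (intro equalityI subsetI)
    fix B assume "B \<in> \<Union>resol"
    then show "B \<in> blocks"
      using J_sub unfolding resol_def main_class_def side_class_def blocks_def by blast
  next
    fix B assume B: "B \<in> blocks"
    then consider a where "B = spread a" | b s where "b \<in> I - J" "B = blk b s"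
      | b s where "b \<in> J" "B = blk b s"
      unfolding blocks_def by blast
    then show "B \<in> \<Union>resol"
    proof cases
      case 1
      then show ?thesis unfolding resol_def main_class_def by blast
    next
      case 2
      then have "B \<in> main_class s" unfolding main_class_def using cong_refl by blast
      then show ?thesis unfolding resol_def by blast
    next
      case 3
      then have "B \<in> side_class b s" unfolding side_class_def using cong_refl by blast
      moreover have "side_class b s \<in> resol"
        using 3(1) by (auto simp: resol_def)
      ultimately show ?thesis by (rule UnionI[rotated])
    qed
  qed
qed

text \<open>Both kinds of class are built from such families of translates, so the shift advances
  the parameter of a class by one and thereby permutes the classes.\<close>

lemma shift_image_trans:
  "shift (l * k) ` trans f ` {s. [s = a] (mod n)} = trans f ` {s. [s = a + 1] (mod n)}"
proof (intro equalityI subsetI)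
  fix B assume "B \<in> trans f ` {s. [s = a + 1] (mod n)}"
  then obtain s where "B = trans f s" "[s = a + 1] (mod n)" by blast
  then have "B = shift (l * k) (trans f (s - 1))" "[s - 1 = a] (mod n)"
    using cong_diff[OF _ cong_refl[of 1], of s "a + 1"] by (auto simp: shift_trans)
  then show "B \<in> shift (l * k) ` trans f ` {s. [s = a] (mod n)}" by blast
qed (auto simp: shift_trans cong_add_rcancel)

lemma shift_blocks: "shift (l * k) ` blocks = blocks"
proof -
  have "shift (l * k) ` range (trans f) = range (trans f)" for f
    using shift_image_trans[of f 0 1] by simp
  then show ?thesis
    by (simp only: blocks_def image_Un image_UN)
qed

lemma shift_main_class: "(`) (shift (l * k)) (main_class a) = main_class (a + 1)"
proof -
  have "shift (l * k) ` blk b ` {s. [s = a] (mod int l)} = blk b ` {s. [s = a + 1] (mod int l)}" for b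
    by (rule shift_image_trans)
  then show ?thesis
    by (simp add: main_class_def shift_trans image_UN)
qed

lemma shift_side_class: "(`) (shift (l * k)) (side_class b c) = side_class b (c + 1)"
  unfolding side_class_def by (rule shift_image_trans)

lemma shift_resol: "(`) (shift (l * k)) ` resol = resol"
proof -
  have "main_class a \<in> (`) (shift (l * k)) ` resol" for a
  proof (rule image_eqI)
    show "main_class a = shift (l * k) ` main_class (a - 1)"
      by (simp add: shift_main_class)
  qed (simp add: resol_def)
  moreover have "side_class b c \<in> (`) (shift (l * k)) ` resol" if "b \<in> J" for b c
  proof (rule image_eqI)
    show "side_class b c = shift (l * k) ` side_class b (c - 1)"
      by (simp add: shift_side_class)
    show "side_class b (c - 1) \<in> resol"
      using that unfolding resol_def by blast
  qed
  ultimately show ?thesis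
    by (auto simp: resol_def shift_main_class shift_side_class)
qed

lemma crcbibd_resol: "crcbibd (l * k) k 1 blocks resol"
  using bibd_blocks resolution_resol shift_blocks shift_resol by (simp add: crcbibd_def)

end

section \<open>Replication number, number of blocks, and the parameters of the code\<close>

lemma bibd_replication:
  assumes "bibd v k 1 B" and "x < v"
  shows "card {b \<in> B. x \<in> b} * (k - 1) = v - 1"
proof -
  have fin: "finite B" and sub: "\<And>b. b \<in> B \<Longrightarrow> b \<subseteq> {..<v} \<and> card b = k"
    and pair: "\<And>y. y < v \<Longrightarrow> x \<noteq> y \<Longrightarrow> card {b \<in> B. x \<in> b \<and> y \<in> b} = 1"
    using assms by (auto simp: bibd_def)
  have "(\<Sum>b\<in>{b \<in> B. x \<in> b}. card {y \<in> {..<v} - {x}. y \<in> b}) = 1 * card ({..<v} - {x})"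
  proof (rule sum_multicount)
    show "\<forall>y\<in>{..<v} - {x}. card {b \<in> {b \<in> B. x \<in> b}. y \<in> b} = 1"
      using pair by (auto simp: conj_assoc)
  qed (use fin in auto)
  moreover have "card {y \<in> {..<v} - {x}. y \<in> b} = k - 1" if "b \<in> {b \<in> B. x \<in> b}" for b
  proof -
    have "{y \<in> {..<v} - {x}. y \<in> b} = b - {x}"
      using that sub by auto
    then show ?thesis
      using that sub by simp
  qed
  ultimately show ?thesis
    using assms(2) by simp
qed

lemma bibd_card:
  assumes "bibd v k 1 B" and "\<And>x. x < v \<Longrightarrow> card {b \<in> B. x \<in> b} = r"
  shows "card B * k = r * v"
proof -
  have fin: "finite B" and sub: "\<And>b. b \<in> B \<Longrightarrow> b \<subseteq> {..<v} \<and> card b = k"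
    using assms by (auto simp: bibd_def)
  have "(\<Sum>b\<in>B. card {y \<in> {..<v}. y \<in> b}) = r * card {..<v}"
    by (rule sum_multicount) (use fin assms(2) in auto)
  moreover have "{y \<in> {..<v}. y \<in> b} = b" if "b \<in> B" for b
    using that sub by auto
  ultimately show ?thesis
    using sub by simp
qed

text \<open>A maximal independent set of columns has as many elements as the rank, and it lies in a
  space of dimension \<open>n\<close>.\<close>

lemma (in vec_space) rank_le_nr:
  assumes "A \<in> carrier_mat n nc" shows "rank A \<le> n"
proof -
  obtain S where S: "maximal S (\<lambda>T. T \<subseteq> set (cols A) \<and> lin_indpt T)"
    using maximal_exists_superset[of "set (cols A)" "\<lambda>T. T \<subseteq> set (cols A) \<and> lin_indpt T" "{}"]
    by (auto simp: lin_dep_def)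
  then have "S \<subseteq> carrier_vec n" "lin_indpt S"
    using cols_dim[of A] assms unfolding maximal_def by blast+
  then have "card S \<le> n"
    using li_le_dim(2)[of S] dim_is_n by simp
  then show ?thesis
    using rank_card_indpt[OF assms S] by simp
qed

text \<open>Column weights are block sizes, row weights are the replication number, and the length
  comes from counting flags. The rate only needs that the rank is at most the number
  \<open>l k\<close> of rows: \<open>(l r - l k) / (l r) = (r - k) / r\<close>.\<close>

lemma crc_ldpc_resultI:
  assumes "crcbibd (l * k) k 1 B R" and k: "1 < k" and l: "0 < l"
  shows "crc_ldpc_result k l"
proof -
  let ?v = "l * k"
  define r where "r = (l * k - 1) div (k - 1)"
  have bibd: "bibd ?v k 1 B" and fin: "finite B" and sub: "\<And>b. b \<in> B \<Longrightarrow> b \<subseteq> {..<?v} \<and> card b = k"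
    using assms(1) by (auto simp: crcbibd_def bibd_def)
  obtain bs where bs: "set bs = B" "distinct bs"
    using finite_distinct_list[OF fin] by blast
  let ?H = "inc_mat ?v bs"
  have H: "dim_row ?H = ?v" "dim_col ?H = length bs"
    "\<And>i j. i < ?v \<Longrightarrow> j < length bs \<Longrightarrow> ?H $$ (i, j) \<noteq> 0 \<longleftrightarrow> i \<in> bs ! j"
    by (auto simp: inc_mat_def)
  have row: "card {b \<in> B. x \<in> b} = r" if "x < ?v" for x
    unfolding r_def using bibd_replication[OF bibd that] k by (metis nonzero_mult_div_cancel_right zero_less_diff less_numeral_extra(3))
  have "card B * k = r * ?v"
    using bibd_card[OF bibd row] .
  then have "card B * k = (l * r) * k"
    by (simp add: mult_ac)
  then have len: "length bs = l * r"
    using k bs distinct_card[of bs] by simp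
  have "regular_ldpc ?H k r"
    unfolding regular_ldpc_def H
  proof (intro conjI allI impI)
    fix j assume j: "j < length bs"
    then have b: "bs ! j \<subseteq> {..<?v}" "card (bs ! j) = k"
      using sub nth_mem bs(1) by blast+
    then have "{i. i < ?v \<and> ?H $$ (i, j) \<noteq> 0} = bs ! j"
      using j H(3) by blast
    then show "card {i. i < ?v \<and> ?H $$ (i, j) \<noteq> 0} = k"
      using b by simp
  next
    fix i assume i: "i < ?v"
    then have "{j. j < length bs \<and> ?H $$ (i, j) \<noteq> 0} = {j. j < length bs \<and> i \<in> bs ! j}"
      using H(3) by blast
    then have "card {j. j < length bs \<and> ?H $$ (i, j) \<noteq> 0} = length (filter (\<lambda>b. i \<in> b) bs)"
      by (simp add: length_filter_conv_card)
    also have "\<dots> = card (set (filter (\<lambda>b. i \<in> b) bs))"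
      using distinct_card[OF distinct_filter[OF bs(2)]] by simp
    also have "\<dots> = r"
      using row[OF i] bs by simp
    finally show "card {j. j < length bs \<and> ?H $$ (i, j) \<noteq> 0} = r" .
  qed
  moreover have "code_rate ?H \<ge> (real r - real k) / real r"
  proof -
    have "vec_space.rank ?v ?H \<le> ?v"
      by (rule vec_space.rank_le_nr[where nc = "length bs"]) (auto simp: inc_mat_def)
    then have "real (vec_space.rank ?v ?H) \<le> real l * real k"
      by (metis of_nat_le_iff of_nat_mult)
    moreover have "code_rate ?H = (real l * real r - real (vec_space.rank ?v ?H)) / (real l * real r)"
      unfolding code_rate_def H len by simp
    ultimately have "(real l * real r - real l * real k) / (real l * real r) \<le> code_rate ?H"
      by (simp add: divide_right_mono)
    moreover have "(real l * real r - real l * real k) / (real l * real r) = (real r - real k) / real r"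
      using l by (simp add: right_diff_distrib[symmetric])
    ultimately show ?thesis by simp
  qed
  moreover have "code_length ?H = l * r"
    by (simp add: code_length_def H len)
  moreover have "crcbibd ?v k 1 (set bs) R"
    using assms(1) bs(1) by simp
  ultimately show ?thesis
    unfolding crc_ldpc_result_def Let_def r_def[symmetric] using bs(2)
    by (intro exI[of _ bs] exI[of _ R] conjI)
qed

section \<open>Products\<close>

text \<open>One cannot quantify over index types, so the blocks are numbered by \<open>nat\<close>;
  any finite family can be renumbered.\<close>

definition crc_base :: "nat \<Rightarrow> nat \<Rightarrow> bool" where
  "crc_base k l \<longleftrightarrow> (\<exists>(I :: nat set) J Z. crc_family k l I J Z)"

lemma crc_base_result: "crc_base k l \<Longrightarrow> crc_ldpc_result k l"
proof -
  assume "crc_base k l"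
  then obtain I :: "nat set" and J Z where "crc_family k l I J Z"
    unfolding crc_base_def by blast
  then interpret crc_family k l I J Z .
  show ?thesis
    using crc_ldpc_resultI[OF crcbibd_resol k_gt l_pos] .
qed

lemma (in crc_family) crc_baseI: "crc_base k l"
proof -
  obtain h :: "'i \<Rightarrow> nat" where h: "inj_on h I"
    using fin finite_imp_inj_to_nat_seg by blast
  define Z' where "Z' b = Z (inv_into I h b)" for b
  have Z': "Z' (h b) = Z b" if "b \<in> I" for b
    using h that by (simp add: Z'_def)
  have Z'_J: "Z' (h b) = Z b" if "b \<in> J" for b
    using J_sub that Z' by blast
  have diff: "h ` I - h ` J = h ` (I - J)"
    using h J_sub by (simp add: inj_on_image_set_diff)
  have inj: "h b = h b' \<longleftrightarrow> b = b'" if "b \<in> I" "b' \<in> I" for b b'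
    using h that by (rule inj_on_eq_iff)
  have "crc_family k l (h ` I) (h ` J) Z'"
  proof (unfold_locales, goal_cases)
    case (5 b i j)
    then show ?case using diff_nz Z' by auto
  next
    case (6 d)
    then show ?case using diff_ex[of d] Z' by auto
  next
    case (7 b b' i j i' j')
    then obtain a a' where "b = h a" "b' = h a'" "a \<in> I" "a' \<in> I" by blast
    then show ?case using 7 diff_unique[of a a' i j i' j'] Z' by simp
  next
    case (8 b i)
    then show ?case using res_nz Z' unfolding diff by auto
  next
    case (9 x)
    then show ?case using res_ex[of x] Z' unfolding diff by auto
  next
    case (10 b b' i i')
    then obtain a a' where "b = h a" "b' = h a'" "a \<in> I - J" "a' \<in> I - J" unfolding diff by blast
    then show ?case using 10 res_unique[of a a' i i'] Z' by simp
  next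
    case (11 b c)
    then show ?case using leave_ex Z'_J by auto
  next
    case (12 b i i')
    then show ?case using leave_unique Z'_J by auto
  qed (use k_gt l_pos fin J_sub in auto)
  then show ?thesis
    unfolding crc_base_def by blast
qed

text \<open>Every integer is a multiple of 1, so the empty family has nothing to cover; the design
  is a single block. This starts the induction over prime factors.\<close>

lemma crc_base_1: "1 < k \<Longrightarrow> crc_base k 1"
  using crc_family.crc_baseI[of k 1 "{} :: nat set" "{}" "\<lambda>_ _. 0"] by (auto simp: crc_family_def)

lemma cong_solve_less:
  fixes a c :: int
  assumes "coprime a (int n)" "0 < n"
  obtains u where "u < n" "[a * int u = c] (mod int n)"
proof -
  obtain x where x: "[a * x = 1] (mod int n)"
    using assms(1) cong_solve_coprime_int by blast
  define u where "u = nat ((x * c) mod int n)"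
  have u: "int u = (x * c) mod int n" "u < n"
    using assms(2) by (auto simp: u_def nat_less_iff)
  have "[a * int u = (a * x) * c] (mod int n)"
    by (simp add: u cong_def mod_mult_right_eq mult.assoc)
  then have "[a * int u = c] (mod int n)"
    using cong_scalar_right[OF x, of c] cong_trans by fastforce
  then show ?thesis using that u by blast
qed

lemma cong_eq_less:
  fixes a :: int
  assumes "coprime a (int n)" "u < n" "u' < n" "int n dvd a * (int u - int u')"
  shows "u = u'"
proof -
  have "[int u = int u'] (mod int n)"
    using assms by (simp add: cong_iff_dvd_diff coprime_dvd_mult_right_iff coprime_commute)
  then show ?thesis
    using assms(2,3) cong_int_iff cong_less_modulus_unique_nat by blast
qed

text \<open>The difference matrix with rows \<open>(i + 1) u\<close> inflates a family on \<open>\<int>\<^bsub>qk\<^esub>\<close>; the differences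
  divisible by \<open>q\<close> are supplied by a copy of a family on \<open>\<int>\<^bsub>nk\<^esub>\<close>. The rows start at 1, not 0, so that
  every point of a block runs through all its lifts.\<close>

lemma crc_family_mult:
  fixes I :: "'i set" and I' :: "'j set"
  assumes f1: "crc_family k q I J Z" and f2: "crc_family k n I' J' Z'"
    and cop: "\<And>i. 0 < i \<Longrightarrow> i \<le> k \<Longrightarrow> coprime i n" and cop_q: "coprime k q"
  shows "crc_family k (q * n) (I \<times> {..<n} <+> I') (J \<times> {..<n} <+> J')
    (case_sum (\<lambda>(b, u) i. Z b i + int q * (int k * (int i + 1) * int u)) (\<lambda>b i. int q * Z' b i))"
    (is "crc_family k _ ?I ?J ?Z")
proof -
  interpret F: crc_family k q I J Z by (rule f1)
  interpret G: crc_family k n I' J' Z' by (rule f2)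
  have q: "0 < q" and n: "0 < n" by (rule F.l_pos G.l_pos)+
  \<comment> \<open>The quantities \<open>i - j\<close> and \<open>i + 1\<close> are at most
    \<open>k\<close> in absolute value, hence invertible modulo \<open>n\<close>. This is what makes
    the rows a difference matrix, first for differences, then for points.\<close>
  have cop_diff: "coprime (int i - int j) (int n)" if "i < k" "j < k" "i \<noteq> j" for i j
  proof (cases "j < i")
    case True
    then have "coprime (i - j) n"
      using cop that by simp
    then have "coprime (int (i - j)) (int n)"
      by (simp only: coprime_int_iff)
    then show ?thesis
      using True by (simp only: of_nat_diff less_imp_le)
  next
    case False
    then have "coprime (j - i) n"
      using cop that by simp
    then have "coprime (int (j - i)) (int n)"
      by (simp only: coprime_int_iff)
    then have "coprime (- (int i - int j)) (int n)"
      using False by (simp only: of_nat_diff not_less minus_diff_eq)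
    then show ?thesis by (simp only: coprime_minus_left_iff)
  qed
  have cop_res: "coprime (int k * (int i + 1)) (int n)" if "i < k" for i
  proof -
    have "coprime (int k) (int n)" "coprime (int (Suc i)) (int n)"
      using cop[of k] cop[of "Suc i"] that F.k_gt unfolding coprime_int_iff by auto
    then show ?thesis by (simp add: add.commute)
  qed
  have ZL: "?Z (Inl (b, u)) i - ?Z (Inl (b, u)) j = Z b i - Z b j + int q * int k * ((int i - int j) * int u)"
    for b i j u
    by (simp add: algebra_simps)
  have ZR: "?Z (Inr b) i - ?Z (Inr b) j = int q * (Z' b i - Z' b j)" for b i j
    by (simp add: right_diff_distrib)
  have q_dvd: "int q dvd x" if "int (q * n) dvd x" for x
    using that dvd_mult_left by auto
  have q_dvd': "int q dvd x - y" if "[x = y] (mod int (q * n) * int k)" for x y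
    using that q_dvd cong_dvd_modulus_left by (simp add: cong_iff_dvd_diff)
  have n_dvd: "int n dvd x" if "int (q * n) dvd int q * x" for x
    using that q by auto
  \<comment> \<open>The factor \<open>k\<close> in the inflation keeps residues modulo
    \<open>k\<close>, so transversal blocks remain transversal.\<close>
  have modk: "[Z b i + int q * (int k * (int i + 1) * int u) = Z b i] (mod int k)" for b i u
    by (simp add: cong_iff_dvd_diff)
  show ?thesis
  \<comment> \<open>The goals follow the order of the assumptions of the locale: 5 to 7 concern
    differences, 8 to 10 residues modulo \<open>q n\<close>, 11 and 12 residues modulo
    \<open>k\<close>.\<close>
  proof (unfold_locales, goal_cases)
    case (5 b i j)
    show ?case
    proof (cases b)
      case (Inl bu)
      then obtain b0 u where b0: "bu = (b0, u)" "b0 \<in> I"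
        using 5 by auto
      then have "\<not> int q dvd Z b0 i - Z b0 j + int q * int k * ((int i - int j) * int u)"
        using F.diff_nz[OF b0(2)] 5 by (simp add: dvd_add_left_iff mult.assoc)
      then show ?thesis
        unfolding Inl b0(1) ZL using q_dvd by blast
    next
      case (Inr b0)
      then have "\<not> int n dvd Z' b0 i - Z' b0 j"
        using G.diff_nz 5 by auto
      then show ?thesis
        unfolding Inr ZR using n_dvd by blast
    qed
  next
    case (6 d)
    show ?case
    proof (cases "int q dvd d")
      case False
      then obtain b i j where b: "b \<in> I" "i < k" "j < k" "[Z b i - Z b j = d] (mod int q * int k)"
        using F.diff_ex by blast
      then have "i \<noteq> j"
        using False cong_dvd_modulus_left[OF b(4)] by (auto simp: cong_0_iff cong_sym_eq[of 0])
      \<comment> \<open>The first family realises \<open>d\<close> modulo \<open>q k\<close>; the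
        missing multiple of \<open>q k\<close> is supplied by the choice of
        \<open>u\<close>.\<close>
      obtain e where e: "d = Z b i - Z b j + int q * int k * e"
        using b(4) by (metis cong_iff_lin)
      obtain u where u: "u < n" "[(int i - int j) * int u = e] (mod int n)"
        using cong_solve_less[OF cop_diff[OF b(2,3) \<open>i \<noteq> j\<close>] n] .
      have "int q * int k * int n dvd int q * int k * ((int i - int j) * int u - e)"
        using u(2) by (intro mult_dvd_mono) (auto simp: cong_iff_dvd_diff)
      then have "[?Z (Inl (b, u)) i - ?Z (Inl (b, u)) j = d] (mod int (q * n) * int k)"
        unfolding cong_iff_dvd_diff ZL by (simp add: e algebra_simps)
      then show ?thesis
        using b u(1) by blast
    next
      case True
      then obtain d' where d': "d = int q * d'" by blast
      then have "\<not> int n dvd d'"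
        using 6 by auto
      then obtain b i j where b: "b \<in> I'" "i < k" "j < k" "[Z' b i - Z' b j = d'] (mod int n * int k)"
        using G.diff_ex by blast
      then have "int q * (int n * int k) dvd int q * (Z' b i - Z' b j - d')"
        by (intro mult_dvd_mono) (auto simp: cong_iff_dvd_diff)
      then have "[?Z (Inr b) i - ?Z (Inr b) j = d] (mod int (q * n) * int k)"
        unfolding cong_iff_dvd_diff ZR by (simp add: d' algebra_simps)
      then show ?thesis
        using b by blast
    qed
  next
    case (7 b b' i j i' j')
    note dvd = q_dvd'[OF 7(8)]
    show ?case
    proof (cases b; cases b')
      fix bu bu' assume B: "b = Inl bu" "b' = Inl bu'"
      then obtain b0 u b0' u' where b0: "bu = (b0, u)" "bu' = (b0', u')" "b0 \<in> I" "b0' \<in> I" "u < n" "u' < n"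
        using 7 by auto
      have eq: "[Z b0 i - Z b0 j + int q * int k * ((int i - int j) * int u) =
        Z b0' i' - Z b0' j' + int q * int k * ((int i' - int j') * int u')] (mod int (q * n) * int k)"
        using 7(8) unfolding B b0(1,2) ZL .
      \<comment> \<open>Modulo \<open>q k\<close> the inflation disappears, which identifies the
        block and the positions; the quotient by \<open>q k\<close> then identifies
        \<open>u\<close>.\<close>
      have "int q * int k dvd int (q * n) * int k" by simp
      then have "[Z b0 i - Z b0 j + int q * int k * ((int i - int j) * int u) =
        Z b0' i' - Z b0' j' + int q * int k * ((int i' - int j') * int u')] (mod int q * int k)"
        using eq cong_dvd_modulus by blast
      then have "[Z b0 i - Z b0 j = Z b0' i' - Z b0' j'] (mod int q * int k)"
        by (simp add: cong_def)
      then have same: "b0 = b0' \<and> i = i' \<and> j = j'"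
        using F.diff_unique b0 7 by blast
      then have "(int q * int k) * int n dvd (int q * int k) * ((int i - int j) * (int u - int u'))"
        using eq unfolding cong_iff_dvd_diff by (simp add: algebra_simps)
      then have "int n dvd (int i - int j) * (int u - int u')"
        using q F.k_gt by simp
      then have "u = u'"
        using cong_eq_less cop_diff 7 b0 by blast
      then show ?thesis
        using same B b0 by simp
    next
      fix bu b0' assume B: "b = Inl bu" "b' = Inr b0'"
      then obtain b0 u where b0: "bu = (b0, u)" "b0 \<in> I"
        using 7 by auto
      have "int q dvd (Z b0 i - Z b0 j + int q * int k * ((int i - int j) * int u)) - int q * (Z' b0' i' - Z' b0' j')"
        using dvd unfolding B b0(1) ZL ZR .
      then have "int q dvd Z b0 i - Z b0 j"
        by (simp add: dvd_diff_left_iff dvd_add_left_iff mult.assoc)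
      then show ?thesis
        using F.diff_nz b0 7 by blast
    next
      fix b0 bu' assume B: "b = Inr b0" "b' = Inl bu'"
      then obtain b0' u' where b0: "bu' = (b0', u')" "b0' \<in> I" "b0 \<in> I'"
        using 7 by auto
      have eq: "[int q * (Z' b0 i - Z' b0 j) = Z b0' i' - Z b0' j' + int q * int k * ((int i' - int j') * int u')]
        (mod int (q * n) * int k)"
        using 7(8) unfolding B b0(1) ZL ZR .
      have "int q dvd int q * (Z' b0 i - Z' b0 j) - (Z b0' i' - Z b0' j' + int q * int k * ((int i' - int j') * int u'))"
        using q_dvd'[OF eq] .
      then have "int q dvd Z b0' i' - Z b0' j'"
        by (metis dvd_add_left_iff dvd_diff_right_iff dvd_triv_left mult.assoc)
      then have "i' = j'"
        using F.diff_nz b0 7 by blast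
      then have "int (q * n) dvd int q * (Z' b0 i - Z' b0 j)"
        using eq cong_dvd_modulus_left by (force simp: cong_0_iff)
      then show ?thesis
        using G.diff_nz b0 7 n_dvd by blast
    next
      fix b0 b0' assume B: "b = Inr b0" "b' = Inr b0'"
      then have "int q * (int n * int k) dvd int q * ((Z' b0 i - Z' b0 j) - (Z' b0' i' - Z' b0' j'))"
        using 7(8) unfolding B ZR cong_iff_dvd_diff by (simp add: algebra_simps)
      then have "[Z' b0 i - Z' b0 j = Z' b0' i' - Z' b0' j'] (mod int n * int k)"
        using q by (simp add: cong_iff_dvd_diff)
      then show ?thesis
        using G.diff_unique[of b0 b0' i j i' j'] 7(1-7) B by blast
    qed
  next
    case (8 b i)
    show ?case
    proof (cases b)
      case (Inl bu)
      then obtain b0 u where b0: "bu = (b0, u)" "b0 \<in> I - J"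
        using 8 by auto
      then have "\<not> int q dvd Z b0 i + int q * (int k * (int i + 1) * int u)"
        using F.res_nz[OF b0(2)] 8 by (simp add: dvd_add_left_iff)
      then show ?thesis
        using q_dvd Inl b0(1) by auto
    next
      case (Inr b0)
      then have "\<not> int n dvd Z' b0 i"
        using G.res_nz 8 by auto
      then show ?thesis
        unfolding Inr sum.case using n_dvd by blast
    qed
  next
    case (9 x)
    show ?case
    proof (cases "int q dvd x")
      case False
      then obtain b i where b: "b \<in> I - J" "i < k" "[Z b i = x] (mod int q)"
        using F.res_ex by blast
      obtain e where e: "x = Z b i + int q * e"
        using b(3) by (metis cong_iff_lin)
      \<comment> \<open>Points are compared modulo \<open>q n\<close>, where the factor
        \<open>k\<close> does not cancel, so it has to be inverted together with the row
        entry.\<close>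
      obtain u where u: "u < n" "[int k * (int i + 1) * int u = e] (mod int n)"
        using cong_solve_less[OF cop_res[OF b(2)] n] .
      have "int q * int n dvd int q * (int k * (int i + 1) * int u - e)"
        using u(2) by (intro mult_dvd_mono) (auto simp: cong_iff_dvd_diff)
      then have "[?Z (Inl (b, u)) i = x] (mod int (q * n))"
        unfolding cong_iff_dvd_diff by (simp add: e algebra_simps)
      moreover have "Inl (b, u) \<in> ?I - ?J"
        using b u by auto
      ultimately show ?thesis
        using b(2) by blast
    next
      case True
      then obtain x' where x': "x = int q * x'" by blast
      then have "\<not> int n dvd x'"
        using 9 by auto
      then obtain b i where b: "b \<in> I' - J'" "i < k" "[Z' b i = x'] (mod int n)"
        using G.res_ex by blast
      then have "int q * int n dvd int q * (Z' b i - x')"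
        by (intro mult_dvd_mono) (auto simp: cong_iff_dvd_diff)
      then have "[?Z (Inr b) i = x] (mod int (q * n))"
        unfolding cong_iff_dvd_diff by (simp add: x' algebra_simps)
      moreover have "Inr b \<in> ?I - ?J"
        using b by auto
      ultimately show ?thesis
        using b(2) by blast
    qed
  next
    case (10 b b' i i')
    have dvd: "int q dvd ?Z b i - ?Z b' i'"
      using 10(5) q_dvd by (simp only: cong_iff_dvd_diff)
    show ?case
    proof (cases b; cases b')
      fix bu bu' assume B: "b = Inl bu" "b' = Inl bu'"
      then obtain b0 u b0' u' where b0: "bu = (b0, u)" "bu' = (b0', u')" "b0 \<in> I - J" "b0' \<in> I - J" "u < n" "u' < n"
        using 10 by auto
      have "[Z b0 i + int q * (int k * (int i + 1) * int u) = Z b0' i' + int q * (int k * (int i' + 1) * int u')] (mod int q)"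
        using dvd B b0 by (simp add: cong_iff_dvd_diff)
      then have "[Z b0 i = Z b0' i'] (mod int q)"
        by (simp add: cong_def)
      then have same: "b0 = b0' \<and> i = i'"
        using F.res_unique b0 10 by blast
      then have "int q * int n dvd int q * ((int k * (int i + 1)) * (int u - int u'))"
        using 10(5) B b0 unfolding cong_iff_dvd_diff by (simp add: algebra_simps)
      then have "int n dvd (int k * (int i + 1)) * (int u - int u')"
        using q by (simp only: dvd_mult_cancel_left) auto
      then have "u = u'"
        using cong_eq_less cop_res 10 b0 by blast
      then show ?thesis
        using same B b0 by simp
    next
      fix bu b0' assume B: "b = Inl bu" "b' = Inr b0'"
      then obtain b0 u where b0: "bu = (b0, u)" "b0 \<in> I - J"
        using 10 by auto
      have "int q dvd (Z b0 i + int q * (int k * (int i + 1) * int u)) - int q * Z' b0' i'"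
        using dvd B b0 by simp
      then have "int q dvd Z b0 i"
        by (simp add: dvd_diff_left_iff dvd_add_left_iff)
      then show ?thesis
        using F.res_nz b0 10 by blast
    next
      fix b0 bu' assume B: "b = Inr b0" "b' = Inl bu'"
      then obtain b0' u' where b0: "bu' = (b0', u')" "b0' \<in> I - J"
        using 10 by auto
      have "int q dvd int q * Z' b0 i - (Z b0' i' + int q * (int k * (int i' + 1) * int u'))"
        using dvd B b0 by simp
      then have "int q dvd Z b0' i'"
        by (simp add: dvd_diff_right_iff dvd_add_left_iff)
      then show ?thesis
        using F.res_nz b0 10 by blast
    next
      fix b0 b0' assume B: "b = Inr b0" "b' = Inr b0'"
      then have "int q * int n dvd int q * (Z' b0 i - Z' b0' i')"
        using 10(5) unfolding cong_iff_dvd_diff by (simp add: algebra_simps)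
      then have "[Z' b0 i = Z' b0' i'] (mod int n)"
        using q by (simp add: cong_iff_dvd_diff)
      then show ?thesis
        using G.res_unique 10 B by auto
    qed
  next
    case (11 b c)
    show ?case
    proof (cases b)
      case (Inl bu)
      then obtain b0 u where b0: "bu = (b0, u)" "b0 \<in> J"
        using 11 by auto
      then show ?thesis
        using F.leave_ex[OF b0(2), of c] Inl modk cong_trans by fastforce
    next
      case (Inr b0)
      \<comment> \<open>Scaling by \<open>q\<close> permutes the residues modulo \<open>k\<close>,
        so the copied blocks stay transversal.\<close>
      have "coprime (int q) (int k)"
        using cop_q by (simp add: coprime_commute)
      then obtain x where x: "[int q * x = 1] (mod int k)"
        using cong_solve_coprime_int by blast
      obtain i where i: "i < k" "[Z' b0 i = x * c] (mod int k)"
        using G.leave_ex[of b0] 11 Inr by auto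
      have "[int q * Z' b0 i = (int q * x) * c] (mod int k)"
        using cong_scalar_left[OF i(2), of "int q"] by (simp add: mult.assoc)
      then have "[int q * Z' b0 i = c] (mod int k)"
        using cong_scalar_right[OF x, of c] cong_trans by fastforce
      then show ?thesis
        using i(1) Inr by auto
    qed
  next
    case (12 b i i')
    show ?case
    proof (cases b)
      case (Inl bu)
      then obtain b0 u where b0: "bu = (b0, u)" "b0 \<in> J"
        using 12 by auto
      have "[Z b0 i + int q * (int k * (int i + 1) * int u) = Z b0 i' + int q * (int k * (int i' + 1) * int u)] (mod int k)"
        using 12(4) Inl b0 by simp
      then have "[Z b0 i = Z b0 i'] (mod int k)"
        using modk cong_sym cong_trans by meson
      then show ?thesis
        using F.leave_unique b0 12 by blast
    next
      case (Inr b0)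
      have "coprime (int q) (int k)"
        using cop_q by (simp add: coprime_commute)
      then have "[Z' b0 i = Z' b0 i'] (mod int k)"
        using 12(4) Inr by (simp add: cong_mult_lcancel)
      then show ?thesis
        using G.leave_unique[of b0] 12 Inr by auto
    qed
  qed (use q n F.k_gt F.fin G.fin F.J_sub G.J_sub in auto)
qed

lemma crc_base_mult:
  assumes "crc_base k q" "crc_base k n" "\<And>i. 0 < i \<Longrightarrow> i \<le> k \<Longrightarrow> coprime i n" "coprime k q"
  shows "crc_base k (q * n)"
proof -
  obtain I I' :: "nat set" and J J' Z Z' where f: "crc_family k q I J Z" "crc_family k n I' J' Z'"
    using assms unfolding crc_base_def by blast
  show ?thesis
    by (rule crc_family.crc_baseI[OF crc_family_mult[OF f assms(3,4)]])
qed

text \<open>One prime is split off at a time, and its family is inflated by the cofactor. All prime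
  factors exceed \<open>k\<close>, so the numbers up to \<open>k\<close> are invertible modulo the
  cofactor.\<close>

lemma crc_base_prod:
  assumes "0 < l" "1 < k" "\<And>q. q \<in> prime_factors l \<Longrightarrow> k < q \<and> crc_base k q"
  shows "crc_base k l"
  using assms(1,3)
proof (induction l rule: prime_divisors_induct)
  case unit
  then show ?case
    using crc_base_1 assms(2) by simp
next
  case (factor p n)
  have n: "n \<noteq> 0" using factor.prems by auto
  have p: "k < p" "crc_base k p"
    using factor.prems(2)[of p] factor.hyps n by (auto simp: prime_factors_dvd)
  have q: "k < q \<and> crc_base k q" if "q \<in> prime_factors n" for q
    using factor.prems(2)[of q] that factor.hyps n by (auto simp: prime_factors_dvd)
  have "crc_base k n"
    using factor.IH n q by simp
  moreover have "coprime i n" if "0 < i" "i \<le> k" for i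
  proof (rule ccontr)
    assume "\<not> coprime i n"
    then obtain r where r: "prime r" "r dvd i" "r dvd n"
      by (metis coprime_iff_gcd_eq_1 gcd_dvd1 gcd_dvd2 dvd_trans prime_factor_nat)
    then have "r \<le> k"
      using dvd_imp_le[OF r(2) that(1)] that(2) by simp
    then show False
      using q[of r] r n by (auto simp: prime_factors_dvd)
  qed
  moreover have "coprime k p"
    using p factor.hyps assms(2) by (metis coprime_commute dvd_imp_le leD less_trans less_one prime_imp_coprime zero_less_one neq0_conv not_less_zero)
  ultimately show ?case
    using crc_base_mult p by blast
qed (use assms in simp)

section \<open>Logarithms modulo a prime\<close>

text \<open>By the Chinese remainder theorem points may be given as pairs. Differences are then
  prescribed in both coordinates, while the covering of residues only sees \<open>X\<close> and
  transversality only sees \<open>Y\<close>.\<close>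

lemma crc_base_crtI:
  fixes I J :: "'i set" and X Y :: "'i \<Rightarrow> nat \<Rightarrow> int"
  assumes k: "1 < k" and l: "0 < l" and cop: "coprime k l" and "finite I" "J \<subseteq> I"
    and diff_nz: "\<And>b i j. b \<in> I \<Longrightarrow> i < k \<Longrightarrow> j < k \<Longrightarrow> i \<noteq> j \<Longrightarrow> \<not> int l dvd X b i - X b j"
    and diff_ex: "\<And>d e. \<not> int l dvd d \<Longrightarrow> \<exists>b\<in>I. \<exists>i<k. \<exists>j<k.
      [X b i - X b j = d] (mod int l) \<and> [Y b i - Y b j = e] (mod int k)"
    and diff_unique: "\<And>b b' i j i' j'. b \<in> I \<Longrightarrow> b' \<in> I \<Longrightarrow> i < k \<Longrightarrow> j < k \<Longrightarrow> i \<noteq> j \<Longrightarrow>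
      i' < k \<Longrightarrow> j' < k \<Longrightarrow> [X b i - X b j = X b' i' - X b' j'] (mod int l) \<Longrightarrow>
      [Y b i - Y b j = Y b' i' - Y b' j'] (mod int k) \<Longrightarrow> b = b' \<and> i = i' \<and> j = j'"
    and res_nz: "\<And>b i. b \<in> I - J \<Longrightarrow> i < k \<Longrightarrow> \<not> int l dvd X b i"
    and res_ex: "\<And>x. \<not> int l dvd x \<Longrightarrow> \<exists>b\<in>I - J. \<exists>i<k. [X b i = x] (mod int l)"
    and res_unique: "\<And>b b' i i'. b \<in> I - J \<Longrightarrow> b' \<in> I - J \<Longrightarrow> i < k \<Longrightarrow> i' < k \<Longrightarrow>
      [X b i = X b' i'] (mod int l) \<Longrightarrow> b = b' \<and> i = i'"
    and leave_ex: "\<And>b c. b \<in> J \<Longrightarrow> \<exists>i<k. [Y b i = c] (mod int k)"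
    and leave_unique: "\<And>b i i'. b \<in> J \<Longrightarrow> i < k \<Longrightarrow> i' < k \<Longrightarrow>
      [Y b i = Y b i'] (mod int k) \<Longrightarrow> i = i'"
  shows "crc_base k l"
proof -
  have cop': "coprime (int l) (int k)"
    using cop by (simp add: coprime_commute)
  have "\<forall>b i. \<exists>z. [z = X b i] (mod int l) \<and> [z = Y b i] (mod int k)"
    using binary_chinese_remainder_int[OF cop'] by blast
  then obtain Z where Z: "\<And>b i. [Z b i = X b i] (mod int l)" "\<And>b i. [Z b i = Y b i] (mod int k)"
    by metis
  have split: "[x = y] (mod int l * int k) \<longleftrightarrow> [x = y] (mod int l) \<and> [x = y] (mod int k)" for x y
    using coprime_cong_mult[OF _ _ cop'] cong_dvd_modulus_left cong_dvd_modulus_right by blast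
  have diffX: "[Z b i - Z b j = X b i - X b j] (mod int l)"
    and diffY: "[Z b i - Z b j = Y b i - Y b j] (mod int k)" for b i j
    using Z by (blast intro: cong_diff)+
  have "crc_family k l I J Z"
  proof (unfold_locales, goal_cases)
    case (5 b i j)
    then show ?case using diff_nz cong_dvd_iff[OF diffX] by blast
  next
    case (6 d)
    then obtain b i j where b: "b \<in> I" "i < k" "j < k"
      "[X b i - X b j = d] (mod int l)" "[Y b i - Y b j = d] (mod int k)"
      using diff_ex by blast
    then have "[Z b i - Z b j = d] (mod int l * int k)"
      unfolding split using cong_trans[OF diffX] cong_trans[OF diffY] by blast
    then show ?case using b by blast
  next
    case (7 b b' i j i' j')
    then have "[Z b i - Z b j = Z b' i' - Z b' j'] (mod int l)" "[Z b i - Z b j = Z b' i' - Z b' j'] (mod int k)"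
      unfolding split by blast+
    then have "[X b i - X b j = X b' i' - X b' j'] (mod int l)" "[Y b i - Y b j = Y b' i' - Y b' j'] (mod int k)"
      using cong_trans[OF cong_sym[OF diffX] cong_trans[OF _ diffX]]
        cong_trans[OF cong_sym[OF diffY] cong_trans[OF _ diffY]] by blast+
    then show ?case using diff_unique 7 by blast
  next
    case (8 b i)
    then show ?case using res_nz cong_dvd_iff[OF Z(1)] by blast
  next
    case (9 x)
    then show ?case using res_ex cong_trans[OF Z(1)] by meson
  next
    case (10 b b' i i')
    then show ?case using res_unique cong_trans[OF cong_sym[OF Z(1)] cong_trans[OF _ Z(1)]] by blast
  next
    case (11 b c)
    then show ?case using leave_ex cong_trans[OF Z(2)] by meson
  next
    case (12 b i i')
    then show ?case using leave_unique cong_trans[OF cong_sym[OF Z(2)] cong_trans[OF _ Z(2)]] by blast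
  qed (rule k l \<open>finite I\<close> \<open>J \<subseteq> I\<close>)+
  then show ?thesis
    by (rule crc_family.crc_baseI)
qed

locale prime_log =
  fixes p g :: nat
  assumes prime: "prime p" and root: "residue_primroot p g"
begin

abbreviation n :: int where "n \<equiv> int p - 1"

text \<open>Logarithm and exponential live on the integers, so that logarithms can be subtracted and
  their digits read. On multiples of \<open>p\<close> the value of \<open>L\<close> is
  arbitrary.\<close>

definition L :: "int \<Rightarrow> int" where "L x = int (LEAST a. [int g ^ a = x] (mod int p))"

definition E :: "int \<Rightarrow> int" where "E a = int g ^ nat (a mod n)"

lemma p_gt: "1 < p" and n_pos: "0 < n"
  using prime_gt_1_nat[OF prime] by auto

lemma prime_int: "prime (int p)"
  using prime by simp

lemma unit_mult: "\<not> int p dvd x * y \<longleftrightarrow> \<not> int p dvd x \<and> \<not> int p dvd y"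
  using prime_dvd_mult_iff[OF prime_int] by blast

lemma cong_unit: "[x = y] (mod int p) \<Longrightarrow> int p dvd x \<longleftrightarrow> int p dvd y"
  by (rule cong_dvd_iff)

lemma cancel: "\<not> int p dvd z \<Longrightarrow> [z * x = z * y] (mod int p) \<Longrightarrow> [x = y] (mod int p)"
  using prime_imp_coprime[OF prime_int] cong_mult_lcancel coprime_commute by metis

lemma g_unit: "\<not> int p dvd int g"
proof -
  have "coprime p g"
    using root by (simp add: residue_primroot_def)
  then have "\<not> p dvd g"
    using prime by (metis coprime_absorb_left not_prime_unit)
  then show ?thesis
    by (simp add: int_dvd_int_iff)
qed

lemma power_cong_iff: "[int g ^ a = int g ^ b] (mod int p) \<longleftrightarrow> [int a = int b] (mod n)"
proof -
  have "coprime p g" "ord p g = p - 1"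
    using root prime by (auto simp: residue_primroot_def totient_prime)
  then have "[g ^ a = g ^ b] (mod p) \<longleftrightarrow> [a = b] (mod p - 1)"
    by (simp add: order_divides_expdiff)
  moreover have "int (p - 1) = n"
    using p_gt by simp
  ultimately show ?thesis
    by (metis cong_int_iff of_nat_power)
qed

lemma E_nat: "[E (int a) = int g ^ a] (mod int p)"
  unfolding E_def power_cong_iff using n_pos by (simp add: cong_def)

lemma E_unit: "\<not> int p dvd E a"
  unfolding E_def using g_unit prime_dvd_power[OF prime_int] by blast

lemma E_cong_iff: "[E a = E b] (mod int p) \<longleftrightarrow> [a = b] (mod n)"
  unfolding E_def power_cong_iff using n_pos by (simp add: cong_def)

lemma E_add: "[E (a + b) = E a * E b] (mod int p)"
  unfolding E_def power_add[symmetric] power_cong_iff using n_pos by (simp add: cong_def mod_simps)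

lemma log_ex:
  assumes "\<not> int p dvd x" shows "\<exists>a. [int g ^ a = x] (mod int p)"
proof -
  have "0 < x mod int p"
    using assms p_gt by (simp add: dvd_eq_mod_eq_0 order_less_le)
  define y where "y = nat (x mod int p)"
  have y: "int y = x mod int p" "0 < y" "y < p"
    using \<open>0 < x mod int p\<close> p_gt by (auto simp: y_def nat_less_iff)
  then have "\<not> p dvd y"
    by (simp add: nat_dvd_not_less)
  then have "coprime y p"
    using prime_imp_coprime[OF prime] coprime_commute by blast
  then have "y \<in> totatives p"
    using y by (simp add: in_totatives_iff)
  then obtain a where "y = g ^ a mod p"
    using residue_primroot_is_generator[OF p_gt root] unfolding bij_betw_def by blast
  then have "x mod int p = int g ^ a mod int p"
    using y by (simp add: of_nat_mod)
  then show ?thesis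
    by (metis cong_def)
qed

lemma E_L: "\<not> int p dvd x \<Longrightarrow> [E (L x) = x] (mod int p)"
  using LeastI_ex[OF log_ex] E_nat cong_trans unfolding L_def by blast

lemma L_eqI: "[E a = x] (mod int p) \<Longrightarrow> [L x = a] (mod n)"
  using E_L[of x] E_unit cong_unit E_cong_iff cong_sym cong_trans by meson

lemma L_E: "[L (E a) = a] (mod n)"
  by (rule L_eqI) simp

lemma L_cong: "[x = y] (mod int p) \<Longrightarrow> \<not> int p dvd x \<Longrightarrow> [L x = L y] (mod n)"
  by (meson E_L L_eqI cong_sym cong_trans cong_unit)

lemma L_inj: "[L x = L y] (mod n) \<Longrightarrow> \<not> int p dvd x \<Longrightarrow> \<not> int p dvd y \<Longrightarrow> [x = y] (mod int p)"
  by (meson E_L E_cong_iff cong_sym cong_trans)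

lemma L_mult: "\<not> int p dvd x \<Longrightarrow> \<not> int p dvd y \<Longrightarrow> [L (x * y) = L x + L y] (mod n)"
  by (meson E_L E_add L_eqI cong_mult cong_trans)

lemma L_1: "[L 1 = 0] (mod n)"
  by (rule L_eqI) (simp add: E_def)

lemma unit_power: "\<not> int p dvd x \<Longrightarrow> \<not> int p dvd x ^ i"
  using prime_dvd_power[OF prime_int] by blast

lemma L_power: "\<not> int p dvd x \<Longrightarrow> [L (x ^ i) = int i * L x] (mod n)"
proof (induction i)
  case 0
  then show ?case using L_1 by simp
next
  case (Suc i)
  have "[L (x * x ^ i) = L x + L (x ^ i)] (mod n)"
    using Suc.prems unit_power by (intro L_mult)
  moreover have "[L x + L (x ^ i) = L x + int i * L x] (mod n)"
    using Suc by (intro cong_add) auto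
  ultimately show ?case
    using cong_trans by (fastforce simp: distrib_right)
qed

text \<open>For periodic \<open>A\<close>, multiplicatively: every unit is in exactly one way a
  product of a multiplier from \<open>mult_set A\<close> and some \<open>\<delta> e\<close>. The
  logarithms of the \<open>\<delta> e\<close> and the set \<open>A\<close> factorise the cyclic
  group of order \<open>n\<close>.\<close>

definition tile :: "'e set \<Rightarrow> ('e \<Rightarrow> int) \<Rightarrow> (int \<Rightarrow> bool) \<Rightarrow> bool" where
  "tile S \<delta> A \<longleftrightarrow> (\<forall>e\<in>S. \<not> int p dvd \<delta> e) \<and> (\<forall>y. \<exists>e\<in>S. A (y - L (\<delta> e))) \<and>
    (\<forall>y. \<forall>e\<in>S. \<forall>e'\<in>S. A (y - L (\<delta> e)) \<longrightarrow> A (y - L (\<delta> e')) \<longrightarrow> e = e')"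

definition periodic :: "(int \<Rightarrow> bool) \<Rightarrow> bool" where
  "periodic A \<longleftrightarrow> (\<forall>a b. [a = b] (mod n) \<longrightarrow> A a \<longrightarrow> A b)"

definition mult_set :: "(int \<Rightarrow> bool) \<Rightarrow> int set" where
  "mult_set A = {m \<in> {0<..<int p}. A (L m)}"

lemma periodicD: "periodic A \<Longrightarrow> [a = b] (mod n) \<Longrightarrow> A a \<longleftrightarrow> A b"
  unfolding periodic_def using cong_sym by blast

lemma mult_set_unit: "m \<in> mult_set A \<Longrightarrow> \<not> int p dvd m"
  unfolding mult_set_def using zdvd_imp_le by fastforce

lemma finite_mult_set: "finite (mult_set A)"
  unfolding mult_set_def by (rule finite_subset[of _ "{0<..<int p}"]) auto

lemma mult_set_ex:
  assumes A: "periodic A" and x: "\<not> int p dvd x" and \<delta>: "\<not> int p dvd \<delta>" and "A (L x - L \<delta>)"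
  shows "\<exists>m\<in>mult_set A. [m * \<delta> = x] (mod int p)"
proof -
  define m where "m = E (L x - L \<delta>) mod int p"
  have m: "[m = E (L x - L \<delta>)] (mod int p)"
    by (simp add: m_def cong_def)
  have unit: "\<not> int p dvd m"
    using cong_unit[OF m] E_unit by blast
  then have range: "0 < m" "m < int p"
  proof -
    show "m < int p"
      using p_gt by (simp add: m_def)
    have "0 \<le> m" "m \<noteq> 0"
      using p_gt unit by (auto simp: m_def)
    then show "0 < m" by simp
  qed
  have "[L m = L x - L \<delta>] (mod n)"
    using L_eqI[OF cong_sym[OF m]] .
  then have "m \<in> mult_set A"
    using range assms(4) periodicD[OF A] unfolding mult_set_def by auto
  moreover have "[m * \<delta> = x] (mod int p)"
  proof -
    have "[m * \<delta> = E (L x - L \<delta>) * E (L \<delta>)] (mod int p)"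
      using m E_L[OF \<delta>] by (intro cong_mult) (auto intro: cong_sym)
    moreover have "[E (L x - L \<delta>) * E (L \<delta>) = E (L x)] (mod int p)"
      using E_add[of "L x - L \<delta>" "L \<delta>"] by (simp add: cong_sym)
    ultimately show ?thesis
      using E_L[OF x] cong_trans by blast
  qed
  ultimately show ?thesis by blast
qed

lemma mult_set_eq:
  assumes "m \<in> mult_set A" "m' \<in> mult_set A" "[m = m'] (mod int p)" shows "m = m'"
  using assms unfolding mult_set_def by (auto simp: cong_def)

lemma mult_set_log:
  assumes A: "periodic A" and m: "m \<in> mult_set A" and \<delta>: "\<not> int p dvd \<delta>" and x: "[m * \<delta> = x] (mod int p)"
  shows "A (L x - L \<delta>)"
proof -
  have mp: "\<not> int p dvd m"
    using mult_set_unit[OF m] .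
  have "[L x = L (m * \<delta>)] (mod n)"
    using L_cong[OF x] mp \<delta> unit_mult cong_sym by blast
  then have "[L x = L m + L \<delta>] (mod n)"
    using L_mult[OF mp \<delta>] cong_trans by blast
  then have "[L x - L \<delta> = L m] (mod n)"
    using cong_diff[OF _ cong_refl[of "L \<delta>"], of "L x" "L m + L \<delta>"] by simp
  then show ?thesis
    using periodicD[OF A] m unfolding mult_set_def by blast
qed

lemma tile_unit: "tile S \<delta> A \<Longrightarrow> e \<in> S \<Longrightarrow> \<not> int p dvd \<delta> e"
  unfolding tile_def by blast

lemma tile_ex:
  assumes "periodic A" "tile S \<delta> A" "\<not> int p dvd x"
  shows "\<exists>m\<in>mult_set A. \<exists>e\<in>S. [m * \<delta> e = x] (mod int p)"
  using assms mult_set_ex[OF assms(1,3)] unfolding tile_def by meson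

lemma tile_unique:
  assumes "periodic A" "tile S \<delta> A" "m \<in> mult_set A" "m' \<in> mult_set A" "e \<in> S" "e' \<in> S"
    and eq: "[m * \<delta> e = m' * \<delta> e'] (mod int p)"
  shows "m = m' \<and> e = e'"
proof -
  have unit: "\<not> int p dvd \<delta> e" "\<not> int p dvd \<delta> e'"
    using assms unfolding tile_def by auto
  have "A (L (m' * \<delta> e') - L (\<delta> e))" "A (L (m' * \<delta> e') - L (\<delta> e'))"
    using mult_set_log[OF assms(1,3) unit(1) eq] mult_set_log[OF assms(1,4) unit(2)] by auto
  then have e: "e = e'"
    using assms unfolding tile_def by blast
  then have "[m = m'] (mod int p)"
    using cancel[OF unit(1)] eq by (simp add: mult.commute)
  then show ?thesis
    using e mult_set_eq assms by blast
qed

text \<open>Multipliers act on the first coordinate only, so the difference of two labels stays the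
  same in all multiples of a template; each label difference \<open>e\<close> therefore needs a
  tiling of its own. The templates below \<open>S'\<close> give the blocks outside \<open>J\<close>,
  the remaining ones have to be transversal in their labels.\<close>

lemma crc_base_scaled:
  fixes T lab :: "nat \<Rightarrow> nat \<Rightarrow> int"
  assumes k: "1 < k" "coprime k p" and A: "periodic A" and S: "S' \<le> S"
    and diff: "\<And>e. tile {(s, i, j). s < S \<and> i < k \<and> j < k \<and> i \<noteq> j \<and> [lab s i - lab s j = e] (mod int k)}
      (\<lambda>(s, i, j). T s i - T s j) A"
    and res: "tile ({..<S'} \<times> {..<k}) (\<lambda>(s, i). T s i) A"
    and leave_ex: "\<And>s c. S' \<le> s \<Longrightarrow> s < S \<Longrightarrow> \<exists>i<k. [lab s i = c] (mod int k)"
    and leave_unique: "\<And>s i i'. S' \<le> s \<Longrightarrow> s < S \<Longrightarrow> i < k \<Longrightarrow> i' < k \<Longrightarrow>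
      [lab s i = lab s i'] (mod int k) \<Longrightarrow> i = i'"
  shows "crc_base k p"
proof -
  let ?I = "mult_set A \<times> {..<S}" and ?J = "mult_set A \<times> {S'..<S}"
  let ?X = "\<lambda>(m, s) i. m * T s i" and ?Y = "\<lambda>(m :: int, s) i. lab s i"
  have dnz: "\<not> int p dvd T s i - T s j" if "s < S" "i < k" "j < k" "i \<noteq> j" for s i j
    using tile_unit[OF diff[of "lab s i - lab s j"], of "(s, i, j)"] that by simp
  have rnz: "\<not> int p dvd T s i" if "s < S'" "i < k" for s i
    using tile_unit[OF res, of "(s, i)"] that by simp
  have IJ: "?I - ?J = mult_set A \<times> {..<S'}"
    using S by auto
  show ?thesis
  proof (rule crc_base_crtI[where I = ?I and J = ?J and X = ?X and Y = ?Y], goal_cases)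
    case (6 b i j)
    then obtain m s where b: "b = (m, s)" "m \<in> mult_set A" "s < S" by auto
    then have "\<not> int p dvd m * (T s i - T s j)"
      using dnz 6 mult_set_unit unit_mult by blast
    then show ?case
      by (simp add: b right_diff_distrib)
  next
    case (7 d e)
    obtain m s i j where "m \<in> mult_set A" "s < S" "i < k" "j < k" "[lab s i - lab s j = e] (mod int k)"
      "[m * (T s i - T s j) = d] (mod int p)"
      using tile_ex[OF A diff[of e] 7] by auto
    then have "(m, s) \<in> ?I" "[?X (m, s) i - ?X (m, s) j = d] (mod int p)" "[?Y (m, s) i - ?Y (m, s) j = e] (mod int k)"
      by (auto simp: right_diff_distrib)
    then show ?case
      using \<open>i < k\<close> \<open>j < k\<close> by blast
  next
    case (8 b b' i j i' j')
    obtain m s m' s' where b: "b = (m, s)" "b' = (m', s')" "m \<in> mult_set A" "m' \<in> mult_set A" "s < S" "s' < S"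
      using 8 by auto
    have eq: "[m * (T s i - T s j) = m' * (T s' i' - T s' j')] (mod int p)"
      using 8 b by (simp add: right_diff_distrib)
    have "\<not> int p dvd m * (T s i - T s j)"
      using dnz mult_set_unit unit_mult 8 b by simp
    then have "\<not> int p dvd m' * (T s' i' - T s' j')"
      using cong_unit[OF eq] by blast
    then have "i' \<noteq> j'" by auto
    let ?e = "lab s i - lab s j"
    have "m = m' \<and> (s, i, j) = (s', i', j')"
      by (rule tile_unique[OF A diff[of ?e] b(3,4)]) (use 8 b eq \<open>i' \<noteq> j'\<close> in \<open>auto simp: cong_sym_eq\<close>)
    then show ?case
      using b by simp
  next
    case (9 b i)
    then obtain m s where b: "b = (m, s)" "m \<in> mult_set A" "s < S'"
      unfolding IJ by auto
    then have "\<not> int p dvd m * T s i"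
      using rnz 9 mult_set_unit unit_mult by blast
    then show ?case
      by (simp add: b)
  next
    case (10 x)
    then obtain m s i where "m \<in> mult_set A" "s < S'" "i < k" "[m * T s i = x] (mod int p)"
      using tile_ex[OF A res 10] by auto
    then have "(m, s) \<in> ?I - ?J" "[?X (m, s) i = x] (mod int p)"
      unfolding IJ by auto
    then show ?case using \<open>i < k\<close> by blast
  next
    case (11 b b' i i')
    then obtain m s m' s' where b: "b = (m, s)" "b' = (m', s')" "m \<in> mult_set A" "m' \<in> mult_set A" "s < S'" "s' < S'"
      unfolding IJ by auto
    have "m = m' \<and> (s, i) = (s', i')"
      by (rule tile_unique[OF A res b(3,4)]) (use 11 b in auto)
    then show ?case using b by simp
  next
    case (12 b c)
    then show ?case using leave_ex by auto
  next
    case (13 b i i')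
    then show ?case using leave_unique by auto
  qed (use k p_gt finite_mult_set S in auto)
qed

end

section \<open>Blocks from roots of unity\<close>

context prime_log
begin

lemma eps_unit: "ord p eps = k \<Longrightarrow> 0 < k \<Longrightarrow> \<not> int p dvd int eps"
proof -
  assume "ord p eps = k" "0 < k"
  then have "coprime p eps"
    using ord_eq_0 by (metis less_irrefl)
  then have "\<not> p dvd eps"
    using prime by (metis coprime_absorb_left not_prime_unit)
  then show ?thesis
    by (simp add: int_dvd_int_iff)
qed

lemma eps_power_iff:
  assumes "ord p eps = k" "0 < k"
  shows "[int eps ^ i = int eps ^ j] (mod int p) \<longleftrightarrow> [int i = int j] (mod int k)"
proof -
  have "coprime p eps"
    using assms ord_eq_0 by (metis less_irrefl)
  then have "[eps ^ i = eps ^ j] (mod p) \<longleftrightarrow> [i = j] (mod k)"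
    using order_divides_expdiff assms(1) by blast
  then show ?thesis
    by (metis cong_int_iff of_nat_power)
qed

lemma log_root:
  assumes eps: "ord p eps = k" "0 < k" and K: "n = int k * K"
  obtains c where "L (int eps) = K * c" "coprime c (int k)"
proof -
  let ?l = "L (int eps)"
  have unit: "\<not> int p dvd int eps"
    by (rule eps_unit[OF eps])
  have iff: "n dvd int i * ?l \<longleftrightarrow> k dvd i" for i
  proof -
    have "n dvd int i * ?l \<longleftrightarrow> [L (int eps ^ i) = L 1] (mod n)"
      using L_power[OF unit, of i] L_1 by (metis cong_0_iff cong_sym cong_trans)
    also have "\<dots> \<longleftrightarrow> [int eps ^ i = 1] (mod int p)"
      using L_inj L_cong unit_power[OF unit] p_gt by (meson cong_sym int_dvd_int_iff nat_dvd_1_iff_1 not_prime_unit prime_int)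
    also have "\<dots> \<longleftrightarrow> k dvd i"
      using eps_power_iff[OF eps, of i 0] by (simp add: cong_0_iff)
    finally show ?thesis .
  qed
  have "int k * K dvd int k * ?l"
    using iff[of k] K by simp
  then have "K dvd ?l"
    using eps(2) by simp
  then obtain c where c: "?l = K * c" by blast
  \<comment> \<open>A common factor \<open>d\<close> of \<open>c\<close> and \<open>k\<close> would
    make the power with exponent \<open>k / d\<close> equal to 1 already, against the order of
    \<open>eps\<close>.\<close>
  define d where "d = gcd c (int k)"
  obtain k' c' where k': "int k = d * k'" "c = d * c'"
    unfolding d_def by (meson dvdE gcd_dvd1 gcd_dvd2)
  have d: "0 < d"
    using eps(2) unfolding d_def by simp
  then have "0 < k'"
    using k'(1) eps(2) by (metis of_nat_0_less_iff zero_less_mult_pos)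
  have "int (nat k') * ?l = n * c'"
    using \<open>0 < k'\<close> c k' K by (simp add: ac_simps)
  then have "k dvd nat k'"
    using iff by (metis dvd_triv_left)
  then have "k \<le> nat k'"
    using \<open>0 < k'\<close> by (simp add: dvd_imp_le)
  then have "int k \<le> k'"
    using \<open>0 < k'\<close> by (simp add: le_nat_iff)
  then have "d * k' \<le> 1 * k'"
    using k' by simp
  then have "d = 1"
    using d \<open>0 < k'\<close> by (simp only: mult_le_cancel_right) auto
  then show ?thesis
    using that[OF c] by (simp add: d_def coprime_iff_gcd_eq_1)
qed

lemma eps_power_log:
  assumes "ord p eps = k" "0 < k"
  shows "[E a * int eps ^ i = E (a + int i * L (int eps))] (mod int p)"
proof -
  have unit: "\<not> int p dvd int eps"
    by (rule eps_unit[OF assms])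
  have "[int eps ^ i = E (L (int eps ^ i))] (mod int p)"
    using E_L[OF unit_power[OF unit]] by (rule cong_sym)
  moreover have "[E (L (int eps ^ i)) = E (int i * L (int eps))] (mod int p)"
    using L_power[OF unit] by (simp add: E_cong_iff)
  ultimately have "[E a * int eps ^ i = E a * E (int i * L (int eps))] (mod int p)"
    using cong_scalar_left cong_trans by blast
  then show ?thesis
    using E_add cong_sym cong_trans by blast
qed

text \<open>There are two kinds of block. The blocks \<open>(m D i, 0)\<close> take the differences
  with second coordinate 0. The blocks \<open>(E a eps^i, i)\<close>, one for each coset of the
  group of \<open>eps\<close>, take all others: for second coordinate \<open>r\<close> the first one
  is \<open>E a eps^j (eps^r - 1)\<close>, which runs through all units. By \<open>closed\<close>
  the points of the first kind fill whole cosets. A block of the second kind whose coset is filled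
  goes to \<open>J\<close>, where only its second coordinates matter; the other cosets complete the
  covering of the units.\<close>

lemma crc_base_pure:
  fixes D :: "nat \<Rightarrow> int"
  assumes k: "1 < k" "coprime k p" and A: "periodic A" and eps: "ord p eps = k"
    and diff: "tile {(i, j). i < k \<and> j < k \<and> i \<noteq> j} (\<lambda>(i, j). D i - D j) A"
    and D_nz: "\<And>i. i < k \<Longrightarrow> \<not> int p dvd D i"
    and D_dist: "\<And>i j y. i < k \<Longrightarrow> j < k \<Longrightarrow> A (y - L (D i)) \<Longrightarrow> A (y - L (D j)) \<Longrightarrow> i = j"
    and closed: "\<And>i y. i < k \<Longrightarrow> A (y - L (D i)) \<Longrightarrow> \<exists>j<k. A (y + L (int eps) - L (D j))"
  shows "crc_base k p"
proof -
  have k0: "0 < k" using k by simp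
  note pow_iff = eps_power_iff[OF eps k0]
  let ?l = "L (int eps)"
  have "k dvd p - 1"
    using order_divides_totient[of p eps] eps k0 prime by (metis ord_eq_0 less_irrefl totient_prime)
  then obtain K0 where "p - 1 = k * K0" by blast
  then have K: "n = int k * int K0"
    using p_gt by (metis of_nat_1 of_nat_diff of_nat_mult less_imp_le)
  then have "0 < K0"
    using n_pos by (metis gr0I mult_zero_right of_nat_0 less_irrefl)
  obtain c where c: "?l = int K0 * c" "coprime c (int k)"
    using log_root[OF eps k0 K] .
  have kl: "[int k * ?l = 0] (mod n)"
    by (simp add: K c cong_0_iff)
  have decomp: "\<exists>a<K0. \<exists>i<k. [y = int a + int i * ?l] (mod n)" for y
  proof -
    define a where "a = nat (y mod int K0)"
    have a: "int a = y mod int K0" "a < K0"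
      using \<open>0 < K0\<close> by (auto simp: a_def nat_less_iff)
    obtain b where b: "y = int a + int K0 * b"
      using a by (metis mod_mult_div_eq mod_div_mult_eq add.commute mult.commute)
    obtain i where i: "i < k" "[c * int i = b] (mod int k)"
      using cong_solve_less[OF c(2) k0] .
    have "int k * int K0 dvd (b - c * int i) * int K0"
      using cong_sym[OF i(2)] by (intro mult_dvd_mono) (auto simp: cong_iff_dvd_diff)
    then have "[y = int a + int i * ?l] (mod n)"
      unfolding cong_iff_dvd_diff by (simp add: K c b algebra_simps)
    then show ?thesis
      using a i by blast
  qed
  have decomp_unique: "a = a' \<and> i = i'"
    if "a < K0" "a' < K0" "i < k" "i' < k" "[int a + int i * ?l = int a' + int i' * ?l] (mod n)" for a a' i i'
  proof -
    have "[int a + int i * ?l = int a' + int i' * ?l] (mod int K0)"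
      using that(5) cong_dvd_modulus_right unfolding K by blast
    then have "[int a = int a'] (mod int K0)"
      by (simp add: c cong_def mult.left_commute)
    then have a: "a = a'"
      using that cong_int_iff cong_less_modulus_unique_nat by blast
    then have "[int i * ?l = int i' * ?l] (mod n)"
      using that(5) cong_add_lcancel by blast
    then have "[E (0 + int i * ?l) = E (0 + int i' * ?l)] (mod int p)"
      by (simp add: E_cong_iff)
    then have "[E 0 * int eps ^ i = E 0 * int eps ^ i'] (mod int p)"
      by (rule cong_trans[OF eps_power_log[OF eps k0] cong_trans[OF _ cong_sym[OF eps_power_log[OF eps k0]]]])
    then have "[int i = int i'] (mod int k)"
      using cancel[OF E_unit] pow_iff by blast
    then show ?thesis
      using a that cong_int_iff cong_less_modulus_unique_nat by blast
  qed
  \<comment> \<open>\<open>cov y\<close> says that the unit with logarithm \<open>y\<close> is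
    already a point of a block of the first kind.\<close>
  define cov where "cov y \<longleftrightarrow> (\<exists>i<k. A (y - L (D i)))" for y
  have cov_cong: "cov y \<longleftrightarrow> cov y'" if "[y = y'] (mod n)" for y y'
    unfolding cov_def using periodicD[OF A cong_diff[OF that cong_refl]] by blast
  have cov_shift: "cov (y + int i * ?l)" if "cov y" for y i
  proof (induction i)
    case (Suc i)
    then obtain j where "j < k" "A (y + int i * ?l - L (D j))"
      unfolding cov_def by blast
    then have "cov (y + int i * ?l + ?l)"
      using closed unfolding cov_def by blast
    then show ?case by (simp add: algebra_simps)
  qed (use that in simp)
  \<comment> \<open>For the converse one walks on around the coset: \<open>k - i\<close> further
    steps complete a multiple of \<open>n\<close>.\<close>
  have cov_iff: "cov (y + int i * ?l) \<longleftrightarrow> cov y" if "i < k" for y i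
  proof
    assume "cov (y + int i * ?l)"
    then have "cov (y + int i * ?l + int (k - i) * ?l)"
      by (rule cov_shift)
    moreover have "y + int i * ?l + int (k - i) * ?l = y + int k * ?l"
      using that by (simp add: of_nat_diff algebra_simps)
    moreover have "[y + int k * ?l = y + 0] (mod n)"
      using kl by (intro cong_add) auto
    ultimately show "cov y"
      using cov_cong by simp
  qed (rule cov_shift)
  let ?I = "mult_set A <+> {..<K0}" and ?J = "Inr ` {a. a < K0 \<and> cov (int a)}"
  let ?X = "case_sum (\<lambda>m i. m * D i) (\<lambda>a i. E (int a) * int eps ^ i)"
    and ?Y = "case_sum (\<lambda>m i. 0) (\<lambda>a i. int i)"
  have pow_diff: "\<not> int p dvd int eps ^ i - int eps ^ j" if "\<not> [int i = int j] (mod int k)" for i j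
    using that pow_iff cong_iff_dvd_diff by blast
  have neq: "\<not> [int i = int j] (mod int k)" if "i < k" "j < k" "i \<noteq> j" for i j
    using that cong_int_iff cong_less_modulus_unique_nat by blast
  have tile_nz: "\<not> int p dvd D i - D j" if "i < k" "j < k" "i \<noteq> j" for i j
    using tile_unit[OF diff, of "(i, j)"] that by simp
  have factor_diff: "[E a * int eps ^ i - E a * int eps ^ j = E (a + int j * ?l) * (int eps ^ r - 1)] (mod int p)"
    if "[int i = int j + int r] (mod int k)" for a i j r
  proof -
    have "[int eps ^ i = int eps ^ (j + r)] (mod int p)"
      using that pow_iff by simp
    then have "[E a * int eps ^ i - E a * int eps ^ j = E a * int eps ^ (j + r) - E a * int eps ^ j] (mod int p)"
      by (intro cong_diff cong_scalar_left) auto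
    also have "E a * int eps ^ (j + r) - E a * int eps ^ j = (E a * int eps ^ j) * (int eps ^ r - 1)"
      by (simp add: power_add algebra_simps)
    also have "[(E a * int eps ^ j) * (int eps ^ r - 1) = E (a + int j * ?l) * (int eps ^ r - 1)] (mod int p)"
      using eps_power_log[OF eps k0] by (rule cong_scalar_right)
    finally show ?thesis .
  qed
  show ?thesis
  proof (rule crc_base_crtI[where I = ?I and J = ?J and X = ?X and Y = ?Y], goal_cases)
    case (6 b i j)
    show ?case
    proof (cases b)
      case (Inl m)
      then have "\<not> int p dvd m * (D i - D j)"
        using 6 tile_nz mult_set_unit unit_mult by auto
      then show ?thesis
        using Inl by (simp add: right_diff_distrib)
    next
      case (Inr a)
      have "\<not> int p dvd E (int a) * (int eps ^ i - int eps ^ j)"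
        using 6 pow_diff neq E_unit unit_mult by blast
      then show ?thesis
        using Inr by (simp add: right_diff_distrib)
    qed
  next
    case (7 d e)
    show ?case
    proof (cases "[e = 0] (mod int k)")
      case True
      obtain m i j where m: "m \<in> mult_set A" "i < k" "j < k" "[m * (D i - D j) = d] (mod int p)"
        using tile_ex[OF A diff 7] by auto
      then have "[?X (Inl m) i - ?X (Inl m) j = d] (mod int p)" "[?Y (Inl m) i - ?Y (Inl m) j = e] (mod int k)"
        using cong_sym[OF True] by (auto simp: right_diff_distrib)
      then show ?thesis
        using m by blast
    next
      case False
      define r where "r = nat (e mod int k)"
      have r: "int r = e mod int k"
        using k0 by (simp add: r_def)
      have "\<not> [int r = int 0] (mod int k)"
        using False by (simp add: r cong_def)
      then have \<delta>: "\<not> int p dvd int eps ^ r - 1"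
        using pow_diff[of r 0] by simp
      \<comment> \<open>The logarithm of \<open>d / (eps^r - 1)\<close> determines the coset
        \<open>a\<close> and the position \<open>j\<close> of the subtracted point.\<close>
      obtain a j where aj: "a < K0" "j < k" "[L d - L (int eps ^ r - 1) = int a + int j * ?l] (mod n)"
        using decomp by blast
      define i where "i = (j + r) mod k"
      have i: "i < k" "[int i = int j + int r] (mod int k)"
        using k0 by (auto simp: i_def cong_def of_nat_mod)
      have "[E (int a + int j * ?l) * (int eps ^ r - 1) = E (L d - L (int eps ^ r - 1)) * E (L (int eps ^ r - 1))] (mod int p)"
        using aj(3) E_L[OF \<delta>] E_cong_iff by (intro cong_mult) (auto intro: cong_sym)
      moreover have "[E (L d - L (int eps ^ r - 1)) * E (L (int eps ^ r - 1)) = E (L d)] (mod int p)"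
        using E_add[of "L d - L (int eps ^ r - 1)" "L (int eps ^ r - 1)"] by (simp add: cong_sym)
      ultimately have "[?X (Inr a) i - ?X (Inr a) j = d] (mod int p)"
        using factor_diff[OF i(2), of "int a"] E_L[OF 7] cong_trans by (metis (no_types, lifting) old.sum.simps(6))
      moreover have "[?Y (Inr a) i - ?Y (Inr a) j = e] (mod int k)"
        using cong_diff[OF i(2) cong_refl[of "int j"]] r by simp
      ultimately show ?thesis
        using aj i(1) by blast
    qed
  next
    case (8 b b' i j i' j')
    show ?case
    proof (cases b; cases b')
      fix m m' assume B: "b = Inl m" "b' = Inl m'"
      then have m: "m \<in> mult_set A" "m' \<in> mult_set A"
        using 8 by auto
      have eq: "[m * (D i - D j) = m' * (D i' - D j')] (mod int p)"
        using 8(8) B by (simp add: right_diff_distrib)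
      have "\<not> int p dvd m * (D i - D j)"
        using m 8 tile_nz mult_set_unit unit_mult by blast
      then have "i' \<noteq> j'"
        using cong_unit[OF eq] by auto
      then have "m = m' \<and> (i, j) = (i', j')"
        using tile_unique[OF A diff m, of "(i, j)" "(i', j')"] eq 8 by simp
      then show ?thesis
        using B by simp
    next
      fix m a assume B: "b = Inl m" "b' = Inr a"
      then have "[0 = int i' - int j'] (mod int k)"
        using 8(9) by simp
      then have "[int i' = int j'] (mod int k)"
        by (metis cong_diff_iff_cong_0 cong_sym)
      then have "i' = j'"
        using 8 neq by blast
      then have "[m * (D i - D j) = 0] (mod int p)"
        using 8(8) B by (simp add: right_diff_distrib)
      moreover have "\<not> int p dvd m * (D i - D j)"
        using B 8 tile_nz mult_set_unit unit_mult by blast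
      ultimately show ?thesis
        by (simp add: cong_0_iff)
    next
      fix a m assume B: "b = Inr a" "b' = Inl m"
      then show ?thesis
        using 8 neq[of i j] cong_diff_iff_cong_0 by auto
    next
      fix a a' assume B: "b = Inr a" "b' = Inr a'"
      define r where "r = nat ((int i - int j) mod int k)"
      have r: "int r = (int i - int j) mod int k"
        using k0 by (simp add: r_def)
      have Y: "[int i - int j = int i' - int j'] (mod int k)"
        using 8(9) B by simp
      have ir: "[int i = int j + int r] (mod int k)"
        by (simp add: r cong_def mod_simps)
      have ir': "[int i' = int j' + int r] (mod int k)"
        using Y by (simp add: r cong_def mod_simps)
      have "\<not> [int r = int 0] (mod int k)"
      proof
        assume "[int r = int 0] (mod int k)"
        then have "[int i = int j + 0] (mod int k)"
          using ir cong_add_lcancel cong_trans by (metis of_nat_0)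
        then show False
          using neq 8 by simp
      qed
      then have \<delta>: "\<not> int p dvd int eps ^ r - 1"
        using pow_diff[of r 0] by simp
      have "[E (int a) * int eps ^ i - E (int a) * int eps ^ j = E (int a') * int eps ^ i' - E (int a') * int eps ^ j'] (mod int p)"
        using 8(8) B by simp
      then have "[E (int a + int j * ?l) * (int eps ^ r - 1) = E (int a' + int j' * ?l) * (int eps ^ r - 1)] (mod int p)"
        using factor_diff[OF ir, of "int a"] factor_diff[OF ir', of "int a'"] cong_sym cong_trans by blast
      then have "[E (int a + int j * ?l) = E (int a' + int j' * ?l)] (mod int p)"
        using cancel[OF \<delta>] by (simp add: mult.commute)
      then have aj: "a = a' \<and> j = j'"
        using decomp_unique 8 B E_cong_iff by auto
      then have "[int i = int i'] (mod int k)"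
        using ir ir' cong_sym cong_trans by blast
      then show ?thesis
        using neq 8 B aj by blast
    qed
  next
    case (9 b i)
    show ?case
    proof (cases b)
      case (Inl m)
      then have "\<not> int p dvd m * D i"
        using 9 D_nz mult_set_unit unit_mult by blast
      then show ?thesis using Inl by simp
    next
      case (Inr a)
      have "\<not> int p dvd E (int a) * int eps ^ i"
        using E_unit eps_unit[OF eps k0] unit_power unit_mult by blast
      then show ?thesis using Inr by simp
    qed
  next
    case (10 x)
    show ?case
    proof (cases "cov (L x)")
      case True
      then obtain i where i: "i < k" "A (L x - L (D i))"
        unfolding cov_def by blast
      then obtain m where "m \<in> mult_set A" "[m * D i = x] (mod int p)"
        using mult_set_ex[OF A 10 D_nz] by blast
      then have "Inl m \<in> ?I - ?J" "[?X (Inl m) i = x] (mod int p)"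
        by auto
      then show ?thesis
        using i(1) by blast
    next
      case False
      obtain a i where a: "a < K0" "i < k" "[L x = int a + int i * ?l] (mod n)"
        using decomp by blast
      then have "\<not> cov (int a)"
        using False cov_cong cov_iff by blast
      then have "Inr a \<in> ?I - ?J"
        using a by auto
      moreover have "[?X (Inr a) i = x] (mod int p)"
        using eps_power_log[OF eps k0, of "int a" i] E_L[OF 10] a(3) E_cong_iff cong_sym cong_trans
        by (metis (no_types, lifting) old.sum.simps(6))
      ultimately show ?thesis
        using a(2) by blast
    qed
  next
    case (11 b b' i i')
    have cov: "cov (L x)" if "m \<in> mult_set A" "i < k" "[m * D i = x] (mod int p)" for m i x
      using mult_set_log[OF A that(1) D_nz[OF that(2)] that(3)] that(2) unfolding cov_def by blast
    have not_cov: "\<not> cov (L x)" if "\<not> cov (int a)" "i < k" "[E (int a) * int eps ^ i = x] (mod int p)" for a i x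
    proof -
      have "[L x = int a + int i * ?l] (mod n)"
        using L_eqI eps_power_log[OF eps k0] that(3) cong_sym cong_trans by meson
      then show ?thesis
        using cov_cong cov_iff that by blast
    qed
    show ?case
    proof (cases b; cases b')
      fix m m' assume B: "b = Inl m" "b' = Inl m'"
      then have m: "m \<in> mult_set A" "m' \<in> mult_set A" and eq: "[m * D i = m' * D i'] (mod int p)"
        using 11 by auto
      have "A (L (m' * D i') - L (D i))" "A (L (m' * D i') - L (D i'))"
        using mult_set_log[OF A m(1) D_nz eq] mult_set_log[OF A m(2) D_nz] 11 by auto
      then have i: "i = i'"
        using D_dist 11 by blast
      then have "[m = m'] (mod int p)"
        using cancel[OF D_nz, of i] eq 11 by (simp add: mult.commute)
      then show ?thesis
        using i B mult_set_eq m by blast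
    next
      fix m a assume B: "b = Inl m" "b' = Inr a"
      then show ?thesis
        using 11 cov[of m i] not_cov[of a i' "E (int a) * int eps ^ i'"] by auto
    next
      fix a m assume B: "b = Inr a" "b' = Inl m"
      then show ?thesis
        using 11 cov[of m i' "m * D i'"] not_cov[of a i "m * D i'"] by auto
    next
      fix a a' assume B: "b = Inr a" "b' = Inr a'"
      then have "[E (int a) * int eps ^ i = E (int a') * int eps ^ i'] (mod int p)"
        using 11 by auto
      then have "[E (int a + int i * ?l) = E (int a' + int i' * ?l)] (mod int p)"
        using eps_power_log[OF eps k0] cong_sym cong_trans by meson
      then show ?thesis
        using decomp_unique 11 B E_cong_iff by auto
    qed
  next
    case (12 b c)
    then obtain a where a: "b = Inr a" by blast
    have "nat (c mod int k) < k" "[int (nat (c mod int k)) = c] (mod int k)"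
      using k0 by (auto simp: nat_less_iff cong_def)
    then show ?case
      using a by auto
  next
    case (13 b i i')
    then have "[int i = int i'] (mod int k)"
      by auto
    then show ?case
      using neq 13 by blast
  qed (use k p_gt finite_mult_set in auto)
qed

lemma tile_inj: "tile S \<delta> A \<Longrightarrow> e \<in> S \<Longrightarrow> e' \<in> S \<Longrightarrow> A (y - L (\<delta> e)) \<Longrightarrow> A (y - L (\<delta> e')) \<Longrightarrow> e = e'"
  unfolding tile_def by blast

text \<open>The differences in the group of \<open>eps\<close> are the products of the
  \<open>2 k\<close> numbers \<open>\<plusminus> eps^i\<close> with the \<open>h\<close> numbers
  \<open>1 - eps^d\<close>. The logarithms of \<open>\<plusminus> eps^i\<close> are exactly the
  multiples of \<open>N\<close> modulo \<open>n\<close>, so the tiling only has to be checked modulo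
  \<open>N\<close> on the \<open>1 - eps^d\<close>.\<close>

lemma crc_base_radical:
  assumes k: "k = 2 * h + 1" "0 < h" and eps: "ord p eps = k" and N: "n = 2 * int k * N"
    and A': "\<And>a b. [a = b] (mod N) \<Longrightarrow> A' a \<Longrightarrow> A' b"
    and ex: "\<And>y. \<exists>d\<in>{1..h}. A' (y - L (1 - int eps ^ d))"
    and uniq: "\<And>y d d'. d \<in> {1..h} \<Longrightarrow> d' \<in> {1..h} \<Longrightarrow> A' (y - L (1 - int eps ^ d)) \<Longrightarrow>
      A' (y - L (1 - int eps ^ d')) \<Longrightarrow> d = d'"
  shows "crc_base k p"
proof -
  have k0: "0 < k" "1 < k" using k by auto
  have N_pos: "0 < N"
    using n_pos N k0 by (simp add: zero_less_mult_iff)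
  note pow_iff = eps_power_iff[OF eps k0(1)]
  have unit: "\<not> int p dvd int eps"
    by (rule eps_unit[OF eps k0(1)])
  let ?l = "L (int eps)" and ?v = "\<lambda>d. 1 - int eps ^ d"
  obtain c where c: "?l = (2 * N) * c" "coprime c (int k)"
    using log_root[OF eps k0(1), of "2 * N"] N by (auto simp: ac_simps)
  have "int p = 2 * (int k * N) + 1"
    using N by simp
  then have "odd (int p)" by simp
  then have "p \<noteq> 2" by auto
  have two: "\<not> int p dvd 2"
  proof
    assume "int p dvd 2"
    then have "int p \<le> 2" by (rule zdvd_imp_le) simp
    then show False using p_gt \<open>p \<noteq> 2\<close> by linarith
  qed
  have m1: "\<not> int p dvd - 1"
    using p_gt by simp
  have log_m1: "[L (- 1) = int k * N] (mod n)"
  proof -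
    have "[2 * L (- 1) = 0] (mod n)"
      using L_power[OF m1, of 2] L_1 cong_sym cong_trans by fastforce
    then have "int k * N dvd L (- 1)"
      by (simp add: cong_0_iff N mult.assoc)
    then obtain q where q: "L (- 1) = int k * N * q" by blast
    have "odd q"
    proof
      assume "even q"
      then have "[L (- 1) = 0] (mod n)"
        using q N by (auto simp: cong_0_iff elim!: evenE)
      then have "[L (- 1) = L 1] (mod n)"
        using cong_sym[OF L_1] by (rule cong_trans)
      then have "[- 1 = 1] (mod int p)"
        using L_inj m1 by simp
      then show False
        using two by (simp add: cong_iff_dvd_diff)
    qed
    then obtain q' where "q = 2 * q' + 1" by (elim oddE)
    then have "L (- 1) = int k * N + n * q'"
      using q N by (simp add: algebra_simps)
    then show ?thesis by (simp add: cong_def)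
  qed
  have pow_diff: "\<not> int p dvd int eps ^ i - int eps ^ j" if "i < k" "j < k" "i \<noteq> j" for i j
    using that pow_iff cong_iff_dvd_diff cong_int_iff cong_less_modulus_unique_nat by metis
  have v_unit: "\<not> int p dvd ?v d" if "d \<in> {1..h}" for d
    using pow_diff[of 0 d] that k by simp
  \<comment> \<open>One representative of each admissible class modulo \<open>N\<close>; the
    remaining residues modulo \<open>n\<close> are reached through the factors
    \<open>\<plusminus> eps^i\<close>.\<close>
  define A where "A a \<longleftrightarrow> A' a \<and> a mod n < N" for a
  have A'_iff: "A' a \<longleftrightarrow> A' b" if "[a = b] (mod N)" for a b
    using A' that cong_sym by blast
  have modN: "[a = b] (mod N)" if "[a = b] (mod n)" for a b
    using that cong_dvd_modulus_right unfolding N by blast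
  have A: "periodic A"
    unfolding periodic_def A_def using A'_iff modN by (metis cong_def)
  have pos_log: "[L (int eps ^ i * ?v d) = int i * ?l + L (?v d)] (mod n)" if "d \<in> {1..h}" for i d
    using cong_trans[OF L_mult[OF unit_power[OF unit] v_unit[OF that]] cong_add[OF L_power[OF unit] cong_refl]] .
  have neg_log: "[L (- (int eps ^ i * ?v d)) = int k * N + int i * ?l + L (?v d)] (mod n)" if "d \<in> {1..h}" for i d
  proof -
    have "[L (- 1 * (int eps ^ i * ?v d)) = L (- 1) + L (int eps ^ i * ?v d)] (mod n)"
      using L_mult[OF m1] unit_mult unit_power[OF unit] v_unit[OF that] by blast
    moreover have "[L (- 1) + L (int eps ^ i * ?v d) = int k * N + (int i * ?l + L (?v d))] (mod n)"
      using log_m1 pos_log[OF that] by (rule cong_add)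
    ultimately show ?thesis
      using cong_trans by (simp add: add.assoc)
  qed
  \<comment> \<open>As \<open>k\<close> is odd, exactly one of \<open>j - i\<close> and
    \<open>i - j\<close> reduces modulo \<open>k\<close> to a number in \<open>1..h\<close>; which
    one it is decides the sign.\<close>
  have shape: "\<exists>d\<in>{1..h}. ([int eps ^ i - int eps ^ j = int eps ^ i * ?v d] (mod int p) \<and> [int j = int i + int d] (mod int k)) \<or>
      ([int eps ^ i - int eps ^ j = - (int eps ^ j * ?v d)] (mod int p) \<and> [int i = int j + int d] (mod int k))"
    if ij: "i < k" "j < k" "i \<noteq> j" for i j
  proof -
    define r where "r = nat ((int j - int i) mod int k)"
    have r: "int r = (int j - int i) mod int k" "r < k"
      using k0 by (auto simp: r_def nat_less_iff)
    have "r \<noteq> 0"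
      using r ij cong_int_iff[of j i k] cong_less_modulus_unique_nat[of j i k]
      by (metis cong_iff_dvd_diff dvd_eq_mod_eq_0 of_nat_0)
    show ?thesis
    proof (cases "r \<le> h")
      case True
      have jr: "[int j = int i + int r] (mod int k)"
        by (simp add: r cong_def mod_simps)
      then have "[int eps ^ j = int eps ^ (i + r)] (mod int p)"
        using pow_iff by simp
      then have "[int eps ^ i - int eps ^ j = int eps ^ i - int eps ^ (i + r)] (mod int p)"
        by (intro cong_diff) auto
      then have "[int eps ^ i - int eps ^ j = int eps ^ i * ?v r] (mod int p)"
        by (simp add: power_add algebra_simps)
      then show ?thesis
        using True \<open>r \<noteq> 0\<close> jr by (intro bexI[of _ r]) auto
    next
      case False
      have "int (k - r) = int k - int r"
        using r by simp
      then have "int i - (int j + int (k - r)) = (int i + int r - int j) - int k"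
        by simp
      moreover have "[int i + int r = int j] (mod int k)"
        by (simp add: r cong_def mod_simps)
      ultimately have ir: "[int i = int j + int (k - r)] (mod int k)"
        unfolding cong_iff_dvd_diff by (metis dvd_diff dvd_refl)
      then have "[int eps ^ i = int eps ^ (j + (k - r))] (mod int p)"
        using pow_iff by simp
      then have "[int eps ^ i - int eps ^ j = int eps ^ (j + (k - r)) - int eps ^ j] (mod int p)"
        by (intro cong_diff) auto
      then have "[int eps ^ i - int eps ^ j = - (int eps ^ j * ?v (k - r))] (mod int p)"
        by (simp add: power_add algebra_simps)
      then show ?thesis
        using False r(2) k ir by (intro bexI[of _ "k - r"]) auto
    qed
  qed
  have diff_unit: "\<not> int p dvd int eps ^ i - int eps ^ j" if "i < k" "j < k" "i \<noteq> j" for i j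
    using pow_diff that .
  have l_dvd: "N dvd int i * ?l" for i
    by (simp add: c)
  have A_pos: "A' (y - L x) \<longleftrightarrow> A' (y - L (?v d))" if "d \<in> {1..h}"
    "[x = int eps ^ i * ?v d] (mod int p) \<or> [x = - (int eps ^ i * ?v d)] (mod int p)" "\<not> int p dvd x" for x y i d
  proof -
    have "[L x = L (?v d)] (mod N)"
      using that(2)
    proof
      assume "[x = int eps ^ i * ?v d] (mod int p)"
      then have "[L x = int i * ?l + L (?v d)] (mod N)"
        using L_cong that(3) pos_log[OF that(1)] modN cong_trans by blast
      moreover have "[int i * ?l + L (?v d) = L (?v d)] (mod N)"
        using l_dvd by (simp add: cong_iff_dvd_diff)
      ultimately show ?thesis by (rule cong_trans)
    next
      assume "[x = - (int eps ^ i * ?v d)] (mod int p)"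
      then have "[L x = int k * N + int i * ?l + L (?v d)] (mod N)"
        using L_cong that(3) neg_log[OF that(1)] modN cong_trans by blast
      moreover have "[int k * N + int i * ?l + L (?v d) = L (?v d)] (mod N)"
        using l_dvd by (simp add: cong_iff_dvd_diff)
      ultimately show ?thesis by (rule cong_trans)
    qed
    then have "[y - L x = y - L (?v d)] (mod N)"
      by (rule cong_diff[OF cong_refl])
    then show ?thesis
      by (rule A'_iff)
  qed
  have tile: "tile {(i, j). i < k \<and> j < k \<and> i \<noteq> j} (\<lambda>(i, j). int eps ^ i - int eps ^ j) A"
    unfolding tile_def
  proof (intro conjI allI ballI impI)
    fix e assume "e \<in> {(i, j). i < k \<and> j < k \<and> i \<noteq> j}"
    then show "\<not> int p dvd (case e of (i, j) \<Rightarrow> int eps ^ i - int eps ^ j)"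
      using diff_unit by auto
  next
    fix y
    obtain d where d: "d \<in> {1..h}" "A' (y - L (?v d))"
      using ex by blast
    define z where "z = y - L (?v d)"
    \<comment> \<open>\<open>q N\<close> has to be the logarithm of some
      \<open>\<plusminus> eps^e\<close>. Since -1 has logarithm \<open>k N\<close> and
      \<open>eps\<close> has \<open>2 N c\<close>, the parity \<open>s\<close> of \<open>q\<close>
      selects the sign and the rest \<open>2 b\<close> determines \<open>e\<close>.\<close>
    define q where "q = z div N"
    define s where "s = q mod 2"
    define b where "b = (q - s * int k) div 2"
    have s: "s = 0 \<or> s = 1"
      by (auto simp: s_def)
    have "even (q - s * int k)"
      using k by (auto simp: s_def mod_eq_0_iff_dvd even_diff_iff)
    then have b: "q = s * int k + 2 * b"
      by (simp add: b_def)
    obtain e where e: "e < k" "[c * int e = b] (mod int k)"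
      using cong_solve_less[OF c(2) k0(1)] .
    define f where "f = (e + d) mod k"
    have f: "f < k" "[int f = int e + int d] (mod int k)"
      using k0 by (auto simp: f_def cong_def of_nat_mod)
    have "f \<noteq> e"
    proof
      assume "f = e"
      then have "int k dvd int d"
        using f(2) by (simp add: cong_iff_dvd_diff)
      then have "k dvd d"
        by (simp only: int_dvd_int_iff)
      then show False
        using dvd_imp_le[of k d] d k by simp
    qed
    have main: "A (y - x)" if "[x = s * int k * N + int e * ?l + L (?v d)] (mod n)" for x
    proof -
      have "2 * N * int k dvd 2 * N * (c * int e - b)"
        using e(2) by (intro mult_dvd_mono) (auto simp: cong_iff_dvd_diff)
      moreover have "2 * N * int k = 2 * int k * N"
        by simp
      ultimately have "2 * int k * N dvd 2 * N * (c * int e - b)"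
        by (simp only:)
      then have "[s * int k * N + int e * ?l = q * N] (mod n)"
        unfolding cong_iff_dvd_diff N b c by (simp add: algebra_simps)
      then have "[x = q * N + L (?v d)] (mod n)"
        using that cong_add_rcancel cong_trans by blast
      then have "[y - x = z - q * N] (mod n)"
        using cong_diff[OF cong_refl[of y]] by (fastforce simp: z_def algebra_simps)
      moreover have "z - q * N = z mod N"
        by (simp add: q_def minus_div_mult_eq_mod)
      ultimately have eq: "[y - x = z mod N] (mod n)" by simp
      have "0 \<le> z mod N" "z mod N < N" "N \<le> n"
        using N_pos N k0 by (auto simp: mult_le_cancel_right1 intro: order_trans[of _ "1 * N"])
      then have "(y - x) mod n = z mod N"
        using eq by (simp add: cong_def)
      moreover have "[y - x = z] (mod N)"
        using modN[OF eq] by (simp add: cong_def)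
      ultimately show ?thesis
        unfolding A_def using d(2) A'_iff \<open>z mod N < N\<close> unfolding z_def by simp
    qed
    show "\<exists>e\<in>{(i, j). i < k \<and> j < k \<and> i \<noteq> j}. A (y - L (case e of (i, j) \<Rightarrow> int eps ^ i - int eps ^ j))"
      using s
    proof
      assume s0: "s = 0"
      have "[int eps ^ f = int eps ^ (e + d)] (mod int p)"
        using f(2) pow_iff by simp
      then have "[int eps ^ e - int eps ^ f = int eps ^ e * ?v d] (mod int p)"
        using cong_diff[OF cong_refl[of "int eps ^ e"]] by (fastforce simp: power_add algebra_simps)
      then have "[L (int eps ^ e - int eps ^ f) = s * int k * N + int e * ?l + L (?v d)] (mod n)"
        using L_cong diff_unit[OF e(1) f(1)] \<open>f \<noteq> e\<close> pos_log[OF d(1)] cong_trans s0 by fastforce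
      then show ?thesis
        using main e(1) f(1) \<open>f \<noteq> e\<close> by (intro bexI[of _ "(e, f)"]) auto
    next
      assume s1: "s = 1"
      have "[int eps ^ f = int eps ^ (e + d)] (mod int p)"
        using f(2) pow_iff by simp
      then have "[int eps ^ f - int eps ^ e = - (int eps ^ e * ?v d)] (mod int p)"
        using cong_diff[OF _ cong_refl[of "int eps ^ e"]] by (fastforce simp: power_add algebra_simps)
      then have "[L (int eps ^ f - int eps ^ e) = s * int k * N + int e * ?l + L (?v d)] (mod n)"
        using L_cong diff_unit[OF f(1) e(1)] \<open>f \<noteq> e\<close> neg_log[OF d(1)] cong_trans s1 by fastforce
      then show ?thesis
        using main e(1) f(1) \<open>f \<noteq> e\<close> by (intro bexI[of _ "(f, e)"]) auto
    qed
  next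
    fix y e e'
    assume e: "e \<in> {(i, j). i < k \<and> j < k \<and> i \<noteq> j}" "e' \<in> {(i, j). i < k \<and> j < k \<and> i \<noteq> j}"
      and AA: "A (y - L (case e of (i, j) \<Rightarrow> int eps ^ i - int eps ^ j))"
        "A (y - L (case e' of (i, j) \<Rightarrow> int eps ^ i - int eps ^ j))"
    obtain i j i' j' where ij: "e = (i, j)" "e' = (i', j')" "i < k" "j < k" "i \<noteq> j" "i' < k" "j' < k" "i' \<noteq> j'"
      using e by auto
    let ?x = "int eps ^ i - int eps ^ j" and ?x' = "int eps ^ i' - int eps ^ j'"
    have u: "\<not> int p dvd ?x" "\<not> int p dvd ?x'"
      using diff_unit ij by auto
    obtain d where d: "d \<in> {1..h}" "([?x = int eps ^ i * ?v d] (mod int p) \<and> [int j = int i + int d] (mod int k)) \<or>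
      ([?x = - (int eps ^ j * ?v d)] (mod int p) \<and> [int i = int j + int d] (mod int k))"
      using shape ij by meson
    obtain d' where d': "d' \<in> {1..h}" "([?x' = int eps ^ i' * ?v d'] (mod int p) \<and> [int j' = int i' + int d'] (mod int k)) \<or>
      ([?x' = - (int eps ^ j' * ?v d')] (mod int p) \<and> [int i' = int j' + int d'] (mod int k))"
      using shape ij by meson
    have AA': "A' (y - L ?x)" "(y - L ?x) mod n < N" "A' (y - L ?x')" "(y - L ?x') mod n < N"
      using AA ij unfolding A_def by auto
    have "A' (y - L (?v d))" "A' (y - L (?v d'))"
      using A_pos d d' u AA' by blast+
    then have dd: "d = d'"
      using uniq d(1) d'(1) by blast
    have "[L ?x = L (?v d)] (mod N)" "[L ?x' = L (?v d)] (mod N)"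
    proof -
      have gen: "[L x = L (?v d)] (mod N)" if "[x = int eps ^ i * ?v d] (mod int p) \<or> [x = - (int eps ^ i * ?v d)] (mod int p)"
        "\<not> int p dvd x" for x i
      proof -
        have "[L x = int i * ?l + L (?v d)] (mod N) \<or> [L x = int k * N + int i * ?l + L (?v d)] (mod N)"
          using that L_cong pos_log[OF d(1)] neg_log[OF d(1)] modN cong_trans by blast
        moreover have "[int i * ?l + L (?v d) = L (?v d)] (mod N)" "[int k * N + int i * ?l + L (?v d) = L (?v d)] (mod N)"
          using l_dvd by (simp_all add: cong_iff_dvd_diff)
        ultimately show ?thesis
          using cong_trans by blast
      qed
      show "[L ?x = L (?v d)] (mod N)" "[L ?x' = L (?v d)] (mod N)"
        using gen u d(2) d'(2) dd by blast+
    qed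
    then have "[y - L ?x = y - L ?x'] (mod N)"
      using cong_diff[OF cong_refl] cong_sym cong_trans by meson
    then have "((y - L ?x) mod n) mod N = ((y - L ?x') mod n) mod N"
      by (simp add: N cong_def mod_mod_cancel)
    moreover have "0 \<le> (y - L ?x) mod n" "0 \<le> (y - L ?x') mod n"
      using n_pos by auto
    ultimately have "(y - L ?x) mod n = (y - L ?x') mod n"
      using AA' by simp
    then have "[y - L ?x = y - L ?x'] (mod n)"
      by (simp add: cong_def)
    then have "[L ?x = L ?x'] (mod n)"
      using cong_diff[OF cong_refl[of y]] by fastforce
    then have xx: "[?x = ?x'] (mod int p)"
      using L_inj u by blast
    have v: "\<not> int p dvd ?v d"
      using v_unit d by blast
    have same: "a = a'" if "[int eps ^ a * ?v d = int eps ^ a' * ?v d] (mod int p)" "a < k" "a' < k" for a a'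
      using cancel[OF v] that pow_iff cong_int_iff cong_less_modulus_unique_nat by (metis mult.commute)
    \<comment> \<open>Raising to the odd power \<open>k\<close> would give 1 = -1.\<close>
    have opposite: False if "[int eps ^ a * ?v d = - (int eps ^ a' * ?v d)] (mod int p)" for a a'
    proof -
      have "[?v d * int eps ^ a = ?v d * (- (int eps ^ a'))] (mod int p)"
        using that by (simp add: algebra_simps)
      then have "[(int eps ^ a) ^ k = (- (int eps ^ a')) ^ k] (mod int p)"
        using cancel[OF v] cong_pow by blast
      then have "[int eps ^ (a * k) = - (int eps ^ (a' * k))] (mod int p)"
        using k by (simp only: power_minus_odd power_mult even_plus_one_iff even_mult_iff even_numeral simp_thms)
      moreover have "[int eps ^ (x * k) = 1] (mod int p)" for x
        using pow_iff[of "x * k" 0] by (simp add: cong_0_iff)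
      ultimately have "[1 = - (1 :: int)] (mod int p)"
        using cong_minus_minus_iff cong_sym cong_trans by meson
      then show False
        using two by (simp add: cong_iff_dvd_diff)
    qed
    have fin: "a = a'" if "[int a = b] (mod int k)" "[int a' = b] (mod int k)" "a < k" "a' < k" for a a' b
      using that cong_int_iff cong_less_modulus_unique_nat cong_sym cong_trans by meson
    show "e = e'"
      using d(2)
    proof (elim disjE conjE)
      assume 1: "[?x = int eps ^ i * ?v d] (mod int p)" "[int j = int i + int d] (mod int k)"
      show ?thesis
        using d'(2)
      proof (elim disjE conjE)
        assume 2: "[?x' = int eps ^ i' * ?v d'] (mod int p)" "[int j' = int i' + int d'] (mod int k)"
        then have "[int eps ^ i * ?v d = int eps ^ i' * ?v d] (mod int p)"
          using 1 xx dd cong_sym cong_trans by blast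
        then have "i = i'"
          using same ij by blast
        then have "j = j'"
          using fin 1(2) 2(2) dd ij by blast
        then show ?thesis using \<open>i = i'\<close> ij by simp
      next
        assume "[?x' = - (int eps ^ j' * ?v d')] (mod int p)"
        then show ?thesis
          using 1 xx dd cong_sym cong_trans opposite by blast
      qed
    next
      assume 1: "[?x = - (int eps ^ j * ?v d)] (mod int p)" "[int i = int j + int d] (mod int k)"
      show ?thesis
        using d'(2)
      proof (elim disjE conjE)
        assume "[?x' = int eps ^ i' * ?v d'] (mod int p)"
        then show ?thesis
          using 1 xx dd cong_sym cong_trans opposite by blast
      next
        assume 2: "[?x' = - (int eps ^ j' * ?v d')] (mod int p)" "[int i' = int j' + int d'] (mod int k)"
        then have "[- (int eps ^ j * ?v d) = - (int eps ^ j' * ?v d)] (mod int p)"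
          using 1 xx dd cong_sym cong_trans by blast
        then have "j = j'"
          using same ij cong_minus_minus_iff by blast
        then have "i = i'"
          using fin 1(2) 2(2) dd ij by blast
        then show ?thesis using \<open>j = j'\<close> ij by simp
      qed
    qed
  qed
  have succ_log: "[L (int eps ^ ((i + 1) mod k)) = L (int eps ^ i) + ?l] (mod n)" for i
  proof -
    have "[int ((i + 1) mod k) = int (i + 1)] (mod int k)"
      by (simp add: cong_def of_nat_mod)
    then have "[int eps ^ ((i + 1) mod k) = int eps ^ i * int eps] (mod int p)"
      using pow_iff[of "(i + 1) mod k" "i + 1"] by (simp add: mult.commute)
    then have "[L (int eps ^ ((i + 1) mod k)) = L (int eps ^ i * int eps)] (mod n)"
      using L_cong unit_power[OF unit] by blast
    then show ?thesis
      using L_mult[OF unit_power[OF unit] unit] cong_trans by blast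
  qed
  have coprime_k: "coprime k p"
  proof -
    have "int k \<le> n"
      using N N_pos k0 mult_mono[of 1 "2 * N" "int k" "int k"] by simp
    then have "k < p" by linarith
    then have "\<not> p dvd k"
      using k0 by (simp add: nat_dvd_not_less)
    then show ?thesis
      using prime_imp_coprime[OF prime] coprime_commute by blast
  qed
  show ?thesis
  proof (rule crc_base_pure[OF k0(2) coprime_k A eps tile])
    show "\<not> int p dvd int eps ^ i" for i
      using unit_power[OF unit] .
    show "\<exists>j<k. A (y + ?l - L (int eps ^ j))" if "i < k" "A (y - L (int eps ^ i))" for i y
    proof -
      have "[y - L (int eps ^ i) = y + ?l - L (int eps ^ ((i + 1) mod k))] (mod n)"
        using cong_diff[OF cong_refl[of "y + ?l"] cong_sym[OF succ_log[of i]]] by simp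
      then show ?thesis
        using periodicD[OF A] that k0 by (intro exI[of _ "(i + 1) mod k"]) auto
    qed
    fix i j y assume ij: "i < k" "j < k" "A (y - L (int eps ^ i))" "A (y - L (int eps ^ j))"
    \<comment> \<open>Consecutive points differ by \<open>eps^a (1 - eps)\<close>, so points are
      differences divided by a constant, and their uniqueness is inherited from the tiling by
      differences.\<close>
    have next_tile: "((a, (a + 1) mod k) \<in> {(i, j). i < k \<and> j < k \<and> i \<noteq> j})
      \<and> A (y + L (?v 1) - L (int eps ^ a - int eps ^ ((a + 1) mod k)))"
      if "a < k" "A (y - L (int eps ^ a))" for a
    proof -
      have neq: "(a + 1) mod k \<noteq> a"
        using that(1) k0 by (cases "a + 1 = k") auto
      have "[int ((a + 1) mod k) = int (a + 1)] (mod int k)"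
        by (simp add: cong_def of_nat_mod)
      then have "[int eps ^ ((a + 1) mod k) = int eps ^ (a + 1)] (mod int p)"
        using pow_iff by blast
      then have "[int eps ^ a - int eps ^ ((a + 1) mod k) = int eps ^ a - int eps ^ (a + 1)] (mod int p)"
        by (intro cong_diff) auto
      then have "[int eps ^ a - int eps ^ ((a + 1) mod k) = int eps ^ a * ?v 1] (mod int p)"
        by (simp add: algebra_simps)
      then have "[L (int eps ^ a - int eps ^ ((a + 1) mod k)) = L (int eps ^ a * ?v 1)] (mod n)"
        using L_cong diff_unit[of a "(a + 1) mod k"] that(1) neq k0 by simp
      moreover have "[L (int eps ^ a * ?v 1) = L (int eps ^ a) + L (?v 1)] (mod n)"
        using L_mult[OF unit_power[OF unit] v_unit[of 1]] k by simp
      ultimately have "[L (int eps ^ a - int eps ^ ((a + 1) mod k)) = L (int eps ^ a) + L (?v 1)] (mod n)"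
        by (rule cong_trans)
      then have "[y - L (int eps ^ a) = y + L (?v 1) - L (int eps ^ a - int eps ^ ((a + 1) mod k))] (mod n)"
        using cong_diff[OF cong_refl[of "y + L (?v 1)"] cong_sym] by fastforce
      then show ?thesis
        using periodicD[OF A] that neq k0 by auto
    qed
    have "(i, (i + 1) mod k) = (j, (j + 1) mod k)"
      using tile_inj[OF tile, of "(i, (i + 1) mod k)" "(j, (j + 1) mod k)" "y + L (?v 1)"]
        next_tile[OF ij(1,3)] next_tile[OF ij(2,4)] unfolding prod.case by blast
    then show "i = j" by simp
  qed
qed

end

section \<open>Block sizes 3, 5 and 7\<close>

lemma ex_primroot: "prime p \<Longrightarrow> \<exists>g. prime_log p g"
  using prime_primitive_root_exists[of p] prime_gt_1_nat by (auto simp: prime_log_def)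

lemma ex_exact_power:
  fixes x q :: nat
  assumes "0 < x" "1 < q" obtains e where "q ^ e dvd x" "\<not> q ^ (e + 1) dvd x"
proof -
  let ?m = "LEAST m. \<not> q ^ m dvd x"
  have "\<not> q ^ x dvd x"
    using assms power_gt_expt[of q x] by (auto dest: dvd_imp_le)
  then have m: "\<not> q ^ ?m dvd x"
    by (rule LeastI)
  then obtain e where e: "?m = Suc e"
    by (cases ?m) auto
  then have "q ^ e dvd x"
    using not_less_Least[of e "\<lambda>m. \<not> q ^ m dvd x"] by auto
  then show ?thesis
    using that m e by simp
qed

lemma digit_shift: "((y :: int) - q ^ f * w) div q ^ f = y div q ^ f - w" if "0 < q"
  using div_mult_self2[of "q ^ f" y "- w"] that by simp

text \<open>\<open>q dvd a div q ^ f\<close> expresses that the \<open>f\<close>-th digit of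
  \<open>a\<close> in base \<open>q\<close> is 0, which depends on \<open>a\<close> modulo
  \<open>q ^ (f + 1)\<close> only.\<close>

lemma digit_cong:
  fixes q :: int
  assumes "[a = b] (mod N)" "q ^ (f + 1) dvd N" "0 < q"
  shows "q dvd a div q ^ f \<longleftrightarrow> q dvd b div q ^ f"
proof -
  obtain c where c: "a = b + N * c"
    using assms(1) by (metis cong_iff_lin cong_sym)
  obtain N' where "N = q ^ (f + 1) * N'"
    using assms(2) by blast
  then have N': "N = q ^ f * (q * N')"
    by (simp add: ac_simps)
  have "a = b - q ^ f * (- (q * N' * c))"
    by (simp add: c N')
  then have "a div q ^ f = b div q ^ f + q * N' * c"
    using digit_shift[OF assms(3), of b f "- (q * N' * c)"] by simp
  then show ?thesis
    by (simp add: mult.assoc dvd_add_left_iff)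
qed

context prime_log
begin

lemma E_power: "[E (int i * a) = E a ^ i] (mod int p)"
proof (induction i)
  case (Suc i)
  have "[E (a + int i * a) = E a * E (int i * a)] (mod int p)"
    by (rule E_add)
  then have "[E (a + int i * a) = E a * E a ^ i] (mod int p)"
    using cong_scalar_left[OF Suc] cong_trans by blast
  then show ?case by (simp add: distrib_right)
qed (simp add: E_def)

text \<open>This turns the hypotheses on power residues into divisibility of logarithms.\<close>

lemma power_residue_iff:
  assumes "int m dvd n" "0 < m" "\<not> int p dvd int x"
  shows "is_power_mod p m x \<longleftrightarrow> int m dvd L (int x)"
proof
  assume "is_power_mod p m x"
  then obtain y where "[y ^ m = x] (mod p)"
    unfolding is_power_mod_def by blast
  then have y: "[int y ^ m = int x] (mod int p)"
    by (metis cong_int_iff of_nat_power)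
  then have unit: "\<not> int p dvd int y ^ m"
    using cong_unit assms(3) by blast
  have "int y dvd int y ^ m"
    using assms(2) by (simp add: dvd_power)
  then have "\<not> int p dvd int y"
    using unit dvd_trans by metis
  then have "[L (int x) = int m * L (int y)] (mod n)"
    using L_cong[OF y unit] L_power cong_sym cong_trans by blast
  then have "[L (int x) = int m * L (int y)] (mod int m)"
    using assms(1) cong_dvd_modulus by blast
  then show "int m dvd L (int x)"
    using cong_dvd_iff[of "L (int x)" "int m * L (int y)" "int m"] by simp
next
  assume "int m dvd L (int x)"
  then obtain q where q: "L (int x) = int m * q" by blast
  define y where "y = nat (E q mod int p)"
  have "int y = E q mod int p"
    using p_gt by (simp add: y_def)
  then have "[int y ^ m = E q ^ m] (mod int p)"
    by (intro cong_pow) (simp add: cong_def)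
  then have "[int y ^ m = int x] (mod int p)"
    using E_power[of m q] E_L[OF assms(3)] q cong_sym cong_trans by metis
  then have "[y ^ m = x] (mod p)"
    by (metis cong_int_iff of_nat_power)
  then show "is_power_mod p m x"
    unfolding is_power_mod_def by blast
qed

text \<open>A common summand of the logarithms merely translates the tiling, so one may divide by
  \<open>1 - eps\<close> and work with the quotients \<open>(1 - eps^d) / (1 - eps)\<close>.\<close>

lemma crc_base_radical_logs:
  assumes k: "k = 2 * h + 1" "0 < h" and eps: "ord p eps = k" and N: "n = 2 * int k * N"
    and A': "\<And>a b. [a = b] (mod N) \<Longrightarrow> A' a \<Longrightarrow> A' b"
    and lam: "\<And>d. d \<in> {1..h} \<Longrightarrow> [L (1 - int eps ^ d) = base + lam d] (mod n)"
    and tile: "\<And>y. \<exists>d\<in>{1..h}. A' (y - lam d) \<and> (\<forall>d'\<in>{1..h}. A' (y - lam d') \<longrightarrow> d' = d)"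
  shows "crc_base k p"
proof (rule crc_base_radical[OF k eps N, where A' = A'])
  have iff: "A' (y - L (1 - int eps ^ d)) \<longleftrightarrow> A' (y - base - lam d)" if "d \<in> {1..h}" for y d
  proof -
    have "[y - L (1 - int eps ^ d) = y - (base + lam d)] (mod n)"
      by (rule cong_diff[OF cong_refl lam[OF that]])
    then have "[y - L (1 - int eps ^ d) = y - base - lam d] (mod N)"
      using cong_dvd_modulus_right unfolding N by (simp add: diff_diff_eq)
    then show ?thesis
      using A' cong_sym by blast
  qed
  show "\<exists>d\<in>{1..h}. A' (y - L (1 - int eps ^ d))" for y
    using tile[of "y - base"] iff by blast
  show "d = d'" if "d \<in> {1..h}" "d' \<in> {1..h}" "A' (y - L (1 - int eps ^ d))" "A' (y - L (1 - int eps ^ d'))" for y d d'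
    using that tile[of "y - base"] iff by blast
qed (use A' in blast)

lemma one_minus_unit:
  assumes "ord p eps = k" "0 < k" "\<not> k dvd d" shows "\<not> int p dvd 1 - int eps ^ d"
proof
  assume "int p dvd 1 - int eps ^ d"
  then have "[int eps ^ 0 = int eps ^ d] (mod int p)"
    by (simp add: cong_iff_dvd_diff)
  then have "[int 0 = int d] (mod int k)"
    using eps_power_iff[OF assms(1,2)] by blast
  then show False
    using assms(3) by (metis cong_0_iff cong_int_iff cong_sym)
qed

end

lemma crc_base_3:
  assumes "prime p" "p = 6 * t + 1" shows "crc_base 3 p"
proof -
  obtain g where "prime_log p g"
    using ex_primroot[OF assms(1)] by blast
  then interpret prime_log p g .
  have n: "n = 2 * int 3 * int t"
    using assms by simp
  have "coprime p g" "ord p g = 6 * t"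
    using root assms by (auto simp: residue_primroot_def totient_prime)
  moreover have "0 < t"
    using assms p_gt by (cases t) auto
  ultimately have eps: "ord p (g ^ (2 * t)) = 3"
    by (simp add: ord_power gcd_mult_distrib_nat[symmetric] mult.commute)
  show ?thesis
    by (rule crc_base_radical_logs[where h = 1 and A' = "\<lambda>_. True" and lam = "\<lambda>_. 0"
          and base = "L (1 - int (g ^ (2 * t)))", OF _ _ eps n]) auto
qed

text \<open>The quotient \<open>1 + eps\<close> has logarithm \<open>x = 2^f w\<close> with
  \<open>w\<close> odd, and \<open>f \<le> e\<close> because it is not a \<open>2^(e+1)\<close>-th
  power. Subtracting \<open>x\<close> flips the \<open>f\<close>-th binary digit, so exactly one of
  \<open>y\<close> and \<open>y - x\<close> has digit 0. The bound on \<open>f\<close> makes this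
  digit well defined modulo \<open>N = 2 t\<close>.\<close>

lemma crc_base_5:
  assumes "prime p" "p = 20 * t + 1" "0 < t" "2 ^ e dvd t" "\<not> 2 ^ (e + 1) dvd t"
    and eps: "ord p eps = 5" and np: "\<not> is_power_mod p (2 ^ (e + 1)) (eps + 1)"
  shows "crc_base 5 p"
proof -
  obtain g where "prime_log p g"
    using ex_primroot[OF assms(1)] by blast
  then interpret prime_log p g .
  have n: "n = 2 * int 5 * (2 * int t)"
    using assms by simp
  have factor: "1 - int eps ^ 2 = (1 - int eps) * int (eps + 1)"
    by (simp add: power2_eq_square algebra_simps)
  have "\<not> int p dvd 1 - int eps ^ 2"
    by (rule one_minus_unit[OF eps]) auto
  then have unit: "\<not> int p dvd 1 - int eps" "\<not> int p dvd int (eps + 1)"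
    unfolding factor unit_mult by auto
  define x where "x = L (int (eps + 1))"
  have t2: "(2 :: int) ^ e dvd int t"
    using assms(4) by (metis of_nat_dvd_iff of_nat_numeral of_nat_power)
  have "int (2 ^ (e + 1)) dvd 2 * int t"
    using t2 by simp
  then have "int (2 ^ (e + 1)) dvd n"
    unfolding n by (rule dvd_mult)
  then have nd: "\<not> int (2 ^ (e + 1)) dvd x"
    using power_residue_iff[OF _ _ unit(2)] np unfolding x_def by simp
  have "0 \<le> x"
    unfolding x_def L_def by simp
  then obtain x' where x': "x = int x'"
    using nonneg_int_cases by blast
  have "0 < x'"
    using nd x' by (cases x') auto
  then obtain f where f: "2 ^ f dvd x'" "\<not> 2 ^ (f + 1) dvd x'"
    using ex_exact_power[of x' 2] by auto
  then have "f \<le> e"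
    using nd x' le_imp_power_dvd[of "e + 1" f "2 :: nat"] by (metis dvd_trans int_dvd_int_iff not_less_eq_eq Suc_eq_plus1)
  obtain w where w: "x' = 2 ^ f * w"
    using f by blast
  then have "odd w"
    using f(2) by (auto simp: mult.assoc elim!: evenE)
  have xw: "x = 2 ^ f * int w"
    using w x' by simp
  have "(2 :: int) ^ f dvd int t"
    using t2 le_imp_power_dvd[OF \<open>f \<le> e\<close>] dvd_trans by blast
  then have fN: "(2 :: int) ^ (f + 1) dvd 2 * int t"
    by simp
  show ?thesis
  proof (rule crc_base_radical_logs[where h = 2 and A' = "\<lambda>y. 2 dvd y div 2 ^ f"
        and lam = "\<lambda>d. if d = 1 then 0 else x" and base = "L (1 - int eps)", OF _ _ eps n], goal_cases)
    case (3 a b)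
    then show ?case
      using digit_cong[OF _ fN] by auto
  next
    case (4 d)
    then have "d = 1 \<or> d = 2" by auto
    then show ?case
      using L_mult[OF unit] factor by (auto simp: x_def)
  next
    case (5 y)
    have "{1..2} = {1, 2 :: nat}" by auto
    moreover have "(y - x) div 2 ^ f = y div 2 ^ f - int w"
      unfolding xw by (rule digit_shift) simp
    ultimately show ?case
      using \<open>odd w\<close> by auto
  qed auto
qed

text \<open>Relative to \<open>1 - eps\<close> the three logarithms are 0, \<open>x\<close> and
  \<open>y\<close>. By the three conditions on residues they are multiples of \<open>3^f\<close>
  whose quotients by \<open>3^f\<close> are pairwise incongruent modulo 3, so for each
  \<open>a\<close> exactly one of \<open>a\<close>, \<open>a - x\<close>, \<open>a - y\<close> has
  its \<open>f\<close>-th ternary digit equal to 0.\<close>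

lemma crc_base_7:
  assumes "prime p" "p = 42 * t + 1" "0 < t" "3 ^ f dvd t" and eps: "ord p eps = 7"
    and p1: "is_power_mod p (3 ^ f) (eps + 1)" "\<not> is_power_mod p (3 ^ (f + 1)) (eps + 1)"
    and p2: "is_power_mod p (3 ^ f) (eps\<^sup>2 + eps + 1)" "\<not> is_power_mod p (3 ^ (f + 1)) (eps\<^sup>2 + eps + 1)"
    and p3: "\<And>z. [z * (eps + 1) = eps\<^sup>2 + eps + 1] (mod p) \<Longrightarrow> \<not> is_power_mod p (3 ^ (f + 1)) z"
  shows "crc_base 7 p"
proof -
  obtain g where "prime_log p g"
    using ex_primroot[OF assms(1)] by blast
  then interpret prime_log p g .
  have n: "n = 2 * int 7 * (3 * int t)"
    using assms by simp
  have factor2: "1 - int eps ^ 2 = (1 - int eps) * int (eps + 1)"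
    and factor3: "1 - int eps ^ 3 = (1 - int eps) * int (eps\<^sup>2 + eps + 1)"
    by (simp_all add: power2_eq_square power3_eq_cube algebra_simps)
  have "\<not> int p dvd 1 - int eps ^ 2" "\<not> int p dvd 1 - int eps ^ 3"
    by (rule one_minus_unit[OF eps]; simp)+
  then have unit: "\<not> int p dvd 1 - int eps" "\<not> int p dvd int (eps + 1)" "\<not> int p dvd int (eps\<^sup>2 + eps + 1)"
    unfolding factor2 factor3 unit_mult by auto
  define x y where "x = L (int (eps + 1))" and "y = L (int (eps\<^sup>2 + eps + 1))"
  have t3: "(3 :: int) ^ f dvd int t"
    using assms(4) by (metis of_nat_dvd_iff of_nat_numeral of_nat_power)
  then have fN: "(3 :: int) ^ (f + 1) dvd 3 * int t"
    by simp
  then have "int (3 ^ (f + 1)) dvd 3 * int t"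
    by simp
  then have dn: "int (3 ^ f) dvd n" "int (3 ^ (f + 1)) dvd n"
    unfolding n using t3 by (simp_all only: dvd_mult of_nat_power of_nat_numeral)
  have x: "int (3 ^ f) dvd x" "\<not> int (3 ^ (f + 1)) dvd x"
    using p1 power_residue_iff[OF dn(1) _ unit(2)] power_residue_iff[OF dn(2) _ unit(2)] unfolding x_def by auto
  have y: "int (3 ^ f) dvd y" "\<not> int (3 ^ (f + 1)) dvd y"
    using p2 power_residue_iff[OF dn(1) _ unit(3)] power_residue_iff[OF dn(2) _ unit(3)] unfolding y_def by auto
  \<comment> \<open>The quotient of the two numbers as a natural number, to which \<open>p3\<close>
    applies; its logarithm is \<open>y - x\<close>.\<close>
  define z where "z = nat (E (y - x) mod int p)"
  have z: "[int z = E (y - x)] (mod int p)"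
    using p_gt by (simp add: z_def cong_def)
  then have z_unit: "\<not> int p dvd int z"
    using cong_unit E_unit by blast
  have "[int z * int (eps + 1) = E (y - x) * E x] (mod int p)"
    using z E_L[OF unit(2)] unfolding x_def by (intro cong_mult) (auto intro: cong_sym)
  moreover have "[E (y - x) * E x = E y] (mod int p)"
    using E_add[of "y - x" x] by (simp add: cong_sym)
  ultimately have "[int z * int (eps + 1) = int (eps\<^sup>2 + eps + 1)] (mod int p)"
    using E_L[OF unit(3)] unfolding y_def by (blast intro: cong_trans)
  then have "[z * (eps + 1) = eps\<^sup>2 + eps + 1] (mod p)"
    by (metis cong_int_iff of_nat_mult)
  then have "\<not> int (3 ^ (f + 1)) dvd L (int z)"
    using p3 power_residue_iff[OF dn(2) _ z_unit] by simp
  moreover have "[L (int z) = y - x] (mod n)"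
    by (rule L_eqI[OF cong_sym[OF z]])
  then have "[L (int z) = y - x] (mod int (3 ^ (f + 1)))"
    using dn(2) cong_dvd_modulus by blast
  ultimately have yx: "\<not> int (3 ^ (f + 1)) dvd y - x"
    using cong_dvd_iff by blast
  obtain w v where wv: "x = 3 ^ f * w" "y = 3 ^ f * v"
    using x(1) y(1) by (auto elim!: dvdE)
  have w: "\<not> 3 dvd w" "\<not> 3 dvd v" "\<not> 3 dvd v - w"
    using x(2) y(2) yx unfolding wv by (auto simp flip: right_diff_distrib)
  show ?thesis
  proof (rule crc_base_radical_logs[where h = 3 and A' = "\<lambda>a. 3 dvd a div 3 ^ f"
        and lam = "\<lambda>d. if d = 1 then 0 else if d = 2 then x else y" and base = "L (1 - int eps)", OF _ _ eps n], goal_cases)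
    case (3 a b)
    then show ?case
      using digit_cong[OF _ fN] by auto
  next
    case (4 d)
    then have "d = 1 \<or> d = 2 \<or> d = 3" by auto
    then show ?case
      using L_mult[OF unit(1,2)] L_mult[OF unit(1,3)] factor2 factor3 by (auto simp: x_def y_def)
  next
    case (5 a)
    have "{1..3} = {1, 2, 3 :: nat}" by auto
    moreover have "(a - x) div 3 ^ f = a div 3 ^ f - w" "(a - y) div 3 ^ f = a div 3 ^ f - v"
      unfolding wv by (rule digit_shift; simp)+
    moreover have "(3 dvd b \<or> 3 dvd b - w \<or> 3 dvd b - v) \<and> \<not> (3 dvd b \<and> 3 dvd b - w) \<and>
        \<not> (3 dvd b \<and> 3 dvd b - v) \<and> \<not> (3 dvd b - w \<and> 3 dvd b - v)" for b
      using w by presburger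
    ultimately show ?case
      by (simp; blast)
  qed auto
qed

section \<open>Primitive roots and orders from finite checks\<close>

lemma prime_dvd_prod_list: "prime (r :: nat) \<Longrightarrow> r dvd prod_list qs \<Longrightarrow> \<exists>q\<in>set qs. r dvd q"
  by (induction qs) (auto simp: prime_dvd_mult_iff)

text \<open>A proper divisor of \<open>p - 1\<close> divides \<open>(p - 1) / q\<close> for some
  prime factor \<open>q\<close>, so only these exponents have to be excluded.\<close>

lemma primroot_certI:
  assumes "prime p" "\<not> p dvd g" "p - 1 = prod_list qs"
    "\<And>q. q \<in> set qs \<Longrightarrow> prime q \<and> \<not> [g ^ ((p - 1) div q) = 1] (mod p)"
  shows "prime_log p g"
proof -
  have cop: "coprime p g"
    using assms prime_imp_coprime by blast
  have dvd: "ord p g dvd p - 1"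
    using order_divides_totient[OF cop] assms(1) by (simp add: totient_prime)
  have "ord p g = p - 1"
  proof (rule ccontr)
    assume "ord p g \<noteq> p - 1"
    obtain c where c: "p - 1 = ord p g * c"
      using dvd by blast
    then have "c \<noteq> 1"
      using \<open>ord p g \<noteq> p - 1\<close> by auto
    then obtain r where r: "prime r" "r dvd c"
      using prime_factor_nat by blast
    then have "r dvd prod_list qs"
      using c assms(3) by (metis dvd_mult)
    then obtain q where q: "q \<in> set qs" "r dvd q"
      using prime_dvd_prod_list[OF r(1)] by blast
    then have "r = q"
      using assms(4) r(1) primes_dvd_imp_eq by blast
    then obtain c' where "c = q * c'"
      using r by blast
    then have "(p - 1) div q = ord p g * c'"
      using c r(1) \<open>r = q\<close> by (simp add: prime_gt_0_nat)
    then have "[g ^ ((p - 1) div q) = 1] (mod p)"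
      by (simp add: ord_divides')
    then show False
      using assms(4) q by blast
  qed
  then show ?thesis
    using assms(1) cop prime_gt_0_nat by (auto simp: prime_log_def residue_primroot_def totient_prime)
qed

lemma unique_filter:
  assumes "length (filter P xs) = 1"
  shows "\<exists>d\<in>set xs. P d \<and> (\<forall>d'\<in>set xs. P d' \<longrightarrow> d' = d)"
proof -
  obtain d where "filter P xs = [d]"
    using assms by (auto simp: length_Suc_conv)
  then have "set (filter P xs) = {d}"
    by simp
  then show ?thesis by auto
qed

lemma ord_5: "[eps ^ 5 = 1] (mod p) \<Longrightarrow> \<not> [eps = 1] (mod p) \<Longrightarrow> ord p eps = 5" for eps p :: nat
proof -
  assume a: "[eps ^ 5 = 1] (mod p)" "\<not> [eps = 1] (mod p)"
  have "ord p eps dvd 5"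
    using a(1) ord_divides by blast
  moreover have "prime (5 :: nat)" by simp
  ultimately have "ord p eps = 1 \<or> ord p eps = 5"
    by (simp only: prime_nat_iff)
  then show ?thesis
    using a(2) ord_eq_Suc_0_iff by auto
qed

lemma ord_9: "[eps ^ 9 = 1] (mod p) \<Longrightarrow> \<not> [eps ^ 3 = 1] (mod p) \<Longrightarrow> ord p eps = 9" for eps p :: nat
proof -
  assume a: "[eps ^ 9 = 1] (mod p)" "\<not> [eps ^ 3 = 1] (mod p)"
  have "ord p eps dvd 3 ^ 2"
    using a(1) ord_divides by auto
  moreover have "prime (3 :: nat)" by simp
  ultimately obtain i where i: "i \<le> 2" "ord p eps = 3 ^ i"
    using divides_primepow_nat by blast
  moreover have "\<not> 3 ^ i dvd (3 :: nat)"
    using a(2) i ord_divides by metis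
  ultimately show ?thesis
    by (auto simp: le_Suc_eq numeral_2_eq_2)
qed

section \<open>Explicit primes for block sizes 5 and 9\<close>

definition primroot_cert :: "nat \<Rightarrow> nat \<Rightarrow> (nat \<times> nat) list \<Rightarrow> bool" where
  "primroot_cert p g qs \<longleftrightarrow> p - 1 = prod_list (map (\<lambda>(q, e). q ^ e) qs) \<and> 0 < g \<and> g < p \<and>
    list_all (\<lambda>(q, e). prime q \<and> mod_exp g ((p - 1) div q) p \<noteq> 1) qs"

text \<open>\<open>as\<close> lists the logarithms to base \<open>g\<close> of \<open>1 - eps\<^sup>d\<close>; the multipliers of the blocks are the numbers whose
  logarithm modulo \<open>M\<close> lies in \<open>C\<close>.\<close>

type_synonym radical_data = "nat \<times> nat \<times> nat \<times> (nat \<times> nat) list \<times> int list \<times> int \<times> int list"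

text \<open>Logarithms and tiling are certified separately: the former by simplification of modular
  powers and primality, the latter by evaluation. The exponent \<open>r\<close> is the largest
  proper divisor of \<open>2 h + 1\<close> in both uses, so that \<open>eps^r\<close> being
  different from 1 pins down the order; \<open>ix\<close> spells out the pairs
  \<open>(d, d + 1)\<close> as numerals.\<close>

fun radical_log_cert :: "nat \<Rightarrow> nat \<Rightarrow> (nat \<times> nat) list \<Rightarrow> radical_data \<Rightarrow> bool" where
  "radical_log_cert h r ix (p, g, eps, qs, as, M, C) \<longleftrightarrow>
    primroot_cert p g qs \<and>
    mod_exp eps (2 * h + 1) p = 1 \<and> mod_exp eps r p \<noteq> 1 \<and>
    2 * (2 * h + 1) dvd p - 1 \<and> 0 < M \<and> M dvd int ((p - 1) div (2 * (2 * h + 1))) \<and>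
    list_all (\<lambda>(d, e). 0 \<le> as ! d \<and>
      int (mod_exp g (nat (as ! d)) p) = (1 - int (mod_exp eps e p)) mod int p) ix"

fun radical_tile_cert :: "nat \<Rightarrow> radical_data \<Rightarrow> bool" where
  "radical_tile_cert h (p, g, eps, qs, as, M, C) \<longleftrightarrow>
    list_all (\<lambda>r. length (filter (\<lambda>d. (r - as ! d) mod M \<in> set C) [0..<h]) = 1) [0..M - 1]"

lemma primroot_mod_exp:
  assumes "prime p" "primroot_cert p g qs" shows "prime_log p g"
proof (rule primroot_certI[OF assms(1)])
  note cert = assms(2)[unfolded primroot_cert_def]
  show "\<not> p dvd g"
    using cert by (simp add: nat_dvd_not_less)
  have "prod_list (concat (map (\<lambda>(q, e). replicate e q) xs)) = prod_list (map (\<lambda>(q, e). q ^ e) xs)" for xs :: "(nat \<times> nat) list"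
    by (induction xs) auto
  then show "p - 1 = prod_list (concat (map (\<lambda>(q, e). replicate e q) qs))"
    using cert by simp
  show "prime q \<and> \<not> [g ^ ((p - 1) div q) = 1] (mod p)" if "q \<in> set (concat (map (\<lambda>(q, e). replicate e q) qs))" for q
  proof -
    from that obtain e where "(q, e) \<in> set qs"
      by (fastforce split: prod.splits)
    then have "prime q \<and> mod_exp g ((p - 1) div q) p \<noteq> 1"
      using cert unfolding list_all_iff by blast
    then show ?thesis
      using prime_gt_1_nat[OF assms(1)] by (simp add: mod_exp_def cong_def)
  qed
qed

lemma radical_certD:
  assumes "prime p" "radical_log_cert h r ix (p, g, eps, qs, as, M, C)"
    "radical_tile_cert h (p, g, eps, qs, as, M, C)" "0 < h"
    and ix: "\<And>d. d < h \<Longrightarrow> (d, d + 1) \<in> set ix"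
    and eps: "[eps ^ (2 * h + 1) = 1] (mod p) \<Longrightarrow> \<not> [eps ^ r = 1] (mod p) \<Longrightarrow> ord p eps = 2 * h + 1"
  shows "crc_base (2 * h + 1) p"
proof -
  let ?k = "2 * h + 1"
  note cert = assms(2)[unfolded radical_log_cert.simps]
  interpret prime_log p g
    using primroot_mod_exp[OF assms(1)] cert by blast
  have "mod_exp eps ?k p = 1" "mod_exp eps r p \<noteq> 1"
    using cert by blast+
  then have ord: "ord p eps = ?k"
    using p_gt by (intro eps) (auto simp: mod_exp_def cong_def)
  obtain N where N: "p - 1 = 2 * ?k * N"
    using cert by blast
  have "n = int (p - 1)"
    using p_gt by simp
  then have n: "n = 2 * int ?k * int N"
    unfolding N by (simp only: of_nat_mult of_nat_numeral)
  have "M dvd int ((p - 1) div (2 * ?k))" and M: "0 < M"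
    using cert by blast+
  moreover have "(p - 1) div (2 * ?k) = N"
    unfolding N by (rule nonzero_mult_div_cancel_left) simp
  ultimately have MN: "M dvd int N"
    by (simp only:)
  have tile: "length (filter (\<lambda>d. (r - as ! d) mod M \<in> set C) [0..<h]) = 1" if "r \<in> set [0..M - 1]" for r
    using assms(3) that unfolding radical_tile_cert.simps list_all_iff by blast
  show ?thesis
  proof (rule crc_base_radical_logs[where A' = "\<lambda>y. y mod M \<in> set C" and lam = "\<lambda>d. as ! (d - 1)" and base = 0,
        OF refl assms(4) ord n], goal_cases)
    case (1 a b)
    then have "[a = b] (mod M)"
      using MN cong_dvd_modulus by blast
    then show ?case
      using 1 by (simp add: cong_def)
  next
    case (2 d)
    then have d: "d - 1 < h" "d - 1 + 1 = d" by auto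
    have "(d - 1, d - 1 + 1) \<in> set ix"
      using ix d(1) by blast
    moreover have "list_all (\<lambda>(d, e). 0 \<le> as ! d \<and>
        int (mod_exp g (nat (as ! d)) p) = (1 - int (mod_exp eps e p)) mod int p) ix"
      using cert by blast
    ultimately have "0 \<le> as ! (d - 1) \<and> int (mod_exp g (nat (as ! (d - 1))) p) = (1 - int (mod_exp eps (d - 1 + 1) p)) mod int p"
      unfolding list_all_iff by fast
    then have nn: "0 \<le> as ! (d - 1)" and "[int g ^ nat (as ! (d - 1)) = 1 - int eps ^ d] (mod int p)"
      unfolding d(2) by (simp_all add: mod_exp_def cong_def of_nat_mod mod_diff_right_eq)
    then have "[E (int (nat (as ! (d - 1)))) = 1 - int eps ^ d] (mod int p)"
      using E_nat cong_trans by blast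
    then show ?case
      using L_eqI nn by simp
  next
    case (3 y)
    have red: "(y - x) mod M = (y mod M - x) mod M" for x
      by (simp add: mod_diff_left_eq)
    have "y mod M \<in> set [0..M - 1]"
      using M by simp
    from unique_filter[OF tile[OF this]] obtain d where d: "d \<in> set [0..<h]" "(y mod M - as ! d) mod M \<in> set C"
      "\<forall>d'\<in>set [0..<h]. (y mod M - as ! d') mod M \<in> set C \<longrightarrow> d' = d"
      by blast
    show ?case
    proof (intro bexI[of _ "d + 1"] conjI ballI impI)
      show "(y - as ! (d + 1 - 1)) mod M \<in> set C"
        using d(2) red by simp
      fix d' assume d': "d' \<in> {1..h}" "(y - as ! (d' - 1)) mod M \<in> set C"
      then have "d' - 1 \<in> set [0..<h]" "(y mod M - as ! (d' - 1)) mod M \<in> set C"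
        using red[of "as ! (d' - 1)"] by auto
      then have "d' - 1 = d"
        using d(3) by blast
      then show "d' = d + 1"
        using d' by auto
    qed (use d(1) in auto)
  qed
qed

lemma radical_cert_5:
  assumes "radical_log_cert 2 1 [(0, 1), (1, 2)] (p, X)" "radical_tile_cert 2 (p, X)" "prime p" shows "crc_base 5 p"
proof -
  obtain g eps qs as M C where X: "X = (g, eps, qs, as, M, C)"
    by (metis prod.collapse)
  have "[eps ^ (2 * 2 + 1) = 1] (mod p) \<Longrightarrow> \<not> [eps ^ 1 = 1] (mod p) \<Longrightarrow> ord p eps = 2 * 2 + 1"
    using ord_5[of eps p] by simp
  from radical_certD[OF assms(3) assms(1,2)[unfolded X] _ _ this] show ?thesis
    by (simp add: numeral_eq_Suc less_Suc_eq disj_imp)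
qed

lemma radical_cert_9:
  assumes "radical_log_cert 4 3 [(0, 1), (1, 2), (2, 3), (3, 4)] (p, X)" "radical_tile_cert 4 (p, X)" "prime p" shows "crc_base 9 p"
proof -
  obtain g eps qs as M C where X: "X = (g, eps, qs, as, M, C)"
    by (metis prod.collapse)
  have "[eps ^ (2 * 4 + 1) = 1] (mod p) \<Longrightarrow> \<not> [eps ^ 3 = 1] (mod p) \<Longrightarrow> ord p eps = 2 * 4 + 1"
    using ord_9[of eps p] by simp
  from radical_certD[OF assms(3) assms(1,2)[unfolded X] _ _ this] show ?thesis
    by (simp add: numeral_eq_Suc less_Suc_eq disj_imp)
qed

text \<open>The multipliers are again given by a vanishing binary digit of the logarithm: digit 0
  when \<open>M = 2\<close>, digit 1 when \<open>M = 4\<close>.\<close>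

definition radical_data_5 :: "radical_data list" where
  "radical_data_5 = [
   (41,6,10,[(2, 3), (5, 1)],[10, 13],2,[0]),
   (61,2,9,[(2, 2), (3, 1), (5, 1)],[33, 56],2,[0]),
   (241,7,91,[(2, 4), (3, 1), (5, 1)],[92, 49],2,[0]),
   (281,3,86,[(2, 3), (5, 1), (7, 1)],[212, 105],2,[0]),
   (401,3,72,[(2, 4), (5, 2)],[269, 75],4,[0, 1]),
   (421,2,279,[(2, 2), (3, 1), (5, 1), (7, 1)],[19, 246],2,[0]),
   (601,7,423,[(2, 3), (3, 1), (5, 2)],[188, 267],2,[0]),
   (641,3,357,[(2, 7), (5, 1)],[638, 629],2,[0]),
   (661,2,247,[(2, 2), (3, 1), (5, 1), (11, 1)],[605, 602],2,[0]),
   (701,2,210,[(2, 2), (5, 2), (7, 1)],[173, 6],2,[0]),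
   (761,6,67,[(2, 3), (5, 1), (19, 1)],[542, 156],4,[0, 1]),
   (821,2,470,[(2, 2), (5, 1), (41, 1)],[362, 255],2,[0]),
   (881,3,286,[(2, 4), (5, 1), (11, 1)],[581, 154],2,[0])]"

text \<open>For six of the primes the four logarithms form a complete residue system modulo 4. At
  7489 they are 3, 0, 7, 4 modulo 8, and the multiplier classes 0 and 2 complete the tiling.\<close>

definition radical_data_9 :: "radical_data list" where
  "radical_data_9 = [
   (73,5,2,[(2, 3), (3, 2)],[36, 42, 69, 43],4,[0]),
   (1153,5,97,[(2, 7), (3, 2)],[474, 676, 119, 953],4,[0]),
   (1873,10,1110,[(2, 4), (3, 2), (13, 1)],[1188, 1089, 275, 1222],4,[0]),
   (2017,5,576,[(2, 5), (3, 2), (7, 1)],[1246, 433, 1355, 1132],4,[0]),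
   (6481,7,2122,[(2, 4), (3, 4), (5, 1)],[749, 5024, 1215, 122],4,[0]),
   (7489,7,4338,[(2, 6), (3, 2), (13, 1)],[891, 3296, 6007, 7228],8,[0, 2]),
   (7561,13,7537,[(2, 3), (3, 3), (5, 1), (7, 1)],[916, 4479, 6213, 6278],4,[0])]"

lemma radical_data_5_log: "list_all (radical_log_cert 2 1 [(0, 1), (1, 2)]) radical_data_5"
  by (simp add: radical_data_5_def primroot_cert_def)

lemma radical_data_5_tile: "list_all (radical_tile_cert 2) radical_data_5"
  by code_simp

lemma radical_data_9_log: "list_all (radical_log_cert 4 3 [(0, 1), (1, 2), (2, 3), (3, 4)]) radical_data_9"
  by (simp add: radical_data_9_def primroot_cert_def)

lemma radical_data_9_tile: "list_all (radical_tile_cert 4) radical_data_9"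
  by code_simp

text \<open>For the primes at which the powers of \<open>eps\<close> fail, \<open>Ds\<close> is another block; \<open>dl\<close>, \<open>pl\<close> and \<open>el\<close> are the
  logarithms of its differences, of its points and of \<open>eps\<close>.\<close>

type_synonym pure_data =
  "nat \<times> nat \<times> nat \<times> (nat \<times> nat) list \<times> int list \<times> (nat \<times> nat \<times> int) list \<times> int list \<times> int \<times> int \<times> int list"

fun pure_log_cert :: "pure_data \<Rightarrow> bool" where
  "pure_log_cert (p, g, eps, qs, Ds, dl, pl, el, M, C) \<longleftrightarrow>
    primroot_cert p g qs \<and>
    mod_exp eps 5 p = 1 \<and> mod_exp eps 1 p \<noteq> 1 \<and> \<not> p dvd 5 \<and> 0 < M \<and> M dvd int p - 1 \<and>
    0 \<le> el \<and> int (mod_exp g (nat el) p) = int eps mod int p \<and>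
    map (\<lambda>(i, j, a). (i, j)) dl = [(i, j). i \<leftarrow> [0, 1, 2, 3, 4], j \<leftarrow> [0, 1, 2, 3, 4], i \<noteq> j] \<and>
    list_all (\<lambda>(i, j, a). 0 \<le> a \<and> int (mod_exp g (nat a) p) = (Ds ! i - Ds ! j) mod int p) dl \<and>
    list_all (\<lambda>i. 0 \<le> pl ! i \<and> int (mod_exp g (nat (pl ! i)) p) = Ds ! i mod int p) [0, 1, 2, 3, 4]"

text \<open>The second test says that a class is hit by at most one point and that with each class
  that is hit, its shift by the logarithm of \<open>eps\<close> is hit too. This is the disjointness
  and closure that the completing blocks require.\<close>

fun pure_tile_cert :: "pure_data \<Rightarrow> bool" where
  "pure_tile_cert (p, g, eps, qs, Ds, dl, pl, el, M, C) \<longleftrightarrow>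
    list_all (\<lambda>r. length (filter (\<lambda>(i, j, a). (r - a) mod M \<in> set C) dl) = 1) [0..M - 1] \<and>
    list_all (\<lambda>r. let hit = filter (\<lambda>i. (r - pl ! i) mod M \<in> set C) [0, 1, 2, 3, 4] in
      hit = [] \<or> (tl hit = [] \<and>
        list_ex (\<lambda>i. (r + el - pl ! i) mod M \<in> set C) [0, 1, 2, 3, 4])) [0..M - 1]"

text \<open>The scaling is normalised so that the first two points differ by 1. For
  \<open>M = 20\<close> the logarithms of the twenty differences represent all residues; at 521 they
  fill half of the residues modulo 40, and the translate by 10 fills the other half.\<close>

definition pure_data_5 :: "pure_data list" where
  "pure_data_5 = [
   (101,2,95,[(2, 2), (5, 2)],[2, 3, 21, 78, 74],[(0, 1, 50), (0, 2, 46), (0, 3, 48), (0, 4, 91), (1, 0, 0),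
     (1, 2, 89), (1, 3, 67), (1, 4, 94), (2, 0, 96), (2, 1, 39), (2, 3, 15), (2, 4, 73), (3, 0, 98), (3, 1,
     17), (3, 2, 65), (3, 4, 2), (4, 0, 41), (4, 1, 44), (4, 2, 23), (4, 3, 52)],[1, 69, 78, 36,
     57],20,20,[0]),
   (181,2,59,[(2, 2), (3, 2), (5, 1)],[36, 37, 142, 55, 166],[(0, 1, 90), (0, 2, 8), (0, 3, 45), (0, 4, 51),
     (1, 0, 0), (1, 2, 137), (1, 3, 23), (1, 4, 166), (2, 0, 98), (2, 1, 47), (2, 3, 104), (2, 4, 149), (3,
     0, 135), (3, 1, 113), (3, 2, 14), (3, 4, 172), (4, 0, 141), (4, 1, 76), (4, 2, 59), (4, 3, 82)],[114,
     26, 130, 38, 122],36,20,[0]),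
   (461,2,88,[(2, 2), (5, 1), (23, 1)],[176, 177, 2, 71, 251],[(0, 1, 230), (0, 2, 219), (0, 3, 418), (0, 4,
     437), (1, 0, 0), (1, 2, 355), (1, 3, 243), (1, 4, 246), (2, 0, 449), (2, 1, 125), (2, 3, 61), (2, 4,
     244), (3, 0, 188), (3, 1, 13), (3, 2, 291), (3, 4, 42), (4, 0, 207), (4, 1, 16), (4, 2, 14), (4, 3,
     272)],[93, 197, 1, 425, 189],92,20,[0]),
   (521,3,25,[(2, 3), (5, 1), (13, 1)],[157, 158, 91, 177, 86],[(0, 1, 260), (0, 2, 97), (0, 3, 428), (0, 4,
     164), (1, 0, 0), (1, 2, 139), (1, 3, 431), (1, 4, 436), (2, 0, 357), (2, 1, 399), (2, 3, 253), (2, 4,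
     52), (3, 0, 168), (3, 1, 171), (3, 2, 513), (3, 4, 305), (4, 0, 424), (4, 1, 176), (4, 2, 312), (4, 3,
     45)],[161, 337, 305, 369, 513],104,40,[0, 10]),
   (541,2,48,[(2, 2), (3, 3), (5, 1)],[315, 316, 518, 538, 109],[(0, 1, 270), (0, 2, 267), (0, 3, 173), (0,
     4, 449), (1, 0, 0), (1, 2, 255), (1, 3, 34), (1, 4, 396), (2, 0, 537), (2, 1, 525), (2, 3, 228), (2, 4,
     131), (3, 0, 443), (3, 1, 304), (3, 2, 498), (3, 4, 532), (4, 0, 179), (4, 1, 126), (4, 2, 401), (4, 3,
     262)],[422, 390, 458, 374, 46],108,20,[0]),
   (941,2,412,[(2, 2), (5, 1), (47, 1)],[689, 690, 377, 910, 98],[(0, 1, 470), (0, 2, 79), (0, 3, 422), (0,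
     4, 796), (1, 0, 0), (1, 2, 828), (1, 3, 127), (1, 4, 94), (2, 0, 549), (2, 1, 358), (2, 3, 105), (2, 4,
     323), (3, 0, 892), (3, 1, 597), (3, 2, 575), (3, 4, 841), (4, 0, 326), (4, 1, 564), (4, 2, 793), (4, 3,
     371)],[639, 635, 391, 567, 823],188,20,[0])]"

lemma pure_data_5_log: "list_all pure_log_cert pure_data_5"
  by (simp add: pure_data_5_def primroot_cert_def)

lemma pure_data_5_tile: "list_all pure_tile_cert pure_data_5"
  by code_simp

lemma pure_certD:
  assumes "prime p" "pure_log_cert (p, g, eps, qs, Ds, dl, pl, el, M, C)"
    "pure_tile_cert (p, g, eps, qs, Ds, dl, pl, el, M, C)"
  shows "crc_base 5 p"
proof -
  note cert = assms(2)[unfolded pure_log_cert.simps] and tile_cert = assms(3)[unfolded pure_tile_cert.simps]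
  interpret prime_log p g
    using primroot_mod_exp[OF assms(1)] cert by blast
  have "mod_exp eps 5 p = 1" "mod_exp eps 1 p \<noteq> 1"
    using cert by blast+
  then have ord: "ord p eps = 5"
    using p_gt by (intro ord_5) (auto simp: mod_exp_def cong_def)
  have "\<not> p dvd 5"
    using cert by blast
  then have cop: "coprime 5 p"
    using prime_imp_coprime[OF assms(1)] coprime_commute by blast
  have M: "0 < M" "M dvd n"
    using cert by blast+
  define A where "A y \<longleftrightarrow> y mod M \<in> set C" for y
  have A_cong: "A y \<longleftrightarrow> A y'" if "[y = y'] (mod n)" for y y'
    using cong_dvd_modulus[OF that M(2)] by (simp add: A_def cong_def)
  then have A: "periodic A"
    unfolding periodic_def by blast
  have A_log: "A (y - L x) \<longleftrightarrow> (y mod M - a) mod M \<in> set C" and unit: "\<not> int p dvd x"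
    if "0 \<le> a \<and> int (mod_exp g (nat a) p) = x mod int p" for x a y
  proof -
    have "[int g ^ nat a = x] (mod int p)"
      using that by (simp add: mod_exp_def cong_def of_nat_mod)
    then have "[E (int (nat a)) = x] (mod int p)"
      using E_nat cong_trans by blast
    then have ea: "[E a = x] (mod int p)"
      using that by simp
    then show "\<not> int p dvd x"
      using cong_unit E_unit by blast
    have "A (y - L x) \<longleftrightarrow> A (y - a)"
      using A_cong cong_diff[OF cong_refl L_eqI[OF ea]] by blast
    then show "A (y - L x) \<longleftrightarrow> (y mod M - a) mod M \<in> set C"
      by (simp add: A_def mod_diff_left_eq)
  qed
  have five: "i \<in> set [0, 1, 2, 3, 4]" if "i < 5" for i :: nat
    using that by auto
  have pt: "0 \<le> pl ! i \<and> int (mod_exp g (nat (pl ! i)) p) = Ds ! i mod int p" if "i < 5" for i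
    using cert five[OF that] unfolding list_all_iff by blast
  have y_mod: "y mod M \<in> set [0..M - 1]" for y
    using M by simp
  have hits: "filter (\<lambda>i. (y mod M - pl ! i) mod M \<in> set C) [0, 1, 2, 3, 4] = [] \<or>
      (tl (filter (\<lambda>i. (y mod M - pl ! i) mod M \<in> set C) [0, 1, 2, 3, 4]) = [] \<and>
        (\<exists>i\<in>set [0, 1, 2, 3, 4]. (y mod M + el - pl ! i) mod M \<in> set C))" for y
    using tile_cert y_mod[of y] unfolding list_all_iff list_ex_iff Let_def by blast
  have idx: "set (map (\<lambda>(i, j, a). (i, j)) dl) = {(i, j). i < 5 \<and> j < 5 \<and> i \<noteq> j}"
  proof -
    have "map (\<lambda>(i, j, a). (i, j)) dl = [(i, j). i \<leftarrow> [0, 1, 2, 3, 4], j \<leftarrow> [0, 1, 2, 3, 4], i \<noteq> j]"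
      using cert by blast
    moreover have "[0, 1, 2, 3, 4] = [0..<5]"
      by (simp add: upt_rec)
    ultimately show ?thesis
      by (simp only:) auto
  qed
  have dl: "0 \<le> a \<and> int (mod_exp g (nat a) p) = (Ds ! i - Ds ! j) mod int p" if "(i, j, a) \<in> set dl" for i j a
    using cert that unfolding list_all_iff by blast
  show ?thesis
  proof (rule crc_base_pure[where D = "\<lambda>i. Ds ! i", OF _ cop A ord], goal_cases)
    case 2
    show ?case
      unfolding tile_def
    proof (intro conjI ballI allI impI)
      fix e assume "e \<in> {(i, j). i < 5 \<and> j < 5 \<and> i \<noteq> (j :: nat)}"
      then obtain i j a where "e = (i, j)" "(i, j, a) \<in> set dl"
        unfolding idx[symmetric] by auto
      then show "\<not> int p dvd (case e of (i, j) \<Rightarrow> Ds ! i - Ds ! j)"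
        using unit[OF dl] by simp
    next
      fix y
      have "length (filter (\<lambda>(i, j, a). (y mod M - a) mod M \<in> set C) dl) = 1"
        using tile_cert y_mod[of y] unfolding list_all_iff by blast
      from unique_filter[OF this] obtain i j a where ija: "(i, j, a) \<in> set dl" "(y mod M - a) mod M \<in> set C"
        and uniq: "\<And>i' j' a'. (i', j', a') \<in> set dl \<Longrightarrow> (y mod M - a') mod M \<in> set C \<Longrightarrow> (i', j', a') = (i, j, a)"
        by fastforce
      have "(i, j) \<in> set (map (\<lambda>(i, j, a). (i, j)) dl)"
        using ija by force
      then show "\<exists>e\<in>{(i, j). i < 5 \<and> j < 5 \<and> i \<noteq> j}. A (y - L (case e of (i, j) \<Rightarrow> Ds ! i - Ds ! j))"
        unfolding idx by (intro bexI[of _ "(i, j)"]) (simp_all add: A_log[OF dl[OF ija(1)]] ija(2))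
      have one: "e = (i, j)"
        if hit: "e \<in> {(i, j). i < 5 \<and> j < 5 \<and> i \<noteq> j}" "A (y - L (case e of (i, j) \<Rightarrow> Ds ! i - Ds ! j))" for e
      proof -
        obtain i' j' a' where e: "e = (i', j')" "(i', j', a') \<in> set dl"
          using hit(1) unfolding idx[symmetric] by auto
        then show ?thesis
          using uniq[OF e(2)] A_log[OF dl[OF e(2)]] hit(2) by simp
      qed
      show "e = e'" if "e \<in> {(i, j). i < 5 \<and> j < 5 \<and> i \<noteq> j}" "e' \<in> {(i, j). i < 5 \<and> j < 5 \<and> i \<noteq> j}"
        "A (y - L (case e of (i, j) \<Rightarrow> Ds ! i - Ds ! j))" "A (y - L (case e' of (i, j) \<Rightarrow> Ds ! i - Ds ! j))" for e e'
        using one that by blast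
    qed
  next
    case (3 i)
    then show ?case
      using unit[OF pt] by blast
  next
    case (4 i j y)
    let ?hit = "filter (\<lambda>i. (y mod M - pl ! i) mod M \<in> set C) [0, 1, 2, 3, 4]"
    have mem: "i \<in> set ?hit" "j \<in> set ?hit"
      using 4 A_log[OF pt] five by auto
    then have "tl ?hit = []"
      using hits[of y] by (cases ?hit) auto
    then show ?case
      using mem by (cases ?hit) auto
  next
    case (5 i y)
    let ?hit = "filter (\<lambda>i. (y mod M - pl ! i) mod M \<in> set C) [0, 1, 2, 3, 4]"
    have "i \<in> set ?hit"
      using 5 A_log[OF pt] five by auto
    then obtain j where j: "j \<in> set [0, 1, 2, 3, 4]" "(y mod M + el - pl ! j) mod M \<in> set C"
      using hits[of y] by (metis list.set_cases neq_Nil_conv empty_iff empty_set)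
    have el: "0 \<le> el" "int (mod_exp g (nat el) p) = int eps mod int p"
      using cert by blast+
    then have "[int g ^ nat el = int eps] (mod int p)"
      by (simp add: mod_exp_def cong_def of_nat_mod)
    then have "[E (int (nat el)) = int eps] (mod int p)"
      using E_nat cong_trans by blast
    then have "[L (int eps) = el] (mod n)"
      using L_eqI el(1) by simp
    then have "A (y + L (int eps) - L (Ds ! j)) \<longleftrightarrow> A (y + el - L (Ds ! j))"
      using A_cong cong_diff cong_add cong_refl by meson
    moreover have "j < 5" using j(1) by auto
    moreover have "((y + el) mod M - pl ! j) mod M = (y mod M + el - pl ! j) mod M"
      by (simp only: mod_diff_left_eq add_diff_eq[symmetric] mod_add_left_eq)
    ultimately show ?case
      using A_log[OF pt[OF \<open>j < 5\<close>]] j(2) by metis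
  qed simp
qed

text \<open>A composite number below 1000 has a prime factor at most 31, and 2 and 5 do not divide
  \<open>20 t + 1\<close>.\<close>

lemma primes_20: "prime (20 * t + 1) \<Longrightarrow> 0 < t \<Longrightarrow> t < 50 \<Longrightarrow>
    20 * t + 1 \<in> {41, 61, 241, 281, 401, 421, 601, 641, 661, 701, 761, 821, 881} \<or>
    20 * t + 1 \<in> {101, 181, 461, 521, 541, 941 :: nat}"
proof -
  have "\<forall>t\<in>set (1 # [2..<50]). 20 * t + 1 \<in> {41, 61, 241, 281, 401, 421, 601, 641, 661, 701, 761, 821, 881} \<or>
    20 * t + 1 \<in> {101, 181, 461, 521, 541, 941 :: nat} \<or>
    (\<exists>d\<in>{3, 7, 11, 13, 17, 19, 23, 29, 31}. d dvd 20 * t + 1 \<and> d < 20 * t + 1)"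
    by simp
  moreover assume "prime (20 * t + 1)" "0 < t" "t < 50"
  then have "\<not> (\<exists>d\<in>{3, 7, 11, 13, 17, 19, 23, 29, 31}. d dvd 20 * t + 1 \<and> d < 20 * t + 1)"
  proof (intro notI, elim bexE conjE)
    fix d assume d: "d \<in> {3, 7, 11, 13, 17, 19, 23, 29, 31}" "d dvd 20 * t + 1" "d < 20 * t + 1"
    have "d = 1 \<or> d = 20 * t + 1"
      using \<open>prime (20 * t + 1)\<close> d(2) unfolding prime_nat_iff by blast
    then have "d = 1"
      using d(3) by simp
    then show False
      using d(1) by simp
  qed
  moreover have "t \<in> insert 1 (set [2..<50])"
    unfolding set_upt using \<open>0 < t\<close> \<open>t < 50\<close> by auto
  then have "t \<in> set (1 # [2..<50])"
    by (simp only: list.set)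
  ultimately show ?thesis by blast
qed

lemma crc_base_case3a:
  assumes "prime p" "case3a k p" shows "crc_base k p"
proof -
  obtain t where t: "k = 5" "0 < t" "p = 20 * t + 1" "p < 1000"
    using assms(2) unfolding case3a_def by auto
  then consider "p \<in> {41, 61, 241, 281, 401, 421, 601, 641, 661, 701, 761, 821, 881}"
    | "p \<in> {101, 181, 461, 521, 541, 941}"
    using primes_20[of t] assms(1) by auto
  then show ?thesis
  proof cases
    case 1
    then obtain X where "(p, X) \<in> set radical_data_5"
      by (auto simp: radical_data_5_def)
    then show ?thesis
      using radical_data_5_log radical_data_5_tile radical_cert_5 assms(1) t(1) unfolding list_all_iff by blast
  next
    case 2
    then obtain g eps qs Ds dl pl el M C where "(p, g, eps, qs, Ds, dl, pl, el, M, C) \<in> set pure_data_5"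
      by (auto simp: pure_data_5_def)
    then show ?thesis
      using pure_data_5_log pure_data_5_tile pure_certD assms(1) t(1) unfolding list_all_iff by blast
  qed
qed

lemma crc_base_case5:
  assumes "prime p" "case5 k p" shows "crc_base k p"
proof -
  obtain X where "(p, X) \<in> set radical_data_9"
    using assms(2) by (auto simp: case5_def radical_data_9_def)
  then show ?thesis
    using radical_data_9_log radical_data_9_tile radical_cert_9 assms unfolding list_all_iff case5_def by blast
qed

lemma crc_base_case1: "prime p \<Longrightarrow> case1 k p \<Longrightarrow> crc_base k p"
  using crc_base_3 unfolding case1_def by blast

lemma crc_base_case3b:
  assumes "prime p" "case3b k p" shows "crc_base k p"
proof -
  obtain t where t: "k = 5" "0 < t" "p = 20 * t + 1"
    and c: "\<And>e. 2 ^ e dvd t \<Longrightarrow> \<not> 2 ^ (e + 1) dvd t \<Longrightarrow>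
      \<exists>eps. prim_root_unity p 5 eps \<and> \<not> is_power_mod p (2 ^ (e + 1)) (eps + 1)"
    using assms(2) unfolding case3b_def by blast
  obtain e where e: "2 ^ e dvd t" "\<not> 2 ^ (e + 1) dvd t"
    using ex_exact_power[OF t(2), of 2] by auto
  then obtain eps where "ord p eps = 5" "\<not> is_power_mod p (2 ^ (e + 1)) (eps + 1)"
    using c unfolding prim_root_unity_def by blast
  then show ?thesis
    using crc_base_5[OF assms(1) t(3,2) e] t(1) by blast
qed

lemma crc_base_case4:
  assumes "prime p" "case4 k p" shows "crc_base k p"
proof -
  obtain t f eps where t: "k = 7" "0 < t" "p = 42 * t + 1" "3 ^ f dvd t" "ord p eps = 7"
    and c: "is_power_mod p (3 ^ f) (eps + 1)" "\<not> is_power_mod p (3 ^ (f + 1)) (eps + 1)"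
      "is_power_mod p (3 ^ f) (eps\<^sup>2 + eps + 1)" "\<not> is_power_mod p (3 ^ (f + 1)) (eps\<^sup>2 + eps + 1)"
      "\<forall>z. [z * (eps + 1) = eps\<^sup>2 + eps + 1] (mod p) \<longrightarrow>
        is_power_mod p (3 ^ f) z \<and> \<not> is_power_mod p (3 ^ (f + 1)) z"
    using assms(2) unfolding case4_def prim_root_unity_def by blast
  show ?thesis
    using crc_base_7[OF assms(1) t(3,2,4,5) c(1-4)] c(5) t(1) by blast
qed

section \<open>Block size 4\<close>

type_synonym cyc = "int \<times> int \<times> int \<times> int"
text \<open>A quadruple \<open>(a, b, c, d)\<close> stands for \<open>a + b z + c z\<^sup>2 + d z\<^sup>3\<close> with \<open>z\<close> a primitive 12th root of unity, an
  exponent vector \<open>(k, a, b, c)\<close> for \<open>z\<^sup>k (1 + i)\<^sup>a (\<surd>3)\<^sup>b w\<^sup>c\<close> with \<open>i = z\<^sup>3\<close> and \<open>w = 1 + z - z\<^sup>2 - z\<^sup>3\<close>.\<close>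

type_synonym unit_exp = "nat \<times> nat \<times> nat \<times> nat"

text \<open>The coordinates come from the reduction \<open>z^4 = z^2 - 1\<close> given by the
  twelfth cyclotomic polynomial. The factors of these four maps are \<open>z\<close>,
  \<open>1 + z^3\<close>, \<open>2 z - z^3\<close> and \<open>1 + z - z^2 - z^3\<close>.\<close>

fun mul_zeta :: "cyc \<Rightarrow> cyc" where "mul_zeta (a, b, c, d) = (- d, a, b + d, c)"
fun mul_one_i :: "cyc \<Rightarrow> cyc" where "mul_one_i (a, b, c, d) = (a - b - d, b - c, b + c, a + c + d)"
fun mul_sqrt3 :: "cyc \<Rightarrow> cyc" where "mul_sqrt3 (a, b, c, d) = (b - d, 2 * a + c, b + 2 * d, c - a)"
fun mul_fund :: "cyc \<Rightarrow> cyc" where "mul_fund (a, b, c, d) = (a + b + c, a + b + c + d, d - a, - a - b)"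
fun cyc_diff :: "cyc \<Rightarrow> cyc \<Rightarrow> cyc" where
  "cyc_diff (a, b, c, d) (a', b', c', d') = (a - a', b - b', c - c', d - d')"

fun cyc_unit :: "unit_exp \<Rightarrow> cyc" where
  "cyc_unit (k, a, b, c) =
    (mul_zeta ^^ k) ((mul_one_i ^^ a) ((mul_sqrt3 ^^ b) ((mul_fund ^^ c) (1, 0, 0, 0))))"

fun unit_class :: "cyc \<Rightarrow> unit_exp \<Rightarrow> int" where
  "unit_class (wz, wo, ws, we) (k, a, b, c) = int k * wz + int a * wo + int b * ws + int c * we"

text \<open>Four points and their differences, the latter in the order 10, 20, 21, 30, 31, 32.\<close>

type_synonym config = "unit_exp list \<times> unit_exp list"

text \<open>The position of the pair \<open>(i, j)\<close> with \<open>j < i\<close> in this order;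
  the list holds the triangular numbers \<open>i (i - 1) / 2\<close>.\<close>

definition tri :: "nat \<Rightarrow> nat \<Rightarrow> nat" where "tri i j = [0, 0, 1, 3] ! i + j"

text \<open>The equations are checked in the ring of integers of the cyclotomic field, so one
  verified configuration serves every prime.\<close>

definition config_ok :: "config \<Rightarrow> bool" where
  "config_ok = (\<lambda>(ps, ds). length ps = 4 \<and> length ds = 6 \<and>
    (let v = map cyc_unit ps in map cyc_unit ds =
      [cyc_diff (v ! 1) (v ! 0), cyc_diff (v ! 2) (v ! 0), cyc_diff (v ! 2) (v ! 1),
       cyc_diff (v ! 3) (v ! 0), cyc_diff (v ! 3) (v ! 1), cyc_diff (v ! 3) (v ! 2)]))"

text \<open>A configuration, a shift of all its classes modulo 12, and the second coordinates of its points.\<close>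

type_synonym block = "config \<times> int \<times> int list"

definition point_classes :: "cyc \<Rightarrow> block \<Rightarrow> int list" where
  "point_classes W = (\<lambda>((ps, ds), sh, lab). map (\<lambda>f. (unit_class W f + sh) mod 12) ps)"

definition diff_classes :: "cyc \<Rightarrow> block \<Rightarrow> int list \<times> int list" where
  "diff_classes W = (\<lambda>((ps, ds), sh, lab). (map (\<lambda>f. (unit_class W f + sh) mod 12) ds, lab))"

text \<open>Label difference and class are packed into one number below 48. Reversing a difference
  adds 6, the class of -1.\<close>

definition diff_code :: "(int list \<times> int list) list \<Rightarrow> nat \<times> nat \<times> nat \<Rightarrow> int" where
  "diff_code cs = (\<lambda>(s, i, j). case cs ! s of (D, lab) \<Rightarrow>
    (lab ! i - lab ! j) mod 4 * 12 + (if j < i then D ! tri i j else (D ! tri j i + 6) mod 12))"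

definition triples :: "(nat \<times> nat \<times> nat) list" where
  "triples = [(s, i, j). s \<leftarrow> [0..<4], i \<leftarrow> [0..<4], j \<leftarrow> [0..<4], i \<noteq> j]"

text \<open>There are as many ordered differences as codes, namely 48, and as many points in the
  first three blocks as classes, namely 12, so distinctness already means complete coverage. The
  last block provides \<open>J\<close>.\<close>

definition sol_ok :: "cyc \<Rightarrow> block list \<Rightarrow> bool" where
  "sol_ok W bs \<longleftrightarrow> length bs = 4 \<and> (\<forall>b\<in>set bs. length (snd (snd b)) = 4) \<and>
    distinct (map (diff_code (map (diff_classes W) bs)) triples) \<and>
    distinct (concat (map (point_classes W) (take 3 bs))) \<and>
    (\<forall>c\<in>{0, 1, 2, 3}. c \<in> set (map (\<lambda>x. x mod 4) (snd (snd (bs ! 3)))))"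

lemma set_triples: "set triples = {(s, i, j). s < 4 \<and> i < 4 \<and> j < 4 \<and> i \<noteq> j}"
  by (auto simp: triples_def)

lemma length_triples: "length triples = 48"
  by code_simp

lemma tri_less: "j < i \<Longrightarrow> i < 4 \<Longrightarrow> tri i j < 6"
  by (auto simp: tri_def less_Suc_eq numeral_eq_Suc)

text \<open>\<open>G\<close> is the position at which the ternary digit is read;
  \<open>3 ^ G dvd t\<close> makes that digit modulo 3 well defined on residues modulo
  \<open>n = 12 t\<close>. The two values of \<open>u\<close> allow the sign of all digits to be
  reversed at once.\<close>

locale cyc_prime = prime_log +
  fixes t G :: nat and u z :: int
  assumes t: "p = 12 * t + 1" "odd t" and G: "3 ^ G dvd t" and u: "u = 1 \<or> u = 5"
    and zeta: "[z ^ 4 - z\<^sup>2 + 1 = 0] (mod int p)"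
begin

text \<open>The class modulo 12 that is \<open>y\<close> modulo 4 and the \<open>G\<close>-th 3-adic digit of \<open>y\<close> modulo 3, the latter with
  reversed sign if \<open>u = 5\<close>.\<close>

definition Psi :: "int \<Rightarrow> int" where
  "Psi y = u * (9 * y + 4 * (y div 3 ^ G)) mod 12"

definition ev :: "cyc \<Rightarrow> int" where
  "ev = (\<lambda>(a, b, c, d). a + b * z + c * z\<^sup>2 + d * z ^ 3)"

lemma n_eq: "n = 12 * int t"
  using t by simp

lemma Psi_cong: "[y = y'] (mod n) \<Longrightarrow> Psi y = Psi y'"
proof -
  assume "[y = y'] (mod n)"
  then obtain q where q: "y' = y + 12 * int t * q"
    unfolding n_eq by (metis cong_iff_lin mult.commute)
  obtain t' where t': "int t = 3 ^ G * t'"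
    using G by (metis dvdE of_nat_mult of_nat_numeral of_nat_power)
  have "y' = y + 3 ^ G * (12 * t' * q)"
    using q t' by simp
  then have "y' div 3 ^ G = y div 3 ^ G + 12 * t' * q"
    using div_mult_self2[of "3 ^ G" y "12 * t' * q"] by simp
  then have "u * (9 * y' + 4 * (y' div 3 ^ G)) = u * (9 * y + 4 * (y div 3 ^ G)) + 12 * (u * (9 * int t * q + 4 * t' * q))"
    using q by (simp add: algebra_simps)
  then show ?thesis
    unfolding Psi_def by simp
qed

text \<open>Because of carries \<open>Psi\<close> is not additive, but a multiple of
  \<open>3 ^ G\<close> causes no carry into the digit at \<open>G\<close>.\<close>

lemma Psi_diff: "3 ^ G dvd a \<Longrightarrow> Psi (y - a) = (Psi y - Psi a) mod 12"
proof -
  assume "3 ^ G dvd a"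
  then obtain w where w: "a = 3 ^ G * w" by blast
  have e1: "(y - a) div 3 ^ G = y div 3 ^ G - w"
    using div_mult_self2[of "3 ^ G" y "- w"] by (simp add: w)
  have e2: "a div 3 ^ G = w"
    by (simp add: w)
  have "u * (9 * (y - a) + 4 * ((y - a) div 3 ^ G)) =
      u * (9 * y + 4 * (y div 3 ^ G)) - u * (9 * a + 4 * (a div 3 ^ G))"
    unfolding e1 e2 by (simp add: algebra_simps)
  then show ?thesis
    unfolding Psi_def by (simp add: mod_diff_eq)
qed

text \<open>The class of \<open>x\<close> is defined by the effect of dividing by \<open>x\<close>,
  for all \<open>y\<close> simultaneously. In this form classes add under multiplication although
  \<open>Psi\<close> itself is not additive.\<close>

definition has_class :: "int \<Rightarrow> int \<Rightarrow> bool" where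
  "has_class x q \<longleftrightarrow> \<not> int p dvd x \<and> (\<forall>y. Psi (y - L x) = (Psi y - q) mod 12)"

lemma has_classI: "[E a = x] (mod int p) \<Longrightarrow> 3 ^ G dvd a \<Longrightarrow> has_class x (Psi a)"
proof -
  assume a: "[E a = x] (mod int p)" "3 ^ G dvd a"
  have "\<not> int p dvd x"
    using cong_unit[OF a(1)] E_unit by blast
  moreover have "Psi (y - L x) = Psi (y - a)" for y
    using Psi_cong cong_diff[OF cong_refl L_eqI[OF a(1)]] by blast
  ultimately show ?thesis
    unfolding has_class_def using Psi_diff[OF a(2)] by simp
qed

lemma has_class_mod: "has_class x q \<Longrightarrow> [q = q'] (mod 12) \<Longrightarrow> has_class x q'"
  using cong_diff[OF cong_refl] unfolding has_class_def cong_def by auto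

lemma has_class_cong: "has_class x q \<Longrightarrow> [x = x'] (mod int p) \<Longrightarrow> has_class x' q"
  unfolding has_class_def
  by (metis L_cong Psi_cong cong_diff cong_refl cong_sym cong_unit)

lemma has_class_mult:
  assumes "has_class x q" "has_class x' q'" shows "has_class (x * x') (q + q')"
proof -
  have "[L (x * x') = L x + L x'] (mod n)"
    using L_mult assms unfolding has_class_def by blast
  then have "Psi (y - L (x * x')) = Psi ((y - L x) - L x')" for y
    using Psi_cong cong_diff[OF cong_refl] by (metis diff_diff_eq)
  moreover have "Psi ((y - L x) - L x') = (Psi y - (q + q')) mod 12" for y
  proof -
    have "Psi ((y - L x) - L x') = (Psi (y - L x) - q') mod 12"
      using assms(2) unfolding has_class_def by blast
    also have "Psi (y - L x) = (Psi y - q) mod 12"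
      using assms(1) unfolding has_class_def by blast
    finally show ?thesis
      by (simp add: mod_diff_left_eq diff_diff_eq)
  qed
  moreover have "\<not> int p dvd x * x'"
    using assms unit_mult unfolding has_class_def by blast
  ultimately show ?thesis
    unfolding has_class_def by simp
qed

lemma has_class_1: "has_class 1 0"
proof -
  have "has_class 1 (Psi 0)"
    by (rule has_classI) (simp_all add: E_def)
  then show ?thesis by (simp add: Psi_def)
qed

text \<open>The two sides differ by an explicit multiple of \<open>z^4 - z^2 + 1\<close>, found by
  polynomial division; likewise in the next three lemmas.\<close>

lemma ev_mul_zeta: "[ev (mul_zeta v) = z * ev v] (mod int p)"
proof -
  obtain a b c d where v: "v = (a, b, c, d)" by (cases v)
  have "ev (mul_zeta v) - z * ev v = - d * (z ^ 4 - z\<^sup>2 + 1)"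
    by (simp add: ev_def v algebra_simps power2_eq_square power3_eq_cube power4_eq_xxxx)
  then show ?thesis
    using zeta by (simp add: cong_iff_dvd_diff)
qed

lemma ev_mul_one_i: "[ev (mul_one_i v) = (1 + z ^ 3) * ev v] (mod int p)"
proof -
  obtain a b c d where v: "v = (a, b, c, d)" by (cases v)
  have "ev (mul_one_i v) - (1 + z ^ 3) * ev v = (- b - d - c * z - d * z\<^sup>2) * (z ^ 4 - z\<^sup>2 + 1)"
    by (simp add: ev_def v algebra_simps power2_eq_square power3_eq_cube power4_eq_xxxx)
  then show ?thesis
    using zeta by (simp add: cong_iff_dvd_diff)
qed

lemma ev_mul_sqrt3: "[ev (mul_sqrt3 v) = (2 * z - z ^ 3) * ev v] (mod int p)"
proof -
  obtain a b c d where v: "v = (a, b, c, d)" by (cases v)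
  have "ev (mul_sqrt3 v) - (2 * z - z ^ 3) * ev v = (b - d + c * z + d * z\<^sup>2) * (z ^ 4 - z\<^sup>2 + 1)"
    by (simp add: ev_def v algebra_simps power2_eq_square power3_eq_cube power4_eq_xxxx)
  then show ?thesis
    using zeta by (simp add: cong_iff_dvd_diff)
qed

lemma ev_mul_fund: "[ev (mul_fund v) = (1 + z - z\<^sup>2 - z ^ 3) * ev v] (mod int p)"
proof -
  obtain a b c d where v: "v = (a, b, c, d)" by (cases v)
  have "ev (mul_fund v) - (1 + z - z\<^sup>2 - z ^ 3) * ev v = (b + c + (c + d) * z + d * z\<^sup>2) * (z ^ 4 - z\<^sup>2 + 1)"
    by (simp add: ev_def v algebra_simps power2_eq_square power3_eq_cube power4_eq_xxxx)
  then show ?thesis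
    using zeta by (simp add: cong_iff_dvd_diff)
qed

lemma ev_diff: "ev (cyc_diff v v') = ev v - ev v'"
  by (cases v; cases v') (simp add: ev_def algebra_simps)

lemma has_class_funpow:
  assumes "\<And>v. [ev (f v) = x * ev v] (mod int p)" "has_class x q" "has_class (ev v) r"
  shows "has_class (ev ((f ^^ i) v)) (int i * q + r)"
proof (induction i)
  case (Suc i)
  have "has_class (x * ev ((f ^^ i) v)) (q + (int i * q + r))"
    using has_class_mult assms(2) Suc by blast
  then have "has_class (ev (f ((f ^^ i) v))) (q + (int i * q + r))"
    using has_class_cong cong_sym assms(1) by blast
  then show ?case by (simp add: algebra_simps)
qed (use assms in simp)

lemma has_class_unit:
  assumes W: "has_class z wz" "has_class (1 + z ^ 3) wo" "has_class (2 * z - z ^ 3) ws"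
    "has_class (1 + z - z\<^sup>2 - z ^ 3) we"
  shows "has_class (ev (cyc_unit f)) (unit_class (wz, wo, ws, we) f)"
proof -
  obtain k a b c where f: "f = (k, a, b, c)" by (cases f)
  have "has_class (ev (1, 0, 0, 0)) 0"
    using has_class_1 by (simp add: ev_def)
  then have "has_class (ev (cyc_unit f)) (int k * wz + (int a * wo + (int b * ws + (int c * we + 0))))"
    unfolding f cyc_unit.simps
    by (intro has_class_funpow[OF ev_mul_zeta W(1)] has_class_funpow[OF ev_mul_one_i W(2)]
        has_class_funpow[OF ev_mul_sqrt3 W(3)] has_class_funpow[OF ev_mul_fund W(4)])
  then show ?thesis by (simp add: f add.assoc)
qed

text \<open>The logarithm of -1 is \<open>n / 2 = 6 t\<close>. As \<open>t\<close> is odd this is 2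
  modulo 4, and its digit is 0 modulo 3, so the class is 6 for either value of
  \<open>u\<close>.\<close>

lemma has_class_minus_1: "has_class (- 1) 6"
proof -
  have m1: "\<not> int p dvd - 1"
    using p_gt by simp
  have "t \<noteq> 0" using t p_gt by (cases t) auto
  have "[E (6 * int t) * E (6 * int t) = E 0] (mod int p)"
    using cong_sym[OF E_add[of "6 * int t" "6 * int t"]] E_cong_iff[of "12 * int t" 0] n_eq
    by (metis (no_types, lifting) cong_0_iff cong_trans dvd_refl mult_2 mult.assoc numeral_Bit0_eq_double)
  then have "int p dvd (E (6 * int t) - 1) * (E (6 * int t) + 1)"
    by (simp add: cong_iff_dvd_diff E_def algebra_simps)
  moreover have "\<not> int p dvd E (6 * int t) - 1"
  proof
    assume "int p dvd E (6 * int t) - 1"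
    then have "[E (6 * int t) = E 0] (mod int p)"
      by (simp add: cong_iff_dvd_diff E_def)
    then have "12 * int t dvd 6 * int t"
      unfolding E_cong_iff n_eq by (simp add: cong_0_iff)
    then show False
      using zdvd_imp_le[of "12 * int t" "6 * int t"] \<open>t \<noteq> 0\<close> by simp
  qed
  ultimately have "int p dvd E (6 * int t) + 1"
    using prime_dvd_mult_iff[OF prime_int] by blast
  then have "has_class (- 1) (Psi (6 * int t))"
    using G by (intro has_classI) (auto simp: cong_iff_dvd_diff intro: dvd_mult)
  moreover obtain t' where t': "int t = 3 ^ G * t'"
    using G by (metis dvdE of_nat_mult of_nat_numeral of_nat_power)
  then have "6 * int t div 3 ^ G = 6 * t'"
    by (simp add: mult.left_commute)
  then have "Psi (6 * int t) = u * (54 * int t + 24 * t') mod 12"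
    by (simp add: Psi_def)
  moreover have "[u * (54 * int t + 24 * t') mod 12 = 6] (mod 12)"
  proof -
    obtain r where r: "t = 2 * r + 1"
      using t(2) by (elim oddE)
    have "54 * int t + 24 * t' = 6 + 12 * (4 + 9 * int r + 2 * t')"
      by (simp add: r)
    then have "u * (54 * int t + 24 * t') = 6 * u + 12 * (u * (4 + 9 * int r + 2 * t'))"
      by (simp add: algebra_simps)
    then have "[u * (54 * int t + 24 * t') = 6 * u] (mod 12)"
      by (simp add: cong_def)
    moreover have "[6 * u = 6] (mod 12)"
      using u by (auto simp: cong_def)
    ultimately show ?thesis
      using cong_trans by (simp add: cong_def)
  qed
  ultimately show ?thesis
    using has_class_mod by metis
qed

text \<open>On multiples of \<open>3 ^ G\<close> the map \<open>Psi\<close> is linear with slope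
  \<open>u (9 3^G + 4)\<close>, which is prime to 12. Such elements realise the shifts of the
  tetrads.\<close>

lemma ex_class: "\<exists>x. has_class x q"
proof -
  define M where "M = u * (9 * 3 ^ G + 4)"
  have "odd M" "\<not> 3 dvd M"
  proof -
    show "odd M" using u by (auto simp: M_def)
    have "M = u + 3 * (u * (3 * 3 ^ G + 1))"
      by (simp add: M_def algebra_simps)
    then show "\<not> 3 dvd M"
      using u by presburger
  qed
  then have "coprime M 12"
  proof -
    have c: "coprime M 2" "coprime M 3"
      using \<open>odd M\<close> \<open>\<not> 3 dvd M\<close> by (auto simp: coprime_commute[of M] intro!: prime_imp_coprime)
    have "coprime M (2 * (2 * 3))"
      by (simp only: coprime_mult_right_iff c)
    then show ?thesis by simp
  qed
  then obtain w where "[M * w = 1] (mod 12)"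
    using cong_solve_coprime_int by blast
  then have w: "[M * (w * q) = q] (mod 12)"
    using cong_scalar_right[of "M * w" 1 12 q] by (simp add: mult.assoc)
  have "has_class (E (3 ^ G * (w * q))) (Psi (3 ^ G * (w * q)))"
    by (rule has_classI) auto
  moreover have "[Psi (3 ^ G * (w * q)) = M * (w * q)] (mod 12)"
    by (simp add: Psi_def M_def cong_def algebra_simps)
  ultimately show ?thesis
    using w cong_trans has_class_mod by blast
qed

lemma periodic_Psi: "periodic (\<lambda>y. Psi y = 0)"
  unfolding periodic_def using Psi_cong by metis

text \<open>\<open>Psi (y - L (\<delta> e))\<close> vanishes exactly when \<open>Psi y\<close> is
  the class of \<open>\<delta> e\<close>, so a system in which each class modulo 12 occurs once is
  hit once by every \<open>y\<close>.\<close>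

lemma tile_Psi:
  assumes "\<And>e. e \<in> S \<Longrightarrow> has_class (\<delta> e) (q e)" "\<And>e. e \<in> S \<Longrightarrow> 0 \<le> q e \<and> q e < 12"
    "inj_on q S" "\<And>c. 0 \<le> c \<Longrightarrow> c < 12 \<Longrightarrow> c \<in> q ` S"
  shows "tile S \<delta> (\<lambda>y. Psi y = 0)"
proof -
  have Psi_range: "0 \<le> Psi y \<and> Psi y < 12" for y
    by (simp add: Psi_def)
  have iff: "Psi (y - L (\<delta> e)) = 0 \<longleftrightarrow> Psi y = q e" if "e \<in> S" for y e
  proof -
    have "Psi (y - L (\<delta> e)) = (Psi y - q e) mod 12"
      using assms(1)[OF that] unfolding has_class_def by blast
    then show ?thesis
      using assms(2)[OF that] Psi_range[of y] mod_eq_0_iff_dvd[of "Psi y - q e" 12] by presburger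
  qed
  show ?thesis
    unfolding tile_def
  proof (intro conjI ballI allI impI)
    show "\<not> int p dvd \<delta> e" if "e \<in> S" for e
      using assms(1)[OF that] unfolding has_class_def by blast
    show "\<exists>e\<in>S. Psi (y - L (\<delta> e)) = 0" for y
      using assms(4)[of "Psi y"] Psi_range[of y] iff by auto
    show "e = e'" if "e \<in> S" "e' \<in> S" "Psi (y - L (\<delta> e)) = 0" "Psi (y - L (\<delta> e')) = 0" for y e e'
      using that iff assms(3) by (metis inj_onD)
  qed
qed

lemma distinct_cover:
  fixes xs :: "int list"
  assumes "distinct xs" "length xs = N" "\<And>x. x \<in> set xs \<Longrightarrow> 0 \<le> x \<and> x < int N"
  shows "set xs = {0..<int N}"
proof (rule card_subset_eq)
  show "card (set xs) = card {0..<int N}"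
    using assms distinct_card by fastforce
qed (use assms in auto)

text \<open>Template \<open>s\<close> is the tetrad of the \<open>s\<close>-th configuration
  multiplied by a number of class \<open>sh s\<close>, which shifts the classes of its points and of
  its differences alike.\<close>

lemma crc_base_sol:
  assumes W: "has_class z wz" "has_class (1 + z ^ 3) wo" "has_class (2 * z - z ^ 3) ws"
    "has_class (1 + z - z\<^sup>2 - z ^ 3) we"
    and ok: "sol_ok (wz, wo, ws, we) bs" and configs: "\<And>b. b \<in> set bs \<Longrightarrow> config_ok (fst b)"
  shows "crc_base 4 p"
proof -
  let ?W = "(wz, wo, ws, we)"
  define ps ds sh lab where "ps s = fst (fst (bs ! s))" and "ds s = snd (fst (bs ! s))"
    and "sh s = fst (snd (bs ! s))" and "lab s = snd (snd (bs ! s))" for s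
  have bs: "bs ! s = ((ps s, ds s), sh s, lab s)" for s
    by (simp add: ps_def ds_def sh_def lab_def)
  have len: "length bs = 4"
    using ok by (simp add: sol_ok_def)
  have cfg: "config_ok (ps s, ds s)" if "s < 4" for s
  proof -
    have "config_ok (fst (bs ! s))"
      using configs len that by simp
    then show ?thesis
      by (simp only: bs fst_conv)
  qed
  have len_ps: "length (ps s) = 4" and len_ds: "length (ds s) = 6"
    and cfg_diff: "map cyc_unit (ds s) =
      [cyc_diff (cyc_unit (ps s ! 1)) (cyc_unit (ps s ! 0)), cyc_diff (cyc_unit (ps s ! 2)) (cyc_unit (ps s ! 0)),
       cyc_diff (cyc_unit (ps s ! 2)) (cyc_unit (ps s ! 1)), cyc_diff (cyc_unit (ps s ! 3)) (cyc_unit (ps s ! 0)),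
       cyc_diff (cyc_unit (ps s ! 3)) (cyc_unit (ps s ! 1)), cyc_diff (cyc_unit (ps s ! 3)) (cyc_unit (ps s ! 2))]"
    if "s < 4" for s
    using cfg[OF that] by (auto simp: config_ok_def Let_def)
  have "\<forall>s. \<exists>x. has_class x (sh s)"
    using ex_class by blast
  then obtain X where X: "\<And>s. has_class (X s) (sh s)" by metis
  define T where "T s i = X s * ev (cyc_unit (ps s ! i))" for s i
  define Y where "Y s i = lab s ! i" for s i
  define pc where "pc s i = (unit_class ?W (ps s ! i) + sh s) mod 12" for s i
  define dc where "dc s i j = (if j < i then (unit_class ?W (ds s ! tri i j) + sh s) mod 12
    else ((unit_class ?W (ds s ! tri j i) + sh s) mod 12 + 6) mod 12)" for s i j
  have T_class: "has_class (T s i) (pc s i)" for s i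
    using has_class_mult[OF X has_class_unit[OF W]] unfolding T_def pc_def
    by (rule has_class_mod) (simp add: cong_def add.commute)
  have diff_pos: "T s i - T s j = X s * ev (cyc_unit (ds s ! tri i j))" if "s < 4" "j < i" "i < 4" for s i j
  proof -
    have "map cyc_unit (ds s) ! tri i j = cyc_diff (cyc_unit (ps s ! i)) (cyc_unit (ps s ! j))"
      unfolding cfg_diff[OF that(1)] using that(2,3)
      by (auto simp: tri_def less_Suc_eq numeral_eq_Suc)
    then have "cyc_unit (ds s ! tri i j) = cyc_diff (cyc_unit (ps s ! i)) (cyc_unit (ps s ! j))"
      using len_ds[OF that(1)] tri_less[OF that(2,3)] by simp
    then show ?thesis
      by (simp add: T_def ev_diff right_diff_distrib)
  qed
  have D_pos: "has_class (T s i - T s j) (unit_class ?W (ds s ! tri i j) + sh s)" if "s < 4" "j < i" "i < 4" for s i j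
    unfolding diff_pos[OF that] using has_class_mult[OF X has_class_unit[OF W]] by (simp add: add.commute)
  have D_class: "has_class (T s i - T s j) (dc s i j)" if "s < 4" "i < 4" "j < 4" "i \<noteq> j" for s i j
  proof (cases "j < i")
    case True
    show ?thesis
      using D_pos[OF that(1) True that(2)] unfolding dc_def
      by (rule has_class_mod) (simp add: True cong_def)
  next
    case False
    then have "i < j" using that by simp
    have "has_class (- 1 * (T s j - T s i)) (6 + (unit_class ?W (ds s ! tri j i) + sh s))"
      using has_class_mult[OF has_class_minus_1 D_pos[OF that(1) \<open>i < j\<close> that(3)]] .
    then have "has_class (T s i - T s j) (6 + (unit_class ?W (ds s ! tri j i) + sh s))"
      by simp
    then show ?thesis
      unfolding dc_def by (rule has_class_mod) (use False in \<open>simp add: cong_def mod_simps add.commute\<close>)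
  qed
  have dc_range: "0 \<le> dc s i j \<and> dc s i j < 12" for s i j
    by (simp add: dc_def)
  have code: "diff_code (map (diff_classes ?W) bs) (s, i, j) = (Y s i - Y s j) mod 4 * 12 + dc s i j"
    if "s < 4" "i < 4" "j < 4" "i \<noteq> j" for s i j
  proof -
    have "map (diff_classes ?W) bs ! s = (map (\<lambda>f. (unit_class ?W f + sh s) mod 12) (ds s), lab s)"
      using that len by (simp add: bs diff_classes_def)
    moreover have "j < i \<or> i < j" using that by auto
    ultimately show ?thesis
      using tri_less[of j i] tri_less[of i j] that len_ds[OF that(1)]
      unfolding diff_code_def dc_def Y_def by auto
  qed
  have inj_code: "inj_on (diff_code (map (diff_classes ?W) bs)) (set triples)"
    using ok by (simp add: sol_ok_def distinct_map)
  \<comment> \<open>48 distinct codes below 48 are all of them, so for each label difference every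
    class modulo 12 occurs.\<close>
  have range_code: "set (map (diff_code (map (diff_classes ?W) bs)) triples) = {0..<int 48}"
  proof (rule distinct_cover)
    show "distinct (map (diff_code (map (diff_classes ?W) bs)) triples)"
      using ok by (simp add: sol_ok_def)
    fix x assume "x \<in> set (map (diff_code (map (diff_classes ?W) bs)) triples)"
    then obtain s i j where sij: "s < 4" "i < 4" "j < 4" "i \<noteq> j" "x = (Y s i - Y s j) mod 4 * 12 + dc s i j"
      using code by (auto simp: set_triples)
    have "0 \<le> (Y s i - Y s j) mod 4" "(Y s i - Y s j) mod 4 \<le> 3"
      by simp_all
    then show "0 \<le> x \<and> x < int 48"
      using dc_range[of s i j] sij(5) by simp
  qed (simp add: length_triples)
  have tile_diff: "tile {(s, i, j). s < 4 \<and> i < 4 \<and> j < 4 \<and> i \<noteq> j \<and> [Y s i - Y s j = e] (mod int 4)}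
      (\<lambda>(s, i, j). T s i - T s j) (\<lambda>y. Psi y = 0)" (is "tile ?S _ _") for e
  proof (rule tile_Psi[where q = "\<lambda>(s, i, j). dc s i j"])
    show "has_class (case a of (s, i, j) \<Rightarrow> T s i - T s j) (case a of (s, i, j) \<Rightarrow> dc s i j)" if "a \<in> ?S" for a
      using that D_class by auto
    show "0 \<le> (case a of (s, i, j) \<Rightarrow> dc s i j) \<and> (case a of (s, i, j) \<Rightarrow> dc s i j) < 12" for a
      using dc_range by (auto split: prod.split)
    show "inj_on (\<lambda>(s, i, j). dc s i j) ?S"
    proof (rule inj_onI)
      fix a b assume ab: "a \<in> ?S" "b \<in> ?S" "(case a of (s, i, j) \<Rightarrow> dc s i j) = (case b of (s, i, j) \<Rightarrow> dc s i j)"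
      obtain s i j s' i' j' where eq: "a = (s, i, j)" "b = (s', i', j')" by (cases a; cases b) auto
      have "(Y s i - Y s j) mod 4 = (Y s' i' - Y s' j') mod 4"
        using ab eq by (auto simp: cong_def)
      then have "diff_code (map (diff_classes ?W) bs) a = diff_code (map (diff_classes ?W) bs) b"
        using ab code eq by auto
      moreover have "a \<in> set triples" "b \<in> set triples"
        using ab(1,2) unfolding set_triples by auto
      ultimately show "a = b"
        by (rule inj_onD[OF inj_code])
    qed
    fix c :: int assume c: "0 \<le> c" "c < 12"
    have "0 \<le> e mod 4" "e mod 4 \<le> 3" by simp_all
    then have "e mod 4 * 12 + c \<in> {0..<int 48}"
      using c by simp
    then have "e mod 4 * 12 + c \<in> set (map (diff_code (map (diff_classes ?W) bs)) triples)"
      unfolding range_code .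
    then obtain s i j where sij: "s < 4" "i < 4" "j < 4" "i \<noteq> j"
      "e mod 4 * 12 + c = (Y s i - Y s j) mod 4 * 12 + dc s i j"
      using code by (auto simp: set_triples)
    then have "e mod 4 = (Y s i - Y s j) mod 4 \<and> c = dc s i j"
      using c dc_range[of s i j] by (smt (verit))
    then have "(s, i, j) \<in> ?S" "c = (case (s, i, j) of (s, i, j) \<Rightarrow> dc s i j)"
      using sij by (auto simp: cong_def)
    then show "c \<in> (\<lambda>(s, i, j). dc s i j) ` ?S"
      by (rule rev_image_eqI)
  qed
  have upt: "[0..<3] = [0, 1, 2]" "[0..<4] = [0, 1, 2, 3]"
    by (simp_all add: upt_rec)
  have pts: "concat (map (point_classes ?W) (take 3 bs)) = map (\<lambda>(s, i). pc s i) (List.product [0..<3] [0..<4])"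
  proof -
    obtain b0 b1 b2 b3 where "bs = [b0, b1, b2, b3]"
      using len by (auto simp: numeral_eq_Suc length_Suc_conv)
    then have "take 3 bs = [bs ! 0, bs ! 1, bs ! 2]"
      by simp
    moreover have "point_classes ?W (bs ! s) = [pc s 0, pc s 1, pc s 2, pc s 3]" if "s < 4" for s
    proof -
      obtain p0 p1 p2 p3 where "ps s = [p0, p1, p2, p3]"
        using len_ps[OF \<open>s < 4\<close>] by (auto simp: numeral_eq_Suc length_Suc_conv)
      then show ?thesis
        by (simp add: bs point_classes_def pc_def)
    qed
    ultimately show ?thesis
      unfolding upt by simp
  qed
  have prod: "set (List.product [0..<3] [0..<4]) = {..<3} \<times> {..<4}"
    by (simp add: lessThan_atLeast0)
  have dist: "distinct (map (\<lambda>(s, i). pc s i) (List.product [0..<3] [0..<4]))"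
    using ok unfolding sol_ok_def pts by blast
  have tile_res: "tile ({..<3} \<times> {..<4}) (\<lambda>(s, i). T s i) (\<lambda>y. Psi y = 0)"
  proof (rule tile_Psi[where q = "\<lambda>(s, i). pc s i"])
    show "has_class (case e of (s, i) \<Rightarrow> T s i) (case e of (s, i) \<Rightarrow> pc s i)" for e
      using T_class by (auto split: prod.split)
    show "0 \<le> (case e of (s, i) \<Rightarrow> pc s i) \<and> (case e of (s, i) \<Rightarrow> pc s i) < 12" for e
      by (auto simp: pc_def split: prod.split)
    show "inj_on (\<lambda>(s, i). pc s i) ({..<3} \<times> {..<4})"
      using dist unfolding distinct_map prod by blast
    have "set (map (\<lambda>(s, i). pc s i) (List.product [0..<3] [0..<4])) = {0..<int 12}"
      by (rule distinct_cover[OF dist]) (auto simp: pc_def)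
    then show "c \<in> (\<lambda>(s, i). pc s i) ` ({..<3} \<times> {..<4})" if "0 \<le> c" "c < 12" for c
      unfolding set_map prod using that by auto
  qed
  have lab3: "\<exists>i<4. [Y 3 i = c] (mod int 4)" for c
  proof -
    have "c mod 4 \<in> {0, 1, 2, 3}"
      by auto
    moreover have "\<forall>c\<in>{0, 1, 2, 3}. c \<in> set (map (\<lambda>x. x mod 4) (lab 3))"
      using ok unfolding sol_ok_def lab_def by (elim conjE)
    ultimately have "c mod 4 \<in> set (map (\<lambda>x. x mod 4) (lab 3))"
      by (rule bspec[rotated])
    moreover have "length (lab 3) = 4"
      using ok len unfolding sol_ok_def by (auto simp: lab_def)
    ultimately show ?thesis
      by (auto simp: Y_def in_set_conv_nth cong_def)
  qed
  \<comment> \<open>Four labels that meet all four residues modulo 4 meet each of them once.\<close>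
  have lab3_inj: "i = i'" if "i < 4" "i' < 4" "[Y 3 i = Y 3 i'] (mod int 4)" for i i'
  proof -
    have "{0..<4} \<subseteq> (\<lambda>i. Y 3 i mod 4) ` {..<4 :: nat}"
    proof
      fix c :: int assume "c \<in> {0..<4}"
      then have "c mod 4 = c" by simp
      then show "c \<in> (\<lambda>i. Y 3 i mod 4) ` {..<4 :: nat}"
        using lab3[of c] by (auto simp: cong_def)
    qed
    then have "card {0..<4 :: int} \<le> card ((\<lambda>i. Y 3 i mod 4) ` {..<4 :: nat})"
      by (rule card_mono[rotated]) simp
    then have "inj_on (\<lambda>i. Y 3 i mod 4) {..<4 :: nat}"
      by (intro eq_card_imp_inj_on) (use card_image_le[of "{..<4 :: nat}" "\<lambda>i. Y 3 i mod 4"] in auto)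
    then show ?thesis
      using that by (auto simp: cong_def inj_on_def)
  qed
  have "coprime (2 * 2) p"
    using t by (simp only: coprime_mult_left_iff coprime_left_2_iff_odd) simp
  then have "coprime 4 p" by simp
  show ?thesis
  proof (rule crc_base_scaled[where k = 4 and S = 4 and S' = 3 and T = T and lab = Y and A = "\<lambda>y. Psi y = 0"],
      goal_cases)
    case (5 e)
    then show ?case by (rule tile_diff)
  next
    case (7 s c)
    then have "s = 3" by simp
    then show ?case using lab3 by blast
  next
    case (8 s i i')
    then have "s = 3" by simp
    then show ?case using lab3_inj 8 by blast
  qed (use \<open>coprime 4 p\<close> periodic_Psi tile_res in auto)
qed

end

text \<open>The tables were found by computer search. A key consists of the classes of \<open>z\<close>, \<open>1 + i\<close>, \<open>\<surd>3\<close> and \<open>w\<close>; the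
  first 38 configurations do not involve \<open>w\<close>, and \<open>table1\<close> uses no others. Only one of two keys
  that differ by the factor 5, that is, by the sign of the 3-adic digits, is listed.\<close>

definition configs :: "config list" where
  "configs = [
   ([(0,1,0,0), (0,0,0,0), (9,1,0,0), (9,2,0,0)], [(9,0,0,0), (6,2,0,0), (9,0,0,0), (9,1,0,0), (0,0,0,0), (0,1,0,0)]),
   ([(0,2,0,0), (1,0,0,0), (7,4,0,0), (10,2,0,0)], [(10,0,1,0), (9,2,1,0), (1,0,2,0), (8,2,0,0), (1,0,0,0), (4,2,0,0)]),
   ([(0,2,1,0), (1,2,0,0), (3,0,1,0), (10,2,1,0)], [(5,2,0,0), (9,0,1,0), (0,0,0,0), (8,2,1,0), (6,4,0,0), (0,0,2,0)]),
   ([(0,0,4,0), (0,0,0,0), (0,0,2,0), (6,0,2,0)], [(9,6,0,0), (3,2,2,0), (9,2,0,0), (0,4,2,0), (0,4,0,0), (3,2,2,0)]),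
   ([(0,4,2,0), (0,4,0,0), (3,2,2,0), (6,0,2,0)], [(3,6,0,0), (9,2,2,0), (3,2,0,0), (0,0,4,0), (0,0,0,0), (0,0,2,0)]),
   ([(0,2,1,0), (1,2,0,0), (2,2,1,0), (4,0,2,0)], [(5,2,0,0), (4,2,1,0), (3,2,0,0), (7,0,1,0), (4,0,0,0), (1,0,1,0)]),
   ([(0,2,1,0), (2,0,2,0), (8,4,0,0), (10,2,1,0)], [(11,0,1,0), (9,2,0,0), (2,0,0,0), (8,2,1,0), (11,0,1,0), (7,2,0,0)]),
   ([(0,2,1,0), (1,0,1,0), (9,2,0,0), (10,2,1,0)], [(10,0,2,0), (4,4,0,0), (10,0,0,0), (8,2,1,0), (1,0,1,0), (11,2,0,0)]),
   ([(0,0,2,0), (0,0,0,0), (6,0,2,0), (9,0,1,0)], [(3,2,0,0), (3,2,2,0), (0,4,0,0), (4,2,1,0), (5,2,0,0), (8,2,1,0)]),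
   ([(0,0,0,0), (2,0,0,0), (4,0,0,0), (6,0,0,0)], [(4,0,0,0), (5,0,1,0), (6,0,0,0), (3,2,0,0), (7,0,1,0), (8,0,0,0)]),
   ([(0,2,1,0), (1,2,0,0), (3,0,1,0), (5,0,1,0)], [(5,2,0,0), (9,0,1,0), (0,0,0,0), (8,0,2,0), (8,0,0,0), (7,0,1,0)]),
   ([(0,0,2,0), (0,0,0,0), (6,0,0,0), (9,0,1,0)], [(3,2,0,0), (0,4,0,0), (3,2,0,0), (4,2,1,0), (5,2,0,0), (7,2,0,0)]),
   ([(0,0,2,0), (1,0,1,0), (8,2,1,0), (9,2,0,0)], [(5,0,1,0), (9,0,1,0), (10,0,2,0), (6,0,0,0), (10,0,0,0), (1,2,0,0)]),
   ([(0,0,1,0), (1,0,0,0), (9,0,0,0), (11,0,0,0)], [(5,0,0,0), (4,2,0,0), (8,0,1,0), (7,0,0,0), (9,0,0,0), (1,0,0,0)]),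
   ([(0,0,2,0), (0,0,0,0), (1,0,1,0), (9,0,1,0)], [(3,2,0,0), (5,0,1,0), (2,0,0,0), (4,2,1,0), (5,2,0,0), (8,0,2,0)]),
   ([(0,0,2,0), (0,0,0,0), (9,0,1,0), (11,0,1,0)], [(3,2,0,0), (4,2,1,0), (5,2,0,0), (7,0,1,0), (10,0,0,0), (1,0,1,0)]),
   ([(0,2,1,0), (1,2,0,0), (4,0,2,0), (10,4,0,0)], [(5,2,0,0), (7,0,1,0), (4,0,0,0), (3,2,0,0), (1,2,0,0), (4,0,0,0)]),
   ([(0,0,2,0), (0,0,0,0), (3,0,1,0), (6,0,0,0)], [(3,2,0,0), (2,2,1,0), (1,2,0,0), (0,4,0,0), (3,2,0,0), (5,2,0,0)]),
   ([(0,2,1,0), (1,0,1,0), (10,2,1,0), (11,2,0,0)], [(10,0,2,0), (8,2,1,0), (1,0,1,0), (7,2,0,0), (4,0,0,0), (3,2,0,0)]),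
   ([(0,2,1,0), (1,0,1,0), (2,0,2,0), (11,2,0,0)], [(10,0,2,0), (11,0,1,0), (3,0,1,0), (7,2,0,0), (4,0,0,0), (8,0,0,0)]),
   ([(0,2,2,0), (0,2,0,0), (3,0,2,0), (11,2,1,0)], [(3,4,0,0), (9,0,2,0), (3,0,0,0), (7,2,1,0), (10,2,0,0), (0,0,1,0)]),
   ([(0,0,1,0), (1,0,0,0), (8,2,0,0), (10,2,0,0)], [(5,0,0,0), (9,0,0,0), (10,0,1,0), (3,0,0,0), (1,0,0,0), (0,2,0,0)]),
   ([(0,2,1,0), (1,2,2,0), (4,0,2,0), (10,4,0,0)], [(2,2,1,0), (7,0,1,0), (10,0,2,0), (3,2,0,0), (7,2,0,0), (4,0,0,0)]),
   ([(0,4,2,0), (3,2,2,0), (6,0,4,0), (9,6,0,0)], [(9,2,2,0), (0,0,2,0), (6,0,2,0), (6,4,0,0), (3,2,0,0), (0,0,0,0)]),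
   ([(0,2,0,0), (1,0,0,0), (4,2,0,0), (7,4,0,0)], [(10,0,1,0), (5,2,1,0), (7,0,2,0), (9,2,1,0), (1,0,2,0), (10,2,2,0)]),
   ([(0,0,2,0), (0,0,0,0), (6,0,0,0), (6,0,2,0)], [(3,2,0,0), (0,4,0,0), (3,2,0,0), (3,2,2,0), (0,4,0,0), (3,2,0,0)]),
   ([(0,2,1,0), (1,0,1,0), (3,0,1,0), (11,2,0,0)], [(10,0,2,0), (9,0,1,0), (5,0,1,0), (7,2,0,0), (4,0,0,0), (0,0,0,0)]),
   ([(0,0,2,0), (0,0,0,0), (3,0,1,0), (9,0,1,0)], [(3,2,0,0), (2,2,1,0), (1,2,0,0), (4,2,1,0), (5,2,0,0), (6,2,1,0)]),
   ([(0,0,2,0), (0,0,0,0), (9,2,0,0), (11,0,1,0)], [(3,2,0,0), (6,0,0,0), (0,0,0,0), (7,0,1,0), (10,0,0,0), (8,0,0,0)]),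
   ([(0,0,1,0), (1,0,0,0), (3,0,0,0), (9,0,0,0)], [(5,0,0,0), (2,2,0,0), (5,0,0,0), (4,2,0,0), (8,0,1,0), (6,2,0,0)]),
   ([(0,2,2,0), (0,2,0,0), (1,2,1,0), (3,0,2,0)], [(3,4,0,0), (5,2,1,0), (2,2,0,0), (9,0,2,0), (3,0,0,0), (0,0,1,0)]),
   ([(0,0,2,0), (1,0,1,0), (9,2,0,0), (10,2,1,0)], [(5,0,1,0), (6,0,0,0), (10,0,0,0), (3,0,1,0), (1,0,1,0), (11,2,0,0)]),
   ([(0,2,0,0), (1,0,0,0), (2,0,1,0), (10,2,0,0)], [(10,0,1,0), (11,0,0,0), (3,0,0,0), (8,2,0,0), (1,0,0,0), (11,0,0,0)]),
   ([(0,0,2,0), (1,0,1,0), (9,2,0,0), (11,0,1,0)], [(5,0,1,0), (6,0,0,0), (10,0,0,0), (7,0,1,0), (9,0,1,0), (8,0,0,0)]),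
   ([(0,0,2,0), (0,0,0,0), (1,0,1,0), (9,2,0,0)], [(3,2,0,0), (5,0,1,0), (2,0,0,0), (6,0,0,0), (0,0,0,0), (10,0,0,0)]),
   ([(0,0,2,0), (0,0,0,0), (6,4,0,0), (9,2,0,0)], [(3,2,0,0), (0,0,0,0), (0,0,2,0), (6,0,0,0), (0,0,0,0), (3,2,0,0)]),
   ([(0,2,1,0), (1,0,1,0), (8,2,1,0), (9,2,0,0)], [(10,0,2,0), (7,2,2,0), (10,0,2,0), (4,4,0,0), (10,0,0,0), (1,2,0,0)]),
   ([(0,2,0,0), (1,0,0,0), (5,0,0,0), (9,0,0,0)], [(10,0,1,0), (8,0,1,0), (6,0,1,0), (9,0,2,0), (8,0,1,0), (10,0,1,0)]),
   ([(0,2,0,2), (0,0,0,0), (0,1,0,1), (6,1,0,1)], [(9,0,1,2), (6,1,1,1), (0,0,1,0), (9,1,0,3), (9,0,0,2), (3,3,0,1)]),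
   ([(0,2,0,2), (0,0,0,0), (1,1,0,1), (11,1,0,1)], [(9,0,1,2), (7,1,0,2), (3,0,0,1), (8,1,0,2), (0,0,0,1), (9,1,0,1)]),
   ([(0,3,0,1), (0,2,0,0), (3,2,1,2), (9,0,0,0)], [(6,2,1,0), (3,2,0,2), (9,5,0,1), (0,0,1,2), (9,0,2,0), (3,0,0,4)]),
   ([(0,2,0,2), (0,0,0,0), (0,1,0,1), (11,1,0,1)], [(9,0,1,2), (6,1,1,1), (0,0,1,0), (8,1,0,2), (0,0,0,1), (7,1,0,0)]),
   ([(0,1,0,2), (0,0,0,2), (2,0,0,2), (11,1,0,1)], [(9,0,0,2), (5,0,0,1), (4,0,0,2), (4,1,0,1), (3,0,1,1), (5,0,0,0)]),
   ([(0,2,0,2), (0,0,0,0), (3,3,0,1), (6,4,0,0)], [(9,0,1,2), (6,2,1,2), (9,0,1,2), (3,2,1,0), (0,0,2,0), (9,3,1,1)]),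
   ([(0,0,1,1), (1,0,0,2), (4,0,1,2), (11,0,0,1)], [(8,0,0,0), (5,0,1,2), (2,2,0,2), (7,0,0,1), (6,0,0,1), (0,0,0,3)]),
   ([(0,0,1,1), (1,0,0,1), (8,1,0,1), (10,1,0,1)], [(5,0,0,1), (9,0,0,2), (10,0,0,2), (6,0,0,0), (10,0,0,1), (0,1,0,1)]),
   ([(0,2,0,1), (0,1,0,1), (4,2,0,2), (5,0,0,2)], [(9,1,0,1), (5,2,0,2), (6,1,1,2), (5,0,0,0), (5,0,1,1), (2,0,1,2)]),
   ([(0,2,1,4), (0,0,1,2), (6,0,0,2), (9,2,0,2)], [(9,0,2,4), (0,0,0,6), (6,1,0,3), (0,5,0,3), (9,0,0,0), (0,0,2,2)]),
   ([(0,1,0,1), (0,0,0,1), (1,1,0,2), (2,0,0,1)], [(9,0,0,1), (11,1,0,1), (3,0,0,2), (5,0,0,0), (4,0,0,1), (8,0,0,2)]),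
   ([(0,2,1,2), (0,0,1,0), (0,1,0,1), (6,1,1,1)], [(9,0,2,2), (9,1,0,3), (0,0,0,0), (9,1,1,3), (9,0,1,2), (6,2,0,2)]),
   ([(0,2,0,3), (0,0,0,1), (7,2,0,1), (11,0,0,2)], [(9,0,1,3), (5,2,1,2), (9,0,1,1), (11,0,0,4), (10,0,0,2), (5,0,0,0)]),
   ([(0,1,1,1), (0,0,0,0), (7,1,0,0), (10,0,1,1)], [(9,0,0,2), (8,1,0,2), (9,0,0,1), (10,0,1,2), (11,0,0,2), (10,0,0,1)]),
   ([(0,1,0,1), (0,0,0,1), (10,1,0,0), (11,1,0,2)], [(9,0,0,1), (5,1,0,0), (3,0,0,0), (10,1,0,2), (0,0,0,2), (9,1,1,1)]),
   ([(0,2,0,2), (0,0,0,0), (3,3,0,1), (8,1,0,1)], [(9,0,1,2), (6,2,1,2), (9,0,1,2), (8,1,1,2), (9,0,1,1), (11,1,1,1)]),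
   ([(0,2,0,2), (0,0,0,0), (3,3,0,1), (4,1,0,1)], [(9,0,1,2), (6,2,1,2), (9,0,1,2), (7,1,1,2), (6,0,1,1), (1,1,1,1)]),
   ([(0,2,0,0), (1,0,0,0), (2,2,0,1), (6,0,0,2)], [(10,0,1,0), (1,2,0,0), (7,0,0,2), (3,0,1,0), (5,0,1,1), (0,0,0,0)]),
   ([(0,1,1,1), (0,0,1,1), (0,1,0,2), (11,1,1,1)], [(9,0,1,1), (7,2,0,1), (0,0,0,1), (7,1,1,0), (0,0,1,0), (1,1,0,0)]),
   ([(0,1,0,2), (0,0,0,1), (0,0,1,1), (1,0,0,1)], [(6,0,1,1), (6,0,0,1), (9,1,0,0), (7,0,0,2), (2,0,0,0), (5,0,0,1)]),
   ([(0,2,1,3), (0,0,1,1), (6,4,1,1), (9,3,0,2)], [(9,0,2,3), (3,2,2,1), (0,0,3,1), (6,2,0,3), (3,0,0,3), (0,3,0,0)]),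
   ([(0,2,0,2), (0,0,0,0), (0,1,0,1), (3,2,0,0)], [(9,0,1,2), (6,1,1,1), (0,0,1,0), (3,3,1,1), (6,0,2,0), (6,1,1,1)]),
   ([(0,2,0,2), (0,0,0,0), (0,1,1,1), (1,1,0,1)], [(9,0,1,2), (6,1,0,1), (3,0,0,2), (7,1,0,2), (3,0,0,1), (5,1,0,1)]),
   ([(0,2,1,1), (1,1,1,0), (2,2,0,0), (11,0,1,0)], [(7,1,1,1), (7,2,0,2), (7,1,0,1), (11,0,1,2), (11,0,1,1), (2,0,0,2)]),
   ([(0,2,1,1), (0,1,0,0), (9,2,0,0), (11,0,1,0)], [(9,1,0,2), (5,3,0,1), (9,1,0,0), (11,0,1,2), (11,0,0,1), (8,0,0,0)]),
   ([(0,1,1,2), (0,1,0,2), (1,0,1,2), (11,1,1,1)], [(3,2,0,1), (7,0,1,1), (10,0,0,1), (4,1,1,1), (1,1,0,0), (4,0,1,1)]),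
   ([(0,2,1,1), (0,1,0,0), (7,2,0,0), (11,0,1,0)], [(9,1,0,2), (8,2,0,2), (9,1,0,1), (11,0,1,2), (11,0,0,1), (2,0,0,0)]),
   ([(0,1,0,2), (0,0,0,1), (1,0,0,1), (10,1,0,1)], [(6,0,1,1), (7,0,0,2), (2,0,0,0), (5,1,0,1), (9,0,0,0), (10,0,0,1)]),
   ([(0,2,0,2), (0,0,0,0), (6,4,0,0), (7,2,0,0)], [(9,0,1,2), (3,2,1,0), (0,0,2,0), (5,2,1,1), (9,0,1,0), (4,2,1,0)]),
   ([(0,1,1,0), (1,2,0,0), (8,2,0,0), (10,0,1,0)], [(6,1,0,1), (9,1,0,1), (9,2,0,1), (10,0,1,1), (1,0,0,2), (7,0,0,0)]),
   ([(0,1,1,1), (0,0,0,0), (7,1,0,0), (11,0,1,0)], [(9,0,0,2), (8,1,0,2), (9,0,0,1), (8,0,1,1), (10,0,0,0), (2,0,0,1)]),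
   ([(0,1,0,2), (0,0,1,1), (9,1,1,1), (10,1,0,1)], [(6,0,0,1), (5,2,0,1), (9,0,1,1), (5,1,0,1), (6,0,0,0), (2,1,0,1)]),
   ([(0,3,0,3), (0,1,0,1), (0,2,0,2), (3,0,1,2)], [(9,1,1,3), (6,2,1,2), (0,1,1,1), (0,0,0,4), (3,0,0,2), (6,0,0,0)]),
   ([(0,1,0,2), (0,0,0,1), (10,1,0,1), (11,1,0,1)], [(6,0,1,1), (5,1,0,1), (9,0,0,0), (4,1,0,1), (0,0,0,0), (0,1,0,0)]),
   ([(0,2,1,3), (0,1,1,2), (3,0,1,3), (9,3,0,2)], [(6,1,2,2), (9,0,1,3), (0,0,1,1), (6,2,0,3), (9,1,0,0), (6,0,0,1)]),
   ([(0,2,0,2), (0,0,0,0), (6,4,0,0), (11,2,0,0)], [(9,0,1,2), (3,2,1,0), (0,0,2,0), (4,2,1,1), (3,0,1,0), (2,2,1,0)]),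
   ([(0,1,3,1), (0,0,2,0), (3,2,1,0), (6,4,0,0)], [(9,0,2,2), (9,1,1,3), (9,0,1,2), (9,1,0,3), (0,0,0,0), (0,2,0,2)]),
   ([(0,0,1,1), (0,0,0,0), (1,0,0,1), (11,1,0,1)], [(4,1,0,1), (5,0,0,1), (11,0,0,0), (3,0,0,0), (0,0,0,1), (10,0,0,0)])]"

definition table1 :: "((int \<times> int \<times> int) \<times> (nat \<times> int \<times> int list) list) list" where
  "table1 = [
   ((3,0,1), [(12,0,[0,2,0,0]), (22,4,[0,1,0,1]), (23,9,[0,3,3,2]), (30,10,[0,2,1,3])]),
   ((3,0,4), [(6,7,[0,1,0,1]), (2,0,[0,2,0,2]), (25,6,[0,1,1,0]), (15,4,[0,1,3,2])]),
   ((3,1,1), [(0,9,[0,1,1,0]), (1,3,[0,2,2,0]), (22,5,[0,3,0,3]), (6,9,[0,2,1,3])]),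
   ((3,1,4), [(0,3,[0,2,2,2]), (3,9,[0,3,2,3]), (3,10,[0,1,0,1]), (0,11,[0,1,3,2])]),
   ((3,1,5), [(5,2,[0,1,1,0]), (19,6,[0,2,0,0]), (20,4,[0,2,3,3]), (2,5,[0,1,2,3])]),
   ((3,3,1), [(12,10,[0,2,0,0]), (22,2,[0,3,0,3]), (23,1,[0,1,1,2]), (2,5,[0,1,2,3])]),
   ((3,3,4), [(7,4,[0,2,0,2]), (6,5,[0,3,0,3]), (25,4,[0,1,1,0]), (6,2,[0,1,2,3])]),
   ((3,4,1), [(0,9,[0,0,1,1]), (1,9,[0,2,2,0]), (22,5,[0,1,0,1]), (6,3,[0,2,1,3])]),
   ((3,4,4), [(3,0,[0,1,2,1]), (0,6,[0,0,2,0]), (3,7,[0,3,0,3]), (0,8,[0,2,1,3])]),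
   ((3,4,5), [(20,8,[0,0,1,1]), (5,0,[0,0,2,0]), (19,4,[0,3,2,3]), (30,6,[0,1,2,3])]),
   ((3,6,1), [(12,10,[0,2,0,0]), (22,2,[0,3,0,3]), (23,7,[0,1,1,2]), (2,11,[0,1,2,3])]),
   ((3,6,4), [(25,4,[0,1,1,0]), (6,11,[0,1,0,1]), (2,4,[0,2,0,2]), (6,8,[0,1,2,3])]),
   ((3,7,1), [(0,10,[0,2,2,0]), (0,2,[0,1,1,0]), (0,6,[0,1,1,0]), (4,6,[0,2,1,3])]),
   ((3,7,4), [(8,11,[0,1,2,1]), (4,10,[0,2,0,0]), (15,8,[0,1,1,0]), (2,6,[0,2,1,3])]),
   ((3,7,5), [(5,2,[0,1,1,0]), (19,6,[0,2,0,0]), (20,4,[0,2,3,3]), (2,5,[0,1,2,3])]),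
   ((3,9,1), [(12,10,[0,2,0,0]), (22,2,[0,3,0,3]), (23,1,[0,1,1,2]), (2,5,[0,1,2,3])]),
   ((3,9,4), [(6,1,[0,1,0,1]), (7,0,[0,2,0,2]), (25,6,[0,1,1,0]), (15,4,[0,1,3,2])]),
   ((3,10,1), [(0,4,[0,0,2,2]), (0,8,[0,0,1,1]), (0,0,[0,0,1,1]), (4,6,[0,2,1,3])]),
   ((3,10,4), [(4,3,[0,0,0,2]), (5,0,[0,3,3,0]), (20,5,[0,2,1,1]), (8,4,[0,1,3,2])]),
   ((3,10,5), [(5,2,[0,1,1,0]), (19,6,[0,2,0,0]), (20,10,[0,2,3,3]), (2,11,[0,1,2,3])]),
   ((7,0,0), [(26,8,[0,2,1,1]), (9,10,[0,2,0,0]), (21,11,[0,0,3,3]), (15,0,[0,2,1,3])]),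
   ((7,0,1), [(4,2,[0,0,2,0]), (13,2,[0,0,3,3]), (5,5,[0,3,0,1]), (9,0,[0,1,2,3])]),
   ((7,0,4), [(27,5,[0,2,0,0]), (17,3,[0,0,3,3]), (33,11,[0,1,3,0]), (3,8,[0,2,1,3])]),
   ((7,0,5), [(24,8,[0,1,1,0]), (24,10,[0,1,3,0]), (1,6,[0,0,0,2]), (4,2,[0,2,1,3])]),
   ((7,0,8), [(28,1,[0,2,0,0]), (17,3,[0,0,1,1]), (17,6,[0,2,1,1]), (35,8,[0,1,3,2])]),
   ((7,0,9), [(13,8,[0,1,1,0]), (12,4,[0,0,1,1]), (13,9,[0,0,2,2]), (8,6,[0,1,2,3])]),
   ((7,1,0), [(36,4,[0,1,0,3]), (29,10,[0,3,0,3]), (37,1,[0,0,2,0]), (8,0,[0,1,3,2])]),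
   ((7,1,1), [(1,10,[0,0,0,2]), (11,2,[0,1,0,3]), (11,7,[0,1,0,1]), (4,6,[0,1,2,3])]),
   ((7,1,4), [(0,3,[0,2,2,2]), (3,9,[0,3,2,3]), (3,10,[0,1,0,1]), (0,11,[0,1,3,2])]),
   ((7,1,5), [(1,1,[0,0,0,2]), (29,2,[0,3,3,0]), (11,4,[0,3,3,2]), (9,0,[0,1,2,3])]),
   ((7,1,8), [(10,6,[0,2,2,2]), (4,4,[0,1,0,1]), (28,5,[0,1,1,2]), (7,2,[0,2,1,3])]),
   ((7,1,9), [(9,0,[0,1,0,1]), (12,3,[0,0,1,1]), (13,8,[0,0,2,2]), (21,3,[0,1,2,3])]),
   ((7,2,0), [(0,0,[0,2,2,2]), (0,8,[0,3,3,0]), (2,7,[0,0,3,1]), (7,8,[0,1,3,2])]),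
   ((7,2,1), [(20,7,[0,1,0,1]), (30,3,[0,2,0,0]), (3,8,[0,0,3,1]), (7,7,[0,2,1,3])]),
   ((7,2,4), [(15,4,[0,0,2,0]), (10,7,[0,0,3,3]), (10,6,[0,3,0,1]), (2,4,[0,1,2,3])]),
   ((7,2,5), [(17,9,[0,1,0,1]), (23,2,[0,3,3,2]), (17,0,[0,2,2,2]), (3,4,[0,1,2,3])]),
   ((7,2,8), [(14,8,[0,2,1,1]), (3,5,[0,2,2,2]), (3,6,[0,0,1,1]), (0,10,[0,2,1,3])]),
   ((7,2,9), [(0,2,[0,0,2,0]), (21,3,[0,1,0,1]), (0,6,[0,0,3,1]), (8,6,[0,2,1,3])]),
   ((7,3,0), [(9,2,[0,0,2,0]), (32,5,[0,1,1,0]), (10,4,[0,1,1,2]), (6,6,[0,1,2,3])]),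
   ((7,3,1), [(4,2,[0,0,2,0]), (13,8,[0,0,3,3]), (5,11,[0,3,0,1]), (9,0,[0,1,2,3])]),
   ((7,3,4), [(34,8,[0,2,0,0]), (11,6,[0,0,1,1]), (11,3,[0,2,1,1]), (25,4,[0,1,3,2])]),
   ((7,3,5), [(24,2,[0,1,1,0]), (24,4,[0,1,3,0]), (1,0,[0,0,0,2]), (4,2,[0,2,1,3])]),
   ((7,3,8), [(27,9,[0,2,0,0]), (28,6,[0,3,0,3]), (27,0,[0,2,3,3]), (3,4,[0,2,1,3])]),
   ((7,3,9), [(13,2,[0,1,1,0]), (12,4,[0,0,1,1]), (13,9,[0,0,2,2]), (8,6,[0,1,2,3])]),
   ((7,4,0), [(9,1,[0,2,0,2]), (5,8,[0,1,1,0]), (26,1,[0,3,0,3]), (2,4,[0,1,3,2])]),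
   ((7,4,1), [(1,4,[0,0,0,2]), (11,2,[0,1,0,3]), (11,1,[0,1,0,1]), (4,6,[0,1,2,3])]),
   ((7,4,4), [(0,0,[0,0,2,0]), (3,1,[0,1,0,1]), (3,6,[0,3,2,3]), (0,8,[0,2,1,3])]),
   ((7,4,5), [(1,7,[0,0,0,2]), (29,2,[0,1,1,0]), (11,10,[0,1,1,2]), (9,0,[0,1,2,3])]),
   ((7,4,8), [(8,8,[0,2,0,0]), (15,10,[0,1,0,3]), (26,0,[0,3,3,0]), (7,8,[0,1,2,3])]),
   ((7,4,9), [(9,0,[0,1,0,1]), (12,9,[0,0,1,1]), (13,2,[0,0,2,2]), (21,3,[0,1,2,3])]),
   ((7,5,0), [(9,3,[0,2,0,2]), (10,3,[0,3,0,3]), (5,6,[0,0,3,3]), (7,2,[0,1,3,2])]),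
   ((7,5,1), [(20,7,[0,1,0,1]), (30,3,[0,2,0,0]), (3,8,[0,0,3,1]), (7,1,[0,2,1,3])]),
   ((7,5,4), [(21,0,[0,2,0,2]), (33,1,[0,3,3,0]), (9,11,[0,1,0,1]), (2,10,[0,2,1,3])]),
   ((7,5,5), [(0,3,[0,0,1,1]), (3,2,[0,2,2,2]), (8,9,[0,3,3,2]), (3,4,[0,1,2,3])]),
   ((7,5,8), [(0,9,[0,2,2,2]), (3,8,[0,3,0,3]), (3,3,[0,1,2,1]), (0,7,[0,1,3,2])]),
   ((7,5,9), [(0,3,[0,1,0,1]), (31,8,[0,0,0,2]), (16,0,[0,3,2,3]), (32,2,[0,2,1,3])]),
   ((7,6,0), [(9,2,[0,2,0,0]), (26,0,[0,2,3,3]), (21,3,[0,0,1,1]), (6,0,[0,2,1,3])]),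
   ((7,6,1), [(4,2,[0,0,2,0]), (13,2,[0,0,3,3]), (5,5,[0,3,0,1]), (9,0,[0,1,2,3])]),
   ((7,6,4), [(27,5,[0,2,0,0]), (17,3,[0,0,3,3]), (33,11,[0,1,3,0]), (3,8,[0,2,1,3])]),
   ((7,6,5), [(24,8,[0,1,1,0]), (24,10,[0,1,3,0]), (1,6,[0,0,0,2]), (4,2,[0,2,1,3])]),
   ((7,6,8), [(28,10,[0,2,0,0]), (17,3,[0,2,1,1]), (17,0,[0,0,1,1]), (25,8,[0,1,3,2])]),
   ((7,6,9), [(13,8,[0,1,1,0]), (12,4,[0,0,1,1]), (13,9,[0,0,2,2]), (8,6,[0,1,2,3])]),
   ((7,7,0), [(0,10,[0,0,2,0]), (7,11,[0,2,3,3]), (0,2,[0,0,1,1]), (2,10,[0,1,3,2])]),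
   ((7,7,1), [(1,10,[0,0,0,2]), (11,2,[0,1,0,3]), (11,7,[0,1,0,1]), (4,6,[0,1,2,3])]),
   ((7,7,4), [(14,8,[0,0,1,3]), (3,9,[0,0,1,1]), (3,10,[0,2,2,2]), (0,5,[0,1,3,2])]),
   ((7,7,5), [(1,1,[0,0,0,2]), (29,2,[0,3,3,0]), (11,4,[0,3,3,2]), (9,0,[0,1,2,3])]),
   ((7,7,8), [(10,6,[0,2,2,2]), (4,4,[0,1,0,1]), (28,5,[0,1,1,2]), (7,2,[0,2,1,3])]),
   ((7,7,9), [(9,0,[0,1,0,1]), (12,3,[0,0,1,1]), (13,8,[0,0,2,2]), (21,3,[0,1,2,3])]),
   ((7,8,0), [(18,1,[0,0,0,2]), (18,5,[0,1,1,2]), (1,9,[0,1,1,0]), (8,0,[0,1,2,3])]),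
   ((7,8,1), [(20,7,[0,1,0,1]), (30,3,[0,2,0,0]), (3,8,[0,0,3,1]), (7,7,[0,2,1,3])]),
   ((7,8,4), [(15,4,[0,0,2,0]), (10,7,[0,0,3,3]), (10,6,[0,3,0,1]), (2,4,[0,1,2,3])]),
   ((7,8,5), [(0,3,[0,1,1,0]), (3,8,[0,2,2,2]), (8,9,[0,1,1,2]), (3,4,[0,1,2,3])]),
   ((7,8,8), [(0,6,[0,0,2,0]), (3,11,[0,3,0,3]), (3,0,[0,1,2,1]), (0,4,[0,2,1,3])]),
   ((7,8,9), [(0,2,[0,1,0,1]), (31,1,[0,0,0,2]), (16,5,[0,3,2,3]), (34,6,[0,1,2,3])]),
   ((7,9,0), [(10,6,[0,1,1,2]), (9,4,[0,0,2,0]), (32,7,[0,1,1,0]), (15,0,[0,1,3,2])]),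
   ((7,9,1), [(4,2,[0,0,2,0]), (13,8,[0,0,3,3]), (5,11,[0,3,0,1]), (9,0,[0,1,2,3])]),
   ((7,9,4), [(34,5,[0,2,0,0]), (11,3,[0,0,1,1]), (11,0,[0,2,1,1]), (35,4,[0,1,3,2])]),
   ((7,9,5), [(24,2,[0,1,1,0]), (24,4,[0,1,3,0]), (1,0,[0,0,0,2]), (4,2,[0,2,1,3])]),
   ((7,9,8), [(27,9,[0,2,0,0]), (28,6,[0,3,0,3]), (27,0,[0,2,3,3]), (3,4,[0,2,1,3])]),
   ((7,9,9), [(13,2,[0,1,1,0]), (12,4,[0,0,1,1]), (13,9,[0,0,2,2]), (8,6,[0,1,2,3])]),
   ((7,10,0), [(9,1,[0,2,0,2]), (5,8,[0,1,1,0]), (26,1,[0,3,0,3]), (2,4,[0,1,3,2])]),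
   ((7,10,1), [(1,4,[0,0,0,2]), (11,2,[0,1,0,3]), (11,1,[0,1,0,1]), (4,6,[0,1,2,3])]),
   ((7,10,4), [(0,6,[0,0,2,0]), (0,2,[0,1,0,1]), (0,10,[0,1,3,0]), (27,4,[0,1,2,3])]),
   ((7,10,5), [(1,7,[0,0,0,2]), (29,2,[0,1,1,0]), (11,10,[0,1,1,2]), (9,0,[0,1,2,3])]),
   ((7,10,8), [(0,2,[0,0,2,0]), (26,3,[0,3,3,0]), (29,2,[0,1,1,2]), (6,8,[0,1,2,3])]),
   ((7,10,9), [(9,0,[0,1,0,1]), (12,9,[0,0,1,1]), (13,2,[0,0,2,2]), (21,3,[0,1,2,3])]),
   ((7,11,0), [(10,9,[0,1,0,1]), (5,0,[0,0,1,1]), (9,9,[0,2,0,2]), (7,2,[0,1,3,2])]),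
   ((7,11,1), [(20,7,[0,1,0,1]), (30,3,[0,2,0,0]), (3,8,[0,0,3,1]), (7,1,[0,2,1,3])]),
   ((7,11,4), [(28,9,[0,2,0,0]), (0,2,[0,3,0,1]), (14,0,[0,0,3,3]), (2,10,[0,1,2,3])]),
   ((7,11,5), [(17,3,[0,1,0,1]), (23,2,[0,3,3,2]), (17,0,[0,2,2,2]), (3,4,[0,1,2,3])]),
   ((7,11,8), [(14,1,[0,0,2,0]), (14,3,[0,1,2,1]), (0,9,[0,1,0,1]), (4,0,[0,1,2,3])]),
   ((7,11,9), [(0,2,[0,2,2,2]), (21,3,[0,1,0,1]), (0,6,[0,1,1,2]), (8,6,[0,2,1,3])])]"

text \<open>All keys here have class 3 for \<open>z\<close>, so the ternary digit of
  \<open>z\<close> is 0. When \<open>z\<close> has class 7, or 11 by the symmetry, the first table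
  is complete.\<close>

definition table2 :: "((int \<times> int \<times> int \<times> int) \<times> (nat \<times> int \<times> int list) list) list" where
  "table2 = [
   ((3,0,0,1), [(43,0,[0,0,1,1]), (44,6,[0,0,1,3]), (43,3,[0,2,2,2]), (51,11,[0,1,2,3])]),
   ((3,0,0,4), [(44,0,[0,2,2,2]), (47,1,[0,3,0,1]), (41,6,[0,0,3,3]), (39,4,[0,1,2,3])]),
   ((3,0,0,7), [(44,7,[0,0,0,2]), (39,3,[0,0,1,3]), (39,6,[0,0,1,1]), (10,0,[0,1,2,3])]),
   ((3,0,0,10), [(44,6,[0,2,2,2]), (47,7,[0,1,0,3]), (41,0,[0,0,1,1]), (39,4,[0,1,2,3])]),
   ((3,0,9,1), [(49,2,[0,0,1,1]), (59,8,[0,1,0,1]), (49,3,[0,2,0,2]), (51,2,[0,1,2,3])]),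
   ((3,0,9,4), [(62,3,[0,0,1,1]), (62,11,[0,2,0,0]), (62,7,[0,3,3,2]), (40,8,[0,1,2,3])]),
   ((3,0,9,7), [(60,3,[0,0,2,0]), (59,9,[0,3,3,0]), (60,10,[0,1,1,2]), (43,10,[0,2,1,3])]),
   ((3,0,9,10), [(45,8,[0,0,2,0]), (45,6,[0,0,1,1]), (45,4,[0,0,1,3]), (40,2,[0,2,1,3])]),
   ((3,1,0,0), [(47,0,[0,0,0,2]), (5,11,[0,1,1,0]), (38,8,[0,0,3,1]), (43,10,[0,2,1,3])]),
   ((3,1,0,1), [(47,4,[0,1,1,0]), (45,1,[0,1,1,0]), (2,11,[0,0,2,2]), (2,10,[0,1,3,2])]),
   ((3,1,0,2), [(62,11,[0,0,1,1]), (6,3,[0,0,0,2]), (62,9,[0,1,3,0]), (2,10,[0,2,1,3])]),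
   ((3,1,0,3), [(6,5,[0,2,1,1]), (31,0,[0,1,0,1]), (64,5,[0,2,0,0]), (47,10,[0,1,2,3])]),
   ((3,1,0,4), [(46,8,[0,0,0,2]), (5,3,[0,0,1,1]), (10,7,[0,3,3,2]), (0,11,[0,2,1,3])]),
   ((3,1,0,5), [(5,8,[0,1,1,0]), (48,1,[0,0,2,0]), (5,9,[0,0,1,3]), (6,10,[0,1,2,3])]),
   ((3,1,0,6), [(5,2,[0,0,1,3]), (47,3,[0,0,0,2]), (38,11,[0,0,1,1]), (43,10,[0,2,1,3])]),
   ((3,1,0,7), [(41,1,[0,0,0,0]), (59,4,[0,3,2,1]), (19,8,[0,1,2,3]), (6,10,[0,1,2,3])]),
   ((3,1,0,8), [(46,0,[0,1,0,3]), (55,1,[0,0,0,2]), (61,4,[0,1,1,0]), (0,11,[0,1,3,2])]),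
   ((3,1,0,9), [(5,7,[0,1,1,0]), (2,8,[0,0,0,2]), (5,6,[0,3,1,0]), (64,1,[0,1,2,3])]),
   ((3,1,0,10), [(10,0,[0,1,0,1]), (1,5,[0,1,1,0]), (51,0,[0,0,2,2]), (2,10,[0,1,3,2])]),
   ((3,1,0,11), [(44,6,[0,0,1,3]), (44,10,[0,2,2,2]), (44,2,[0,0,3,3]), (66,0,[0,2,1,3])]),
   ((3,1,8,0), [(64,11,[0,1,0,1]), (50,6,[0,0,2,0]), (42,1,[0,0,3,1]), (62,2,[0,2,1,3])]),
   ((3,1,8,1), [(70,6,[0,0,0,2]), (40,0,[0,1,2,1]), (66,7,[0,0,3,3]), (0,11,[0,1,3,2])]),
   ((3,1,8,2), [(1,6,[0,1,1,0]), (46,9,[0,0,0,2]), (15,6,[0,0,3,1]), (4,4,[0,2,1,3])]),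
   ((3,1,8,3), [(41,5,[0,0,0,0]), (41,3,[0,1,2,3]), (63,5,[0,2,3,1]), (47,2,[0,1,2,3])]),
   ((3,1,8,4), [(44,5,[0,1,1,0]), (49,7,[0,2,2,2]), (56,10,[0,3,1,0]), (51,11,[0,1,3,2])]),
   ((3,1,8,5), [(74,10,[0,0,1,1]), (4,3,[0,0,3,1]), (40,7,[0,0,2,0]), (55,10,[0,1,3,2])]),
   ((3,1,8,6), [(63,6,[0,0,2,0]), (53,2,[0,1,0,1]), (56,10,[0,2,1,1]), (41,10,[0,1,2,3])]),
   ((3,1,8,7), [(72,10,[0,0,0,2]), (12,3,[0,1,0,1]), (15,11,[0,0,3,1]), (8,8,[0,2,1,3])]),
   ((3,1,8,8), [(53,1,[0,1,0,1]), (54,8,[0,2,2,2]), (57,7,[0,1,2,1]), (3,4,[0,1,2,3])]),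
   ((3,1,8,9), [(41,6,[0,0,0,0]), (49,7,[0,2,1,3]), (54,0,[0,3,1,2]), (4,4,[0,1,2,3])]),
   ((3,1,8,10), [(0,11,[0,0,1,1]), (45,8,[0,0,3,3]), (63,1,[0,2,0,2]), (41,2,[0,1,2,3])]),
   ((3,1,8,11), [(75,9,[0,0,0,2]), (75,10,[0,1,3,0]), (42,4,[0,3,3,0]), (40,10,[0,1,3,2])]),
   ((3,1,9,0), [(66,3,[0,1,1,0]), (50,10,[0,1,0,1]), (49,7,[0,2,2,0]), (40,9,[0,1,2,3])]),
   ((3,1,9,1), [(16,2,[0,0,1,1]), (39,6,[0,2,0,0]), (1,1,[0,1,2,1]), (14,6,[0,1,3,2])]),
   ((3,1,9,2), [(43,9,[0,0,2,2]), (53,2,[0,1,1,0]), (56,1,[0,0,3,3]), (65,7,[0,1,2,3])]),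
   ((3,1,9,3), [(61,3,[0,1,1,0]), (69,8,[0,2,2,2]), (57,7,[0,2,1,1]), (52,8,[0,2,1,3])]),
   ((3,1,9,4), [(45,11,[0,0,0,2]), (65,10,[0,0,1,1]), (65,4,[0,3,0,1]), (0,11,[0,2,1,3])]),
   ((3,1,9,5), [(1,11,[0,1,1,0]), (42,7,[0,2,2,2]), (16,10,[0,0,1,3]), (14,6,[0,1,3,2])]),
   ((3,1,9,6), [(60,10,[0,0,2,0]), (53,11,[0,0,1,1]), (42,3,[0,1,2,1]), (46,4,[0,1,2,3])]),
   ((3,1,9,7), [(16,2,[0,0,1,1]), (39,6,[0,2,0,0]), (1,1,[0,1,2,1]), (14,6,[0,1,3,2])]),
   ((3,1,9,8), [(42,10,[0,2,2,2]), (43,1,[0,1,1,0]), (58,7,[0,0,3,1]), (0,11,[0,2,1,3])]),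
   ((3,1,9,9), [(70,11,[0,2,2,2]), (46,4,[0,3,0,3]), (58,4,[0,0,3,1]), (52,2,[0,2,1,3])]),
   ((3,1,9,10), [(71,7,[0,0,2,0]), (65,1,[0,3,1,0]), (48,9,[0,0,1,1]), (49,5,[0,1,3,2])]),
   ((3,1,9,11), [(1,11,[0,1,1,0]), (42,7,[0,2,2,2]), (1,7,[0,1,3,0]), (14,6,[0,1,3,2])]),
   ((3,3,0,1), [(44,7,[0,0,0,2]), (39,3,[0,0,1,1]), (39,6,[0,0,3,1]), (0,9,[0,1,3,2])]),
   ((3,3,0,4), [(38,11,[0,2,2,2]), (38,7,[0,3,2,3]), (38,3,[0,0,3,3]), (40,11,[0,1,3,2])]),
   ((3,3,0,7), [(50,10,[0,0,2,0]), (39,3,[0,3,3,0]), (43,6,[0,3,1,0]), (58,9,[0,1,3,2])]),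
   ((3,3,0,10), [(38,11,[0,2,2,2]), (38,7,[0,1,0,1]), (38,3,[0,2,3,3]), (40,5,[0,1,3,2])]),
   ((3,3,9,1), [(42,7,[0,0,2,0]), (48,10,[0,1,1,0]), (1,7,[0,1,2,1]), (54,4,[0,2,1,3])]),
   ((3,3,9,4), [(40,2,[0,0,0,2]), (40,1,[0,0,3,3]), (38,11,[0,1,0,3]), (38,10,[0,2,1,3])]),
   ((3,3,9,7), [(40,0,[0,0,0,2]), (40,7,[0,1,0,1]), (52,10,[0,0,3,1]), (41,4,[0,2,1,3])]),
   ((3,3,9,10), [(48,4,[0,1,1,0]), (42,1,[0,0,2,0]), (1,7,[0,1,2,1]), (54,10,[0,2,1,3])]),
   ((3,4,0,0), [(2,9,[0,2,0,0]), (64,5,[0,1,0,1]), (12,4,[0,1,3,0]), (0,8,[0,2,1,3])]),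
   ((3,4,0,1), [(47,1,[0,0,2,2]), (40,4,[0,0,1,1]), (39,8,[0,0,3,3]), (52,7,[0,2,1,3])]),
   ((3,4,0,2), [(55,8,[0,0,2,0]), (10,6,[0,3,0,3]), (18,5,[0,2,3,3]), (2,4,[0,1,3,2])]),
   ((3,4,0,3), [(47,6,[0,0,0,2]), (5,5,[0,0,3,3]), (38,8,[0,0,3,1]), (43,10,[0,2,1,3])]),
   ((3,4,0,4), [(56,5,[0,1,1,0]), (42,6,[0,0,0,2]), (12,4,[0,1,3,0]), (0,8,[0,2,1,3])]),
   ((3,4,0,5), [(45,10,[0,0,0,0]), (1,9,[0,2,1,3]), (61,7,[0,1,3,2]), (7,4,[0,1,3,2])]),
   ((3,4,0,6), [(2,8,[0,0,0,2]), (18,6,[0,0,1,3]), (18,10,[0,0,1,1]), (46,10,[0,1,2,3])]),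
   ((3,4,0,7), [(6,8,[0,1,0,1]), (19,0,[0,3,0,3]), (48,0,[0,0,2,2]), (7,4,[0,1,3,2])]),
   ((3,4,0,8), [(1,9,[0,3,1,0]), (42,5,[0,0,0,2]), (22,8,[0,1,1,0]), (6,4,[0,2,1,3])]),
   ((3,4,0,9), [(5,8,[0,1,1,2]), (47,9,[0,0,0,2]), (38,11,[0,0,3,3]), (43,10,[0,2,1,3])]),
   ((3,4,0,10), [(5,10,[0,2,1,1]), (42,3,[0,2,0,0]), (7,5,[0,1,0,1]), (44,2,[0,1,2,3])]),
   ((3,4,0,11), [(55,5,[0,0,0,2]), (18,2,[0,0,3,3]), (31,0,[0,1,3,0]), (2,4,[0,2,1,3])]),
   ((3,4,8,0), [(69,11,[0,1,3,0]), (0,6,[0,3,3,0]), (57,8,[0,0,2,0]), (18,8,[0,2,1,3])]),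
   ((3,4,8,1), [(52,7,[0,2,2,2]), (38,4,[0,1,1,0]), (45,2,[0,2,3,3]), (49,6,[0,2,1,3])]),
   ((3,4,8,2), [(57,3,[0,0,1,1]), (4,6,[0,2,0,2]), (40,4,[0,1,1,0]), (2,8,[0,1,2,3])]),
   ((3,4,8,3), [(55,3,[0,2,1,1]), (67,2,[0,3,0,3]), (41,5,[0,0,0,2]), (44,1,[0,2,1,3])]),
   ((3,4,8,4), [(72,8,[0,0,0,2]), (19,4,[0,1,0,1]), (15,6,[0,1,1,2]), (10,8,[0,1,2,3])]),
   ((3,4,8,5), [(51,9,[0,2,2,2]), (25,7,[0,0,1,3]), (54,6,[0,3,3,0]), (4,4,[0,2,1,3])]),
   ((3,4,8,6), [(63,0,[0,0,2,0]), (50,11,[0,0,3,3]), (61,4,[0,1,0,3]), (4,4,[0,1,2,3])]),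
   ((3,4,8,7), [(49,11,[0,0,0,2]), (60,11,[0,0,3,3]), (53,4,[0,1,0,3]), (3,4,[0,1,2,3])]),
   ((3,4,8,8), [(42,6,[0,0,0,2]), (67,9,[0,3,0,1]), (23,10,[0,1,0,1]), (46,8,[0,2,1,3])]),
   ((3,4,8,9), [(57,5,[0,1,0,3]), (59,7,[0,0,1,1]), (49,3,[0,2,0,0]), (18,8,[0,2,1,3])]),
   ((3,4,8,10), [(45,11,[0,0,1,1]), (44,4,[0,0,0,2]), (53,2,[0,2,3,3]), (2,8,[0,1,2,3])]),
   ((3,4,8,11), [(66,7,[0,2,0,0]), (43,8,[0,3,0,3]), (8,11,[0,3,3,2]), (10,8,[0,1,2,3])]),
   ((3,4,9,0), [(50,6,[0,1,0,1]), (60,0,[0,2,2,0]), (16,11,[0,0,1,1]), (4,2,[0,2,1,3])]),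
   ((3,4,9,1), [(71,10,[0,0,2,0]), (23,7,[0,0,1,1]), (69,9,[0,3,1,0]), (0,8,[0,1,3,2])]),
   ((3,4,9,2), [(0,9,[0,2,2,2]), (55,2,[0,0,1,1]), (52,9,[0,1,0,3]), (52,6,[0,1,3,2])]),
   ((3,4,9,3), [(61,7,[0,2,2,2]), (42,0,[0,1,0,1]), (71,4,[0,1,0,3]), (0,8,[0,1,3,2])]),
   ((3,4,9,4), [(39,0,[0,2,0,0]), (16,8,[0,0,1,1]), (1,7,[0,1,2,1]), (14,6,[0,1,3,2])]),
   ((3,4,9,5), [(0,0,[0,2,2,2]), (58,1,[0,3,2,3]), (72,9,[0,0,3,3]), (47,11,[0,1,3,2])]),
   ((3,4,9,6), [(50,0,[0,1,0,1]), (60,0,[0,2,2,0]), (1,2,[0,1,1,0]), (4,2,[0,2,1,3])]),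
   ((3,4,9,7), [(48,5,[0,0,0,2]), (53,9,[0,1,3,0]), (46,0,[0,0,1,1]), (44,8,[0,1,2,3])]),
   ((3,4,9,8), [(42,5,[0,0,0,0]), (64,6,[0,1,2,3]), (63,0,[0,1,3,2]), (50,4,[0,2,1,3])]),
   ((3,4,9,9), [(46,0,[0,0,1,1]), (69,5,[0,2,2,2]), (57,10,[0,1,0,3]), (40,3,[0,1,3,2])]),
   ((3,4,9,10), [(16,8,[0,0,1,1]), (39,0,[0,2,0,0]), (1,7,[0,1,2,1]), (14,6,[0,1,3,2])]),
   ((3,4,9,11), [(45,2,[0,1,0,1]), (45,6,[0,0,2,0]), (69,4,[0,1,2,1]), (61,8,[0,2,1,3])]),
   ((3,6,0,1), [(38,11,[0,2,2,2]), (38,7,[0,3,0,3]), (38,3,[0,2,1,1]), (40,5,[0,1,3,2])]),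
   ((3,6,0,4), [(53,0,[0,1,0,1]), (40,11,[0,0,0,2]), (55,3,[0,2,3,3]), (46,8,[0,1,3,2])]),
   ((3,6,0,7), [(44,7,[0,0,0,2]), (39,3,[0,0,1,3]), (39,6,[0,0,1,1]), (0,6,[0,2,1,3])]),
   ((3,6,0,10), [(38,10,[0,0,1,1]), (46,5,[0,0,2,2]), (43,11,[0,3,3,0]), (39,4,[0,2,1,3])]),
   ((3,6,9,1), [(38,11,[0,2,0,2]), (73,8,[0,1,1,0]), (46,2,[0,3,3,0]), (43,10,[0,1,3,2])]),
   ((3,6,9,4), [(45,6,[0,0,1,1]), (45,2,[0,0,2,2]), (45,4,[0,0,1,1]), (40,2,[0,2,1,3])]),
   ((3,6,9,7), [(49,8,[0,0,1,1]), (59,2,[0,1,0,1]), (49,9,[0,2,0,2]), (51,2,[0,1,2,3])]),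
   ((3,6,9,10), [(73,7,[0,1,1,0]), (68,11,[0,0,2,0]), (55,6,[0,1,0,3]), (63,1,[0,1,3,2])]),
   ((3,7,0,0), [(5,2,[0,0,1,3]), (47,3,[0,0,0,2]), (38,11,[0,0,1,1]), (43,10,[0,2,1,3])]),
   ((3,7,0,1), [(41,7,[0,0,0,0]), (59,10,[0,1,2,3]), (19,2,[0,3,2,1]), (6,10,[0,1,2,3])]),
   ((3,7,0,2), [(70,6,[0,0,1,1]), (52,9,[0,2,0,0]), (45,11,[0,1,3,0]), (3,0,[0,1,2,3])]),
   ((3,7,0,3), [(53,8,[0,0,2,0]), (41,3,[0,0,3,3]), (0,2,[0,1,0,3]), (46,7,[0,1,2,3])]),
   ((3,7,0,4), [(51,6,[0,0,2,2]), (10,6,[0,3,0,3]), (1,11,[0,3,3,0]), (2,10,[0,1,3,2])]),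
   ((3,7,0,5), [(5,8,[0,1,1,0]), (48,7,[0,0,2,0]), (5,9,[0,0,1,3]), (6,10,[0,1,2,3])]),
   ((3,7,0,6), [(47,0,[0,0,0,2]), (5,11,[0,1,1,0]), (38,8,[0,0,3,1]), (43,10,[0,2,1,3])]),
   ((3,7,0,7), [(51,6,[0,0,1,3]), (6,9,[0,0,0,2]), (68,0,[0,1,1,0]), (7,10,[0,2,1,3])]),
   ((3,7,0,8), [(38,10,[0,2,1,1]), (68,2,[0,2,2,2]), (59,9,[0,3,3,0]), (0,5,[0,2,1,3])]),
   ((3,7,0,9), [(61,10,[0,1,0,1]), (40,9,[0,0,1,1]), (2,8,[0,0,2,2]), (6,10,[0,1,2,3])]),
   ((3,7,0,10), [(45,2,[0,2,2,2]), (53,6,[0,0,1,1]), (18,6,[0,3,3,2]), (7,10,[0,1,3,2])]),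
   ((3,7,0,11), [(5,1,[0,1,1,0]), (62,7,[0,0,2,2]), (26,8,[0,3,0,3]), (50,1,[0,2,1,3])]),
   ((3,7,8,0), [(49,4,[0,2,0,0]), (58,10,[0,3,0,1]), (39,5,[0,1,0,1]), (0,5,[0,2,1,3])]),
   ((3,7,8,1), [(72,4,[0,0,0,2]), (12,3,[0,1,0,1]), (15,11,[0,0,3,1]), (8,8,[0,2,1,3])]),
   ((3,7,8,2), [(53,1,[0,1,0,1]), (54,8,[0,2,2,2]), (57,1,[0,1,2,1]), (3,4,[0,1,2,3])]),
   ((3,7,8,3), [(46,0,[0,0,2,0]), (54,6,[0,1,1,0]), (51,7,[0,0,3,1]), (2,2,[0,2,1,3])]),
   ((3,7,8,4), [(68,10,[0,1,0,3]), (41,8,[0,0,3,3]), (41,1,[0,0,2,0]), (14,8,[0,2,1,3])]),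
   ((3,7,8,5), [(4,9,[0,2,0,0]), (0,11,[0,1,1,0]), (35,10,[0,1,0,3]), (69,7,[0,1,2,3])]),
   ((3,7,8,6), [(38,9,[0,1,0,3]), (0,7,[0,2,2,2]), (0,8,[0,0,3,3]), (4,4,[0,2,1,3])]),
   ((3,7,8,7), [(43,8,[0,0,1,1]), (42,2,[0,3,0,3]), (41,3,[0,0,2,2]), (0,5,[0,1,3,2])]),
   ((3,7,8,8), [(73,6,[0,2,0,0]), (8,10,[0,3,3,2]), (43,1,[0,1,0,1]), (8,8,[0,2,1,3])]),
   ((3,7,8,9), [(39,8,[0,0,1,1]), (39,5,[0,0,2,0]), (44,5,[0,0,3,1]), (44,7,[0,2,1,3])]),
   ((3,7,8,10), [(65,0,[0,2,2,0]), (53,4,[0,1,0,1]), (46,7,[0,0,1,1]), (3,4,[0,1,2,3])]),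
   ((3,7,8,11), [(55,10,[0,0,0,2]), (44,2,[0,1,2,1]), (52,5,[0,1,1,0]), (8,8,[0,2,1,3])]),
   ((3,7,9,0), [(54,11,[0,0,2,0]), (50,10,[0,0,1,1]), (62,9,[0,3,1,0]), (57,5,[0,1,3,2])]),
   ((3,7,9,1), [(64,4,[0,0,0,2]), (0,2,[0,1,1,0]), (65,4,[0,3,2,3]), (7,1,[0,1,2,3])]),
   ((3,7,9,2), [(0,3,[0,0,1,1]), (0,4,[0,0,2,2]), (61,11,[0,0,1,1]), (41,6,[0,1,3,2])]),
   ((3,7,9,3), [(61,8,[0,0,1,1]), (63,7,[0,2,2,2]), (57,6,[0,3,0,1]), (41,4,[0,1,3,2])]),
   ((3,7,9,4), [(47,0,[0,2,2,2]), (67,7,[0,0,1,1]), (62,1,[0,3,3,2]), (47,9,[0,1,3,2])]),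
   ((3,7,9,5), [(1,11,[0,1,1,0]), (42,1,[0,2,2,2]), (16,10,[0,0,1,3]), (14,6,[0,1,3,2])]),
   ((3,7,9,6), [(74,1,[0,0,0,2]), (39,0,[0,1,2,1]), (0,8,[0,0,1,1]), (0,5,[0,2,1,3])]),
   ((3,7,9,7), [(60,11,[0,2,1,3]), (39,1,[0,0,0,0]), (48,7,[0,2,3,1]), (0,5,[0,2,1,3])]),
   ((3,7,9,8), [(58,7,[0,2,1,1]), (42,4,[0,2,2,2]), (43,7,[0,1,1,0]), (0,5,[0,2,1,3])]),
   ((3,7,9,9), [(72,5,[0,0,1,1]), (74,10,[0,0,2,0]), (65,0,[0,1,2,1]), (41,4,[0,1,3,2])]),
   ((3,7,9,10), [(67,8,[0,0,0,2]), (46,9,[0,3,3,0]), (67,1,[0,1,3,0]), (0,5,[0,2,1,3])]),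
   ((3,7,9,11), [(1,11,[0,1,1,0]), (42,1,[0,2,2,2]), (1,7,[0,1,3,0]), (14,6,[0,1,3,2])]),
   ((3,9,0,1), [(44,1,[0,0,0,2]), (39,9,[0,0,1,1]), (39,0,[0,0,3,1]), (8,0,[0,2,1,3])]),
   ((3,9,0,4), [(40,1,[0,0,0,0]), (39,1,[0,1,3,2]), (40,3,[0,1,3,2]), (73,10,[0,2,1,3])]),
   ((3,9,0,7), [(48,1,[0,1,2,1]), (46,8,[0,2,2,2]), (52,3,[0,1,0,1]), (44,5,[0,1,2,3])]),
   ((3,9,0,10), [(38,9,[0,0,1,1]), (38,1,[0,1,2,1]), (38,5,[0,2,2,2]), (40,11,[0,1,3,2])]),
   ((3,9,9,1), [(64,2,[0,1,1,0]), (56,5,[0,3,3,2]), (48,0,[0,2,2,2]), (38,4,[0,2,1,3])]),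
   ((3,9,9,4), [(59,4,[0,1,0,1]), (41,1,[0,0,2,0]), (54,8,[0,1,0,3]), (39,10,[0,1,2,3])]),
   ((3,9,9,7), [(38,4,[0,0,0,2]), (40,3,[0,3,3,0]), (59,7,[0,0,3,1]), (48,8,[0,2,1,3])]),
   ((3,9,9,10), [(40,7,[0,0,1,1]), (40,8,[0,0,0,2]), (38,5,[0,3,0,1]), (38,10,[0,2,1,3])]),
   ((3,10,0,0), [(52,2,[0,2,2,2]), (49,3,[0,3,2,3]), (51,10,[0,0,1,1]), (63,2,[0,2,1,3])]),
   ((3,10,0,1), [(54,6,[0,0,1,1]), (68,0,[0,2,2,2]), (1,0,[0,3,3,2]), (7,4,[0,2,1,3])]),
   ((3,10,0,2), [(55,8,[0,0,2,0]), (10,6,[0,3,0,3]), (18,5,[0,2,3,3]), (2,4,[0,1,3,2])]),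
   ((3,10,0,3), [(43,2,[0,0,1,1]), (64,0,[0,0,2,0]), (51,6,[0,1,0,3]), (41,10,[0,2,1,3])]),
   ((3,10,0,4), [(47,4,[0,1,1,0]), (45,1,[0,1,1,0]), (7,11,[0,0,2,2]), (7,4,[0,1,3,2])]),
   ((3,10,0,5), [(66,10,[0,0,0,2]), (7,3,[0,3,0,3]), (50,2,[0,0,1,3]), (7,4,[0,2,1,3])]),
   ((3,10,0,6), [(54,4,[0,0,2,2]), (6,1,[0,0,1,1]), (70,2,[0,0,1,1]), (56,8,[0,1,3,2])]),
   ((3,10,0,7), [(48,0,[0,0,2,2]), (19,6,[0,1,0,1]), (6,2,[0,3,0,3]), (7,4,[0,1,3,2])]),
   ((3,10,0,8), [(42,11,[0,0,0,2]), (22,8,[0,1,1,0]), (1,9,[0,3,1,0]), (6,4,[0,2,1,3])]),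
   ((3,10,0,9), [(47,6,[0,0,0,2]), (5,5,[0,0,3,3]), (38,8,[0,0,3,1]), (43,10,[0,2,1,3])]),
   ((3,10,0,10), [(0,2,[0,2,2,0]), (48,1,[0,3,3,0]), (22,8,[0,1,1,0]), (6,4,[0,2,1,3])]),
   ((3,10,0,11), [(2,9,[0,1,0,1]), (50,8,[0,0,3,1]), (66,4,[0,0,0,2]), (2,4,[0,2,1,3])]),
   ((3,10,8,0), [(41,4,[0,2,0,0]), (49,9,[0,1,1,0]), (56,0,[0,2,3,3]), (3,4,[0,1,2,3])]),
   ((3,10,8,1), [(39,3,[0,0,0,2]), (39,2,[0,1,3,0]), (0,8,[0,1,1,0]), (10,8,[0,1,2,3])]),
   ((3,10,8,2), [(42,0,[0,0,0,2]), (67,9,[0,3,0,1]), (23,4,[0,1,0,1]), (46,2,[0,2,1,3])]),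
   ((3,10,8,3), [(49,7,[0,2,0,0]), (39,2,[0,1,1,0]), (58,10,[0,3,0,1]), (0,2,[0,1,3,2])]),
   ((3,10,8,4), [(41,8,[0,0,2,0]), (4,5,[0,3,3,0]), (1,3,[0,2,1,1]), (3,4,[0,1,2,3])]),
   ((3,10,8,5), [(66,7,[0,2,0,0]), (43,8,[0,3,0,3]), (8,11,[0,3,3,2]), (10,8,[0,1,2,3])]),
   ((3,10,8,6), [(40,2,[0,2,2,0]), (59,8,[0,3,0,3]), (58,9,[0,1,1,0]), (58,2,[0,1,3,2])]),
   ((3,10,8,7), [(0,5,[0,2,2,2]), (63,0,[0,1,0,1]), (70,4,[0,2,1,1]), (0,2,[0,1,3,2])]),
   ((3,10,8,8), [(40,4,[0,1,1,0]), (4,6,[0,0,2,0]), (57,9,[0,0,1,3]), (2,8,[0,1,2,3])]),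
   ((3,10,8,9), [(0,7,[0,0,2,0]), (38,9,[0,3,0,1]), (0,2,[0,3,3,0]), (4,4,[0,2,1,3])]),
   ((3,10,8,10), [(48,4,[0,2,0,0]), (58,1,[0,1,0,3]), (19,11,[0,1,0,1]), (2,8,[0,1,2,3])]),
   ((3,10,8,11), [(65,8,[0,2,0,0]), (45,11,[0,3,0,3]), (54,3,[0,2,3,3]), (4,4,[0,1,2,3])]),
   ((3,10,9,0), [(50,6,[0,1,0,1]), (60,0,[0,2,2,0]), (16,11,[0,0,1,1]), (4,2,[0,2,1,3])]),
   ((3,10,9,1), [(0,5,[0,2,2,2]), (38,2,[0,0,3,3]), (0,10,[0,3,3,2]), (51,4,[0,1,2,3])]),
   ((3,10,9,2), [(42,3,[0,0,0,0]), (56,9,[0,2,3,1]), (55,6,[0,3,1,2]), (41,0,[0,1,2,3])]),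
   ((3,10,9,3), [(61,7,[0,2,2,0]), (42,0,[0,1,0,1]), (71,4,[0,3,0,3]), (0,2,[0,1,3,2])]),
   ((3,10,9,4), [(16,8,[0,0,1,1]), (39,0,[0,2,0,0]), (1,7,[0,1,2,1]), (14,6,[0,1,3,2])]),
   ((3,10,9,5), [(0,6,[0,0,2,0]), (0,2,[0,3,0,3]), (0,10,[0,3,1,0]), (41,6,[0,1,2,3])]),
   ((3,10,9,6), [(50,0,[0,1,0,1]), (60,0,[0,2,2,0]), (1,2,[0,1,1,0]), (4,2,[0,2,1,3])]),
   ((3,10,9,7), [(45,9,[0,0,2,2]), (57,11,[0,1,1,0]), (68,10,[0,0,1,1]), (2,7,[0,1,3,2])]),
   ((3,10,9,8), [(56,9,[0,2,2,2]), (56,5,[0,0,3,1]), (56,1,[0,0,3,3]), (52,6,[0,1,3,2])]),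
   ((3,10,9,9), [(67,8,[0,0,2,0]), (16,7,[0,0,1,1]), (4,10,[0,2,1,1]), (48,5,[0,1,2,3])]),
   ((3,10,9,10), [(71,7,[0,2,0,0]), (48,10,[0,3,1,0]), (60,11,[0,3,3,0]), (0,2,[0,2,1,3])]),
   ((3,10,9,11), [(0,6,[0,0,2,0]), (0,2,[0,3,0,3]), (0,10,[0,3,1,0]), (41,6,[0,1,2,3])])]"

section \<open>From the tables to all classes of the four generators\<close>

definition resolve :: "(nat \<times> int \<times> int list) list \<Rightarrow> block list" where
  "resolve = map (\<lambda>(i, sh, lab). (configs ! i, sh, lab))"

lemma configs_ok: "list_all config_ok configs"
  by code_simp

lemma table1_ok: "list_all (\<lambda>((wz, wo, ws), sol). sol_ok (wz, wo, ws, 0) (resolve sol)) table1"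
  by code_simp

lemma table2_ok: "list_all (\<lambda>(W, sol). sol_ok W (resolve sol)) table2"
  by code_simp

definition fund_free :: "config \<Rightarrow> bool" where
  "fund_free = (\<lambda>(ps, ds). list_all (\<lambda>(k, a, b, c). c = 0) (ps @ ds))"

lemma length_configs: "length configs = 76"
  by (simp add: configs_def)

lemma fund_free_configs: "list_all fund_free (take 38 configs)"
  by (simp add: configs_def fund_free_def)

lemma table1_index: "list_all (\<lambda>(W, sol). list_all (\<lambda>(i, sh, lab). i < 38) sol) table1"
  by (simp add: table1_def)

lemma table2_index: "list_all (\<lambda>(W, sol). list_all (\<lambda>(i, sh, lab). i < 76) sol) table2"
  by (simp add: table2_def)

definition solvable :: "cyc \<Rightarrow> bool" where
  "solvable W \<longleftrightarrow> (\<exists>bs. sol_ok W bs \<and> (\<forall>b\<in>set bs. config_ok (fst b)))"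

lemma set_resolve: "list_all (\<lambda>(i, sh, lab). P i) sol \<Longrightarrow> b \<in> set (resolve sol) \<Longrightarrow> \<exists>i. P i \<and> fst b = configs ! i"
  by (auto simp: resolve_def list_all_iff)

lemma unit_class_fund_free:
  assumes "\<And>f. f \<in> set fs \<Longrightarrow> snd (snd (snd f)) = 0"
  shows "map (\<lambda>f. (unit_class (wz, wo, ws, we) f + sh) mod 12) fs = map (\<lambda>f. (unit_class (wz, wo, ws, 0) f + sh) mod 12) fs"
proof (rule map_cong[OF refl])
  fix f assume "f \<in> set fs"
  then obtain k a b where "f = (k, a, b, 0)"
    using assms by (metis prod.collapse)
  then show "(unit_class (wz, wo, ws, we) f + sh) mod 12 = (unit_class (wz, wo, ws, 0) f + sh) mod 12"
    by simp
qed

text \<open>Without the factor \<open>w\<close> no check depends on its class, so a solution tested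
  for class 0 is valid for every class.\<close>

lemma sol_ok_fund_free:
  assumes "sol_ok (wz, wo, ws, 0) bs" "\<And>b. b \<in> set bs \<Longrightarrow> fund_free (fst b)"
  shows "sol_ok (wz, wo, ws, we) bs"
proof -
  have "point_classes (wz, wo, ws, we) b = point_classes (wz, wo, ws, 0) b \<and>
      diff_classes (wz, wo, ws, we) b = diff_classes (wz, wo, ws, 0) b" if "b \<in> set bs" for b
  proof -
    obtain ps ds sh lab where b: "b = ((ps, ds), sh, lab)"
      by (metis prod.collapse)
    have free: "snd (snd (snd f)) = 0" if "f \<in> set ps \<or> f \<in> set ds" for f
      using assms(2)[OF \<open>b \<in> set bs\<close>] that by (cases f) (fastforce simp: b fund_free_def list_all_iff)
    then show ?thesis
      using unit_class_fund_free[of ps wz wo ws we sh] unit_class_fund_free[of ds wz wo ws we sh]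
      by (simp add: b point_classes_def diff_classes_def)
  qed
  then have eq: "map (diff_classes (wz, wo, ws, we)) bs = map (diff_classes (wz, wo, ws, 0)) bs"
    "map (point_classes (wz, wo, ws, we)) (take 3 bs) = map (point_classes (wz, wo, ws, 0)) (take 3 bs)"
    by (auto dest: in_set_takeD)
  show ?thesis
    using assms(1) unfolding sol_ok_def eq .
qed

lemma config_ok_nth: "i < 76 \<Longrightarrow> config_ok (configs ! i)"
  using configs_ok by (simp add: list_all_length length_configs)

lemma fund_free_nth:
  assumes "i < 38" shows "fund_free (configs ! i)"
proof -
  have "fund_free (take 38 configs ! i)"
    using fund_free_configs assms unfolding list_all_length by (simp add: length_configs)
  then show ?thesis
    using assms by simp
qed

lemma solvable_table1:
  assumes "(wz, wo, ws) \<in> set (map fst table1)" shows "solvable (wz, wo, ws, we)"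
proof -
  obtain sol where sol: "((wz, wo, ws), sol) \<in> set table1"
    using assms by auto
  then have ok: "sol_ok (wz, wo, ws, 0) (resolve sol)"
    and idx: "list_all (\<lambda>(i, sh, lab). i < 38) sol"
    using table1_ok table1_index unfolding list_all_iff by blast+
  have "fund_free (fst b) \<and> config_ok (fst b)" if b: "b \<in> set (resolve sol)" for b
  proof -
    obtain i where "i < 38" "fst b = configs ! i"
      using set_resolve[of "\<lambda>i. i < 38", OF idx b] by blast
    then show ?thesis
      by (simp add: fund_free_nth config_ok_nth)
  qed
  then show ?thesis
    unfolding solvable_def using sol_ok_fund_free[OF ok] by blast
qed

lemma solvable_table2:
  assumes "W \<in> set (map fst table2)" shows "solvable W"
proof -
  obtain sol where sol: "(W, sol) \<in> set table2"
    using assms by auto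
  then have ok: "sol_ok W (resolve sol)"
    and idx: "list_all (\<lambda>(i, sh, lab). i < 76) sol"
    using table2_ok table2_index unfolding list_all_iff by blast+
  have "config_ok (fst b)" if b: "b \<in> set (resolve sol)" for b
  proof -
    obtain i where "i < 76" "fst b = configs ! i"
      using set_resolve[of "\<lambda>i. i < 76", OF idx b] by blast
    then show ?thesis
      by (simp add: config_ok_nth)
  qed
  then show ?thesis
    unfolding solvable_def using ok by blast
qed

text \<open>The keys are narrowed coordinate by coordinate to keep the evaluation short.\<close>

fun select :: "'a \<Rightarrow> ('a \<times> 'b) list \<Rightarrow> 'b list" where
  "select x [] = []"
| "select x ((y, r) # ys) = (if x = y then r # select x ys else select x ys)"

lemma set_select: "r \<in> set (select x ys) \<longleftrightarrow> (x, r) \<in> set ys"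
  by (induction x ys rule: select.induct) auto

text \<open>The flag \<open>z\<close> records that the digits of the three earlier classes vanish;
  then a class of \<open>w\<close> with digit 0 belongs to an excluded key. The factor 5 accounts
  for the reversed sign of the digits.\<close>

definition cover4 :: "bool \<Rightarrow> int list \<Rightarrow> int list \<Rightarrow> int \<Rightarrow> bool" where
  "cover4 z K K' we \<longleftrightarrow> z \<and> we mod 3 = 0 \<or> we \<in> set K \<or> 5 * we mod 12 \<in> set K'"

definition cover3 where
  "cover3 z K1 K1' K2 K2' ws \<longleftrightarrow> ws \<in> set K1 \<or> 5 * ws mod 12 \<in> set K1' \<or>
    list_all (cover4 (z \<and> ws mod 3 = 0) (select ws K2) (select (5 * ws mod 12) K2')) [0..11]"

definition cover2 where
  "cover2 z K1 K1' K2 K2' wo \<longleftrightarrow> list_all (cover3 (z \<and> wo mod 3 = 0)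
    (select wo K1) (select (5 * wo mod 12) K1') (select wo K2) (select (5 * wo mod 12) K2')) [0, 1, 4, 5, 8, 9]"

definition cover1 where
  "cover1 K1 K2 wz \<longleftrightarrow> list_all (cover2 (wz mod 3 = 0)
    (select wz K1) (select (5 * wz mod 12) K1) (select wz K2) (select (5 * wz mod 12) K2)) [0..11]"

lemma tables_cover: "list_all (cover1 (map fst table1) (map fst table2)) [3, 7, 11]"
  by code_simp

text \<open>This is the normal form reached below: residues modulo 4 of the logarithms of
  \<open>z\<close> and of the square root of 3 are restricted by the choice of \<open>z\<close>, and
  some digit is non-zero by the choice of \<open>G\<close>. The two alternatives are the two values
  of \<open>u\<close>.\<close>

lemma solvable_cover:
  fixes wz wo ws we :: int
  assumes "wz \<in> {0..11}" "wo \<in> {0..11}" "ws \<in> {0..11}" "we \<in> {0..11}" "wz mod 4 = 3" "ws mod 4 \<in> {0, 1}"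
    "\<not> (wz mod 3 = 0 \<and> wo mod 3 = 0 \<and> ws mod 3 = 0 \<and> we mod 3 = 0)"
  shows "solvable (wz, wo, ws, we) \<or> solvable (5 * wz mod 12, 5 * wo mod 12, 5 * ws mod 12, 5 * we mod 12)"
proof -
  have "wz \<in> set [3, 7, 11]"
    using assms(1,5) by simp presburger
  moreover have "wo \<in> set [0..11]" "we \<in> set [0..11]"
    using assms by auto
  moreover have "ws \<in> set [0, 1, 4, 5, 8, 9]"
    using assms(3,6) by simp presburger
  ultimately have "(wz, wo, ws) \<in> set (map fst table1) \<or>
    (5 * wz mod 12, 5 * wo mod 12, 5 * ws mod 12) \<in> set (map fst table1) \<or>
    (wz, wo, ws, we) \<in> set (map fst table2) \<or>
    (5 * wz mod 12, 5 * wo mod 12, 5 * ws mod 12, 5 * we mod 12) \<in> set (map fst table2)"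
    using tables_cover assms(7)
    unfolding list_all_iff cover1_def cover2_def cover3_def cover4_def set_select by blast
  then show ?thesis
    using solvable_table1 solvable_table2 by blast
qed

section \<open>Primitive twelfth roots of unity modulo p\<close>

lemma (in prime_log) cyclotomic_root:
  assumes t: "n = 12 * int t" "0 < t" and v: "odd v" "\<not> 3 dvd v" and z: "z = E (int t * v)"
  shows "[z ^ 4 - z\<^sup>2 + 1 = 0] (mod int p)"
proof -
  have pow: "[z ^ i = 1] (mod int p) \<longleftrightarrow> 12 dvd int i * v" for i
  proof -
    have "[z ^ i = E (int i * (int t * v))] (mod int p)"
      unfolding z by (rule cong_sym[OF E_power])
    then have "[z ^ i = 1] (mod int p) \<longleftrightarrow> [E (int i * (int t * v)) = E 0] (mod int p)"
      using cong_sym cong_trans by (metis E_def mod_0 nat_zero_as_int of_nat_0 nat_int power_0)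
    also have "\<dots> \<longleftrightarrow> int t * 12 dvd int t * (int i * v)"
      unfolding E_cong_iff t(1) by (simp add: cong_0_iff ac_simps)
    also have "\<dots> \<longleftrightarrow> 12 dvd int i * v"
      using t(2) by simp
    finally show ?thesis .
  qed
  \<comment> \<open>Since \<open>z^12 = 1\<close> while \<open>z^6\<close> and \<open>z^4\<close>
    differ from 1, only the cyclotomic factor of \<open>z^6 + 1 = (z^2 + 1) (z^4 - z^2 + 1)\<close>
    can vanish.\<close>
  have "int p dvd (z ^ 6 - 1) * (z ^ 6 + 1)"
    using pow[of 12] by (simp add: cong_iff_dvd_diff algebra_simps flip: power_add)
  moreover have "\<not> 12 dvd int 6 * v" "\<not> 12 dvd int 4 * v"
    using v by presburger+
  then have "\<not> int p dvd z ^ 6 - 1" "\<not> int p dvd z ^ 4 - 1"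
    using pow[of 6] pow[of 4] by (simp_all add: cong_iff_dvd_diff)
  ultimately have "int p dvd z ^ 6 + 1"
    using unit_mult by blast
  moreover have "z ^ 6 + 1 = (z\<^sup>2 + 1) * (z ^ 4 - z\<^sup>2 + 1)" "z ^ 4 - 1 = (z\<^sup>2 + 1) * (z\<^sup>2 - 1)"
    by (simp_all add: eval_nat_numeral algebra_simps)
  ultimately have "int p dvd z ^ 4 - z\<^sup>2 + 1"
    using \<open>\<not> int p dvd z ^ 4 - 1\<close> unit_mult by metis
  then show ?thesis
    by (simp add: cong_0_iff)
qed

text \<open>Modulo the cyclotomic polynomial the three numbers divide 2, 3 and 1 respectively, and
  \<open>p > 12\<close>.\<close>

lemma (in prime_log) cyclotomic_units:
  assumes t: "n = 12 * int t" and zeta: "[z ^ 4 - z\<^sup>2 + 1 = 0] (mod int p)"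
  shows "\<not> int p dvd 1 + z ^ 3" "\<not> int p dvd 2 * z - z ^ 3" "\<not> int p dvd 1 + z - z\<^sup>2 - z ^ 3"
proof -
  have Phi: "int p dvd z ^ 4 - z\<^sup>2 + 1"
    using zeta by (simp add: cong_0_iff)
  have "12 < int p"
    using t n_pos by presburger
  then have small: "\<not> int p dvd 2" "\<not> int p dvd 3" "\<not> int p dvd 1"
    using zdvd_imp_le[of "int p"] by fastforce+
  have "(1 + z ^ 3) * (1 - z ^ 3) = 2 - (z\<^sup>2 + 1) * (z ^ 4 - z\<^sup>2 + 1)"
    "(2 * z - z ^ 3) * (2 * z - z ^ 3) = 3 + (z\<^sup>2 - 3) * (z ^ 4 - z\<^sup>2 + 1)"
    "(1 + z - z\<^sup>2 - z ^ 3) * (- 1 + z + z\<^sup>2 - z ^ 3) = 1 + (z\<^sup>2 - 2) * (z ^ 4 - z\<^sup>2 + 1)"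
    by (simp_all add: eval_nat_numeral algebra_simps)
  then have "\<not> int p dvd (1 + z ^ 3) * (1 - z ^ 3)" "\<not> int p dvd (2 * z - z ^ 3) * (2 * z - z ^ 3)"
    "\<not> int p dvd (1 + z - z\<^sup>2 - z ^ 3) * (- 1 + z + z\<^sup>2 - z ^ 3)"
    using small Phi by (simp_all add: dvd_diff_left_iff dvd_add_left_iff)
  then show "\<not> int p dvd 1 + z ^ 3" "\<not> int p dvd 2 * z - z ^ 3" "\<not> int p dvd 1 + z - z\<^sup>2 - z ^ 3"
    unfolding unit_mult by blast+
qed

text \<open>Replacing \<open>z\<close> by \<open>z\<^sup>5\<close> changes the sign of \<open>\<surd>3 = 2 z - z\<^sup>3\<close>, which shifts its logarithm by 2 modulo 4.\<close>

lemma (in prime_log) ex_cyclotomic_root: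
  assumes t: "n = 12 * int t" "odd t"
  obtains z v where "\<not> int p dvd z" "[z ^ 4 - z\<^sup>2 + 1 = 0] (mod int p)" "[L z = int t * v] (mod n)" "\<not> 3 dvd v"
    "L z mod 4 = 3" "L (2 * z - z ^ 3) mod 4 \<in> {0, 1}"
proof -
  have t0: "0 < t" using t(2) by (cases t) auto
  have mod4: "x mod 4 = y mod 4" if "[x = y] (mod n)" for x y
    using cong_dvd_modulus[OF that, of 4] by (simp add: t(1) cong_def)
  \<comment> \<open>This \<open>v\<close> is odd and 1 modulo 3, hence prime to 12, and
    \<open>t v\<close> is congruent to \<open>3 t^2\<close>, that is to 3, modulo 4. Multiplying by
    5 keeps the residue modulo 4.\<close>
  define v where "v = 3 * int t + 4"
  define z where "z = E (int t * v)"
  define z' where "z' = E (int t * (5 * v))"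
  have v: "odd v" "\<not> 3 dvd v" "odd (5 * v)" "\<not> 3 dvd 5 * v"
    using t(2) by (auto simp: v_def) presburger+
  have zeta: "[z ^ 4 - z\<^sup>2 + 1 = 0] (mod int p)" and zeta': "[z' ^ 4 - z'\<^sup>2 + 1 = 0] (mod int p)"
    using cyclotomic_root[OF t(1) t0] v z_def z'_def by blast+
  have log: "[L z = int t * v] (mod n)" "[L z' = int t * (5 * v)] (mod n)"
    unfolding z_def z'_def by (rule L_E)+
  obtain r where r: "int t = 2 * r + 1"
    using t(2) by (metis odd_iff_mod_2_eq_one oddE even_of_nat)
  have "int t * v = 4 * (3 * r * r + 5 * r + 1) + 3"
    by (simp add: v_def r algebra_simps)
  moreover have "int t * (5 * v) = 4 * (5 * (3 * r * r + 5 * r + 1) + 3) + 3"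
    by (simp add: v_def r algebra_simps)
  ultimately have tv: "int t * v mod 4 = 3" "int t * (5 * v) mod 4 = 3"
    by (simp_all only: mod_mult_self4) simp_all
  then have log4: "L z mod 4 = 3" "L z' mod 4 = 3"
    using mod4[OF log(1)] mod4[OF log(2)] by simp_all
  let ?s = "2 * z - z ^ 3" and ?s' = "2 * z' - z' ^ 3"
  have s_unit: "\<not> int p dvd ?s" "\<not> int p dvd ?s'"
    using cyclotomic_units(2)[OF t(1)] zeta zeta' by blast+
  have "int p dvd z ^ 5 - (z ^ 3 - z)"
  proof -
    have "z ^ 5 - (z ^ 3 - z) = z * (z ^ 4 - z\<^sup>2 + 1)"
      by (simp add: eval_nat_numeral algebra_simps)
    then show ?thesis
      using zeta by (simp add: cong_0_iff)
  qed
  moreover have "[z' = z ^ 5] (mod int p)"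
    using E_power[of 5 "int t * v"] by (simp add: z_def z'_def ac_simps)
  ultimately have z': "[z' = z ^ 3 - z] (mod int p)"
    using cong_trans cong_iff_dvd_diff by blast
  have "[?s' = 2 * (z ^ 3 - z) - (z ^ 3 - z) ^ 3] (mod int p)"
    by (intro cong_diff cong_scalar_left cong_pow z')
  moreover have "2 * (z ^ 3 - z) - (z ^ 3 - z) ^ 3 - (- ?s) = z ^ 3 * (2 - z\<^sup>2) * (z ^ 4 - z\<^sup>2 + 1)"
    by (simp add: eval_nat_numeral algebra_simps)
  then have "[2 * (z ^ 3 - z) - (z ^ 3 - z) ^ 3 = - ?s] (mod int p)"
    using zeta by (simp add: cong_iff_dvd_diff cong_0_iff)
  ultimately have s': "[?s' = - ?s] (mod int p)"
    by (rule cong_trans)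
  \<comment> \<open>Writing -1 as \<open>z^6\<close> gives it the logarithm \<open>6 L z\<close>,
    which is 18, that is 2, modulo 4.\<close>
  have "z ^ 6 - (- 1) = (z\<^sup>2 + 1) * (z ^ 4 - z\<^sup>2 + 1)"
    by (simp add: eval_nat_numeral algebra_simps)
  then have "[z ^ 6 = - 1] (mod int p)"
    using zeta by (simp add: cong_iff_dvd_diff cong_0_iff)
  then have "[z ^ 6 * ?s = - 1 * ?s] (mod int p)"
    by (rule cong_scalar_right)
  then have "[z ^ 6 * ?s = - ?s] (mod int p)"
    by simp
  then have "[?s' = z ^ 6 * ?s] (mod int p)"
    using s' cong_sym cong_trans by blast
  moreover have z_unit: "\<not> int p dvd z" "\<not> int p dvd z'"
    unfolding z_def z'_def by (rule E_unit)+
  ultimately have "[L ?s' = L (z ^ 6 * ?s)] (mod n)"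
    using L_cong s_unit by blast
  moreover have "[L (z ^ 6 * ?s) = int 6 * L z + L ?s] (mod n)"
    using cong_trans[OF L_mult[OF unit_power[OF z_unit(1)] s_unit(1)] cong_add[OF L_power[OF z_unit(1)] cong_refl]] .
  ultimately have "[L ?s' = int 6 * L z + L ?s] (mod n)"
    by (rule cong_trans)
  then have "L ?s' mod 4 = (6 * L z + L ?s) mod 4"
    using mod4 by simp
  then have "L ?s mod 4 \<in> {0, 1} \<or> L ?s' mod 4 \<in> {0, 1}"
    using log4(1) by simp presburger
  then show ?thesis
    by (rule disjE[OF _ that[OF z_unit(1) zeta log(1) v(2) log4(1)] that[OF z_unit(2) zeta' log(2) v(4) log4(2)]])
qed

lemma crc_base_4:
  assumes "prime p" "p = 12 * t + 1" "odd t" shows "crc_base 4 p"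
proof -
  obtain g where "prime_log p g"
    using ex_primroot[OF assms(1)] by blast
  then interpret prime_log p g .
  have n: "n = 12 * int t"
    using assms(2) by simp
  obtain z v where z: "\<not> int p dvd z" "[z ^ 4 - z\<^sup>2 + 1 = 0] (mod int p)" "[L z = int t * v] (mod n)" "\<not> 3 dvd v"
    "L z mod 4 = 3" "L (2 * z - z ^ 3) mod 4 \<in> {0, 1}"
    using ex_cyclotomic_root[OF n assms(3)] .
  let ?x = "[z, 1 + z ^ 3, 2 * z - z ^ 3, 1 + z - z\<^sup>2 - z ^ 3]"
  note units = z(1) cyclotomic_units[OF n z(2)]
  define a b c d where "a = L z" and "b = L (1 + z ^ 3)" and "c = L (2 * z - z ^ 3)" and "d = L (1 + z - z\<^sup>2 - z ^ 3)"
  \<comment> \<open>With \<open>G\<close> the exact power of 3 in this gcd, all four logarithms are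
    multiples of \<open>3 ^ G\<close>, so all four numbers have classes, and their digits at
    \<open>G\<close> do not all vanish.\<close>
  define e where "e = gcd a (gcd b (gcd c d))"
  have "a \<noteq> 0"
    using z(5) by (auto simp: a_def)
  then have "0 < e"
    by (simp add: e_def)
  then obtain G where G: "3 ^ G dvd nat e" "\<not> 3 ^ (G + 1) dvd nat e"
    using ex_exact_power[of "nat e" 3] by auto
  have dvd_e: "3 ^ i dvd nat e \<longleftrightarrow> 3 ^ i dvd a \<and> 3 ^ i dvd b \<and> 3 ^ i dvd c \<and> 3 ^ i dvd d" for i
  proof -
    have "3 ^ i dvd nat e \<longleftrightarrow> int (3 ^ i) dvd int (nat e)"
      by (simp only: int_dvd_int_iff)
    also have "\<dots> \<longleftrightarrow> 3 ^ i dvd e"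
      using \<open>0 < e\<close> by simp
    also have "\<dots> \<longleftrightarrow> 3 ^ i dvd a \<and> 3 ^ i dvd b \<and> 3 ^ i dvd c \<and> 3 ^ i dvd d"
      by (simp add: e_def)
    finally show ?thesis .
  qed
  have dvd: "3 ^ G dvd a" "3 ^ G dvd b" "3 ^ G dvd c" "3 ^ G dvd d"
    using G(1) dvd_e by blast+
  \<comment> \<open>The logarithm of \<open>z\<close> is \<open>t\<close> times a number prime to 3,
    so the whole power of 3 divides \<open>t\<close>.\<close>
  have "3 ^ G dvd t"
  proof -
    obtain q where "L z = int t * v + 12 * int t * q"
      using z(3) unfolding n by (metis cong_iff_lin cong_sym)
    then have a: "a = int t * (v + 12 * q)"
      by (simp add: a_def algebra_simps)
    have "\<not> 3 dvd v + 12 * q"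
      using z(4) by presburger
    then have "coprime (3 ^ G) (v + 12 * q)"
      by (intro coprime_power_left_iff[THEN iffD2] disjI1 prime_imp_coprime) auto
    then have "3 ^ G dvd int t"
      using dvd(1) unfolding a by (simp add: coprime_dvd_mult_left_iff)
    then show ?thesis
      by (metis int_dvd_int_iff of_nat_numeral of_nat_power)
  qed
  then have cyc: "cyc_prime p g t G u z" if "u = 1 \<or> u = 5" for u
    unfolding cyc_prime_def cyc_prime_axioms_def using that assms(2,3) z(2) prime_log_axioms by blast
  \<comment> \<open>This is \<open>Psi\<close> for \<open>u = 1\<close>. The coefficients are the
    idempotents modulo 12: 9 is 1 modulo 4 and 0 modulo 3, and 4 is the reverse. The factor
    \<open>u = 5\<close> is 1 modulo 4 and -1 modulo 3.\<close>
  define K where "K x = (9 * x + 4 * (x div 3 ^ G)) mod 12" for x :: int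
  have finish: "crc_base 4 p" if u: "u = 1 \<or> u = 5"
    and sol: "solvable (u * K a mod 12, u * K b mod 12, u * K c mod 12, u * K d mod 12)" for u
  proof -
    interpret C: cyc_prime p g t G u z
      using cyc u .
    have cls: "C.has_class x (u * K (L x) mod 12)" if "\<not> int p dvd x" "3 ^ G dvd L x" for x
    proof -
      have "C.has_class x (C.Psi (L x))"
        using C.has_classI[OF E_L[OF that(1)] that(2)] .
      moreover have "C.Psi (L x) = u * K (L x) mod 12"
        by (simp add: C.Psi_def K_def mod_mult_right_eq)
      ultimately show ?thesis by simp
    qed
    obtain bs where "sol_ok (u * K a mod 12, u * K b mod 12, u * K c mod 12, u * K d mod 12) bs"
      "\<forall>b\<in>set bs. config_ok (fst b)"
      using sol unfolding solvable_def by blast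
    then show ?thesis
      using C.crc_base_sol[OF cls[OF units(1)] cls[OF units(2)] cls[OF units(3)] cls[OF units(4)]] dvd
      unfolding a_def b_def c_def d_def by blast
  qed
  have K: "K x \<in> {0..11}" "K x mod 4 = x mod 4" for x
  proof -
    show "K x \<in> {0..11}"
      unfolding K_def by simp
    have "(9 * x + 4 * y) mod 12 mod 4 = x mod 4" for y :: int
      by presburger
    then show "K x mod 4 = x mod 4"
      by (simp only: K_def)
  qed
  have K3: "3 ^ (G + 1) dvd x" if "3 ^ G dvd x" "K x mod 3 = 0" for x
  proof -
    from that(1) obtain y where y: "x = 3 ^ G * y"
      by blast
    have "(9 * w + 4 * y) mod 12 mod 3 = 0 \<Longrightarrow> 3 dvd y" for w :: int
      by presburger
    then have "3 dvd y"
      using that(2) by (simp add: K_def y)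
    then show ?thesis
      by (simp add: y mult.commute mult_dvd_mono)
  qed
  have "\<not> (K a mod 3 = 0 \<and> K b mod 3 = 0 \<and> K c mod 3 = 0 \<and> K d mod 3 = 0)"
    using G(2) K3[OF dvd(1)] K3[OF dvd(2)] K3[OF dvd(3)] K3[OF dvd(4)] unfolding dvd_e by argo
  then have "solvable (K a, K b, K c, K d) \<or>
      solvable (5 * K a mod 12, 5 * K b mod 12, 5 * K c mod 12, 5 * K d mod 12)"
    using z(5,6) by (intro solvable_cover K(1)) (simp_all add: K(2) a_def c_def)
  moreover have "1 * K x mod 12 = K x" for x
    by (simp add: K_def)
  ultimately show ?thesis
    using finish[of 1] finish[of 5] by auto
qed

lemma crc_base_case2: "prime p \<Longrightarrow> case2 k p \<Longrightarrow> crc_base k p"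
  using crc_base_4 unfolding case2_def by blast

theorem theorem4:
  fixes k :: nat
  shows
    "(\<forall>p. prime p \<and>
          (case1 k p \<or> case2 k p \<or> case3a k p \<or> case3b k p \<or> case4 k p \<or> case5 k p)
        \<longrightarrow> crc_ldpc_result k p) \<and>
     (\<forall>l. (k \<in> {3, 5, 7, 9} \<and> 1 < l \<and>
           (\<forall>q\<in>prime_factors l. [q = 1] (mod k * (k - 1)) \<and>
              (case1 k q \<or> case3a k q \<or> case3b k q \<or> case4 k q \<or> case5 k q)))
        \<longrightarrow> crc_ldpc_result k l) \<and>
     (\<forall>l. (k = 4 \<and> 1 < l \<and> (\<forall>q\<in>prime_factors l. \<exists>t>0. odd t \<and> q = 12 * t + 1))
        \<longrightarrow> crc_ldpc_result k l)"
proof (intro conjI allI impI)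
  fix p assume "prime p \<and> (case1 k p \<or> case2 k p \<or> case3a k p \<or> case3b k p \<or> case4 k p \<or> case5 k p)"
  then show "crc_ldpc_result k p"
    using crc_base_case1 crc_base_case2 crc_base_case3a crc_base_case3b crc_base_case4 crc_base_case5
      crc_base_result by blast
next
  fix l :: nat assume l: "k \<in> {3, 5, 7, 9} \<and> 1 < l \<and> (\<forall>q\<in>prime_factors l. [q = 1] (mod k * (k - 1)) \<and>
    (case1 k q \<or> case3a k q \<or> case3b k q \<or> case4 k q \<or> case5 k q))"
  have "k < q \<and> crc_base k q" if "q \<in> prime_factors l" for q
  proof
    have c: "case1 k q \<or> case3a k q \<or> case3b k q \<or> case4 k q \<or> case5 k q" and q: "prime q"
      using l that by auto
    show "crc_base k q"
      using c crc_base_case1[OF q] crc_base_case3a[OF q] crc_base_case3b[OF q] crc_base_case4[OF q]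
        crc_base_case5[OF q] by blast
    \<comment> \<open>In every case \<open>q\<close> is \<open>k (k - 1) t + 1\<close> with
      \<open>t > 0\<close>, or one of the listed primes above 9.\<close>
    show "k < q"
      using c by (auto simp: case1_def case3a_def case3b_def case4_def case5_def)
  qed
  then have "crc_base k l"
    using l by (intro crc_base_prod) auto
  then show "crc_ldpc_result k l"
    by (rule crc_base_result)
next
  fix l :: nat assume l: "k = 4 \<and> 1 < l \<and> (\<forall>q\<in>prime_factors l. \<exists>t>0. odd t \<and> q = 12 * t + 1)"
  have "k < q \<and> crc_base k q" if q: "q \<in> prime_factors l" for q
  proof -
    obtain t where "0 < t" "odd t" "q = 12 * t + 1"
      using l q by blast
    then show ?thesis
      using crc_base_4[of q t] q l by auto
  qed
  then have "crc_base k l"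
    using l by (intro crc_base_prod) auto
  then show "crc_ldpc_result k l"
    by (rule crc_base_result)
qed

end
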